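(* There exist universal constants $C\ge 2$ and $0<\gamma<1$ such that for every $0<\varepsilon\le 1/(2C)$ the following holds. Let $1\le n\le N$ be integers and let $K\subset\mathbb{R}^N$ be a convex body containing the origin in its interior. Then for every integer $1\le k\le n$ and every linear subspace $E\subset\mathbb{R}^N$ of codimension $k$, one has $$\mathcal{R}_n(K)\le \left(\frac{6\sqrt{\log(1/\varepsilon)}}{\varepsilon}\sqrt{\frac{2n}{n-k+1}}\right)R(P_EK)+\frac{2\sqrt n}{\varepsilon(n-k+1)}\,\ell_*(P_EK)$$ with probability at least $$1-3(C\varepsilon)^{n-k+1}-k e^{-\gamma n}.$$
   Context: $|\cdot|$ is the Euclidean norm on $\mathbb{R}^N$. A convex body is a compact convex set containing the origin in its interior (it need not be symmetric). For a compact set $T$ put $R(T)=\max_{y\in T}|y|$. $P_E$ is the orthogonal projection onto $E$. For a nonempty set $T\subset\mathbb{R}^N$, $\ell_*(T)=\mathbb{E}\sup_{x\in T}\langle G,x\rangle$, where $G$ is a standard Gaussian vector in $\mathbb{R}^N$. The $n$-th random radius is the random variable $\mathcal{R}_n(K)=\max_{y\in E_n\cap K}|y|$, where $E_n$ is a random $n$-codimensional linear subspace of $\mathbb{R}^N$ distributed according to the normalized Haar (rotation invariant) measure on the Grassmannian of $n$-codimensional subspaces. Probability is with respect to $E_n$. *)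

theory Defs
  imports "HOL-Probability.Probability" "HOL-Library.Function_Algebras"
begin

text \<open>
  The dimension \<open>N\<close> is quantified inside the theorem (the constants must not depend on it), so
  \<open>R^N\<close> cannot be a type. As in the library's \<^const>\<open>Euclidean_space\<close>, it is the set of
  sequences \<open>nat \<Rightarrow> real\<close> vanishing from index \<open>N\<close> on. The pointwise vector space structure makes
  \<^const>\<open>subspace\<close>, \<^const>\<open>dim\<close>, \<^const>\<open>convex\<close> and \<^const>\<open>linear\<close> available on sequences.
\<close>

instantiation "fun" :: (type, real_vector) real_vector
begin

definition scaleR_fun :: "real \<Rightarrow> ('a \<Rightarrow> 'b) \<Rightarrow> 'a \<Rightarrow> 'b"
  where "scaleR_fun c f = (\<lambda>x. c *\<^sub>R f x)"

instance
  by standard (auto simp: scaleR_fun_def fun_eq_iff algebra_simps)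

end

abbreviation RN :: "nat \<Rightarrow> (nat \<Rightarrow> real) set"
  where "RN N \<equiv> topspace (Euclidean_space N)"

definition inner_N :: "nat \<Rightarrow> (nat \<Rightarrow> real) \<Rightarrow> (nat \<Rightarrow> real) \<Rightarrow> real"
  where "inner_N N x y = (\<Sum>i<N. x i * y i)"

definition norm_N :: "nat \<Rightarrow> (nat \<Rightarrow> real) \<Rightarrow> real"
  where "norm_N N x = sqrt (inner_N N x x)"

definition convex_body :: "nat \<Rightarrow> (nat \<Rightarrow> real) set \<Rightarrow> bool"
  where "convex_body N K \<longleftrightarrow>
    compactin (Euclidean_space N) K \<and> convex K \<and> 0 \<in> Euclidean_space N interior_of K"

text \<open>For nonempty compact sets the supremum is a maximum.\<close>

definition radius :: "nat \<Rightarrow> (nat \<Rightarrow> real) set \<Rightarrow> real"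
  where "radius N T = (SUP y\<in>T. norm_N N y)"

definition grassmannian :: "nat \<Rightarrow> nat \<Rightarrow> (nat \<Rightarrow> real) set set"
  where "grassmannian N n = {E. subspace E \<and> E \<subseteq> RN N \<and> dim E + n = N}"
  \<comment> \<open>\<open>n\<close> is the codimension\<close>

definition orth_proj :: "nat \<Rightarrow> (nat \<Rightarrow> real) set \<Rightarrow> (nat \<Rightarrow> real) \<Rightarrow> nat \<Rightarrow> real"
  where "orth_proj N E x = (THE y. y \<in> E \<and> (\<forall>z\<in>E. inner_N N (x - y) z = 0))"

text \<open>
  A standard Gaussian vector in \<open>R^N\<close>. Elements of the product space are \<open>undefined\<close> (rather than
  \<open>0\<close>) from index \<open>N\<close> on, which \<^const>\<open>inner_N\<close> ignores.
\<close>

definition std_gaussian :: "nat \<Rightarrow> (nat \<Rightarrow> real) measure"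
  where "std_gaussian N = PiM {..<N} (\<lambda>_. density lborel (\<lambda>x. ennreal (std_normal_density x)))"

definition ell_star :: "nat \<Rightarrow> (nat \<Rightarrow> real) set \<Rightarrow> real"
  where "ell_star N T = (\<integral>g. (SUP x\<in>T. inner_N N g x) \<partial>std_gaussian N)"

text \<open>
  Borel structure of the Grassmannian for its usual topology, the one induced by identifying \<open>E\<close>
  with the matrix of the orthogonal projection onto \<open>E\<close>; the \<open>j\<close>-th column is the image of the
  \<open>j\<close>-th unit vector (and is \<open>0\<close> for \<open>j \<ge> N\<close>).
\<close>

definition grassmannian_borel :: "nat \<Rightarrow> nat \<Rightarrow> (nat \<Rightarrow> real) set measure"
  where "grassmannian_borel N n =
    vimage_algebra (grassmannian N n)
      (\<lambda>E j. orth_proj N E (\<lambda>i. if i = j then 1 else 0)) (borel :: (nat \<Rightarrow> nat \<Rightarrow> real) measure)"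

text \<open>
  The orthogonal group. Linearity of \<open>U\<close> on all sequences is no restriction, since every linear map
  on \<open>R^N\<close> extends; only the values of \<open>U\<close> on \<open>R^N\<close> matter.
\<close>

definition rotation :: "nat \<Rightarrow> ((nat \<Rightarrow> real) \<Rightarrow> nat \<Rightarrow> real) \<Rightarrow> bool"
  where "rotation N U \<longleftrightarrow> linear U \<and> (\<forall>x\<in>RN N. U x \<in> RN N \<and> norm_N N (U x) = norm_N N x)"

text \<open>
  \<open>M\<close> is the normalized Haar measure on the Grassmannian of \<open>n\<close>-codimensional subspaces: the (unique)
  rotation invariant Borel probability measure, i.e. the distribution of the random subspace \<open>E\<^sub>n\<close>.
\<close>

definition haar_grassmannian :: "nat \<Rightarrow> nat \<Rightarrow> (nat \<Rightarrow> real) set measure \<Rightarrow> bool"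
  where "haar_grassmannian N n M \<longleftrightarrow>
    prob_space M \<and> space M = grassmannian N n \<and> sets M = sets (grassmannian_borel N n) \<and>
    (\<forall>U. rotation N U \<longrightarrow> distr M M ((`) U) = M)"

definition random_radius :: "nat \<Rightarrow> (nat \<Rightarrow> real) set \<Rightarrow> (nat \<Rightarrow> real) set \<Rightarrow> real"
  where "random_radius N K F = radius N (F \<inter> K)"

end

theory Submission
  imports Defs
begin

text \<open>
  Let \<open>E\<^sub>n\<close> be the kernel of an \<open>n \<times> N\<close> Gaussian matrix, let \<open>m = n - k + 1\<close>, and fix a unit vector \<open>u\<close> orthogonal
  to \<open>E\<close>. The row space contains a vector \<open>\<rho> u + g\<close>, where \<open>g\<close> is a standard Gaussian vector in \<open>E\<close> and \<open>\<rho>\<close> is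
  independent of \<open>g\<close> and distributed like the norm of a Gaussian vector in \<open>R^m\<close>. Hence every \<open>x\<close> in \<open>E\<^sub>n \<inter> K\<close>
  satisfies \<open>\<rho> \<langle>x, u\<rangle> = - \<langle>g, P\<^sub>E x\<rangle>\<close>, and Gaussian concentration together with the small ball estimate for
  \<open>\<rho>\<close> bounds \<open>\<langle>x, u\<rangle>\<close> outside an event of probability \<open>(C \<epsilon>)^m\<close>.

  If \<open>E\<^sub>n \<inter> K\<close> contains a vector whose component \<open>w\<close> orthogonal to \<open>E\<close> is long, then an independent
  random direction \<open>u\<close> has \<open>\<langle>w, u\<rangle>\<close> of order \<open>|w| sqrt (min m k / k)\<close> with probability \<open>exp (- O(m))\<close>, a factor which
  is absorbed by \<open>C\<^sup>m\<close>. So the bound for a fixed direction bounds the norm.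
\<close>

section \<open>Gaussian measures on finite index sets\<close>

text \<open>The Haar measure is given only through its invariance, so the kernel of a Gaussian
  matrix cannot simply be substituted for the random subspace. The two are coupled approximately
  instead: an event for \<open>F\<close> is dominated by an event for matrices that are small,
  though not zero, on \<open>F\<close>. This is why the kernel equation carries a tolerance below.
  The tolerance is paid for by the strict gap between a number \<open>c\<close> and the claimed
  bound.

  A direction is averaged over because the long vector of \<open>F \<inter> K\<close> varies with
  \<open>F\<close>, so that no direction fixed in advance is aligned with it. With
  \<open>m = n - k + 1\<close> and \<open>s = min m k\<close>, the price is
  \<open>exp (5 * s)\<close> in probability and \<open>sqrt (k / s)\<close> in length. The latter is
  at most \<open>sqrt (n / m)\<close> because \<open>m * k \<le> min m k * n\<close>. Multiplied by
  the factor \<open>1 / (\<epsilon> * sqrt m)\<close> of a fixed direction, it gives the coefficient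
  \<open>sqrt n / (\<epsilon> * m)\<close> of \<open>ell_star\<close> in the theorem, up to a
  constant.\<close>

definition std_normal :: "real measure"
  where "std_normal = density lborel (\<lambda>x. ennreal (std_normal_density x))"

text \<open>The arbitrary index type lets one construction serve for vectors, for matrices indexed
  by pairs, for blocks of columns and, over a one-point set, for scalars.\<close>

definition gauss :: "'i set \<Rightarrow> ('i \<Rightarrow> real) measure"
  where "gauss I = PiM I (\<lambda>_. std_normal)"

lemma std_gaussian_eq_gauss: "std_gaussian N = gauss {..<N}"
  by (simp add: std_gaussian_def gauss_def std_normal_def)

lemma sets_std_normal [measurable_cong, simp]: "sets std_normal = sets borel"
  and space_std_normal [simp]: "space std_normal = UNIV"
  by (simp_all add: std_normal_def)

lemma prob_space_std_normal: "prob_space std_normal"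
  unfolding std_normal_def by (intro prob_space_normal_density) simp

lemma sets_gauss [measurable_cong]: "sets (gauss I) = sets (PiM I (\<lambda>_. borel))"
  unfolding gauss_def by (intro sets_PiM_cong) auto

lemma space_gauss: "space (gauss I) = extensional I"
  by (auto simp: gauss_def space_PiM PiE_def)

lemma prob_space_gauss: "prob_space (gauss I)"
  unfolding gauss_def by (intro prob_space_PiM prob_space_std_normal)

lemma sigma_finite_gauss [simp]: "sigma_finite_measure (gauss I)"
  by (rule prob_space_imp_sigma_finite[OF prob_space_gauss])

lemma psf_lborel: "product_sigma_finite (\<lambda>_::'i. lborel :: real measure)"
  by standard

lemma psf_std_normal: "product_sigma_finite (\<lambda>_::'i. std_normal)"
  by (intro product_sigma_finite.intro prob_space_imp_sigma_finite prob_space_std_normal)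

lemma gauss_eq_density:
  assumes I: "finite I"
  shows "gauss I = density (PiM I (\<lambda>_. lborel)) (\<lambda>x. \<Prod>i\<in>I. ennreal (std_normal_density (x i)))"
    (is "_ = ?D")
proof -
  interpret L: product_sigma_finite "\<lambda>_::'a. lborel :: real measure" by (rule psf_lborel)
  interpret G: product_sigma_finite "\<lambda>_::'a. std_normal" by (rule psf_std_normal)
  have "?D = PiM I (\<lambda>_. std_normal)"
  proof (rule G.PiM_eqI[OF I])
    show "sets ?D = sets (PiM I (\<lambda>_. std_normal))"
      unfolding sets_density by (intro sets_PiM_cong) auto
    fix A assume A: "\<And>i. i \<in> I \<Longrightarrow> A i \<in> sets std_normal"
    then have [measurable]: "i \<in> I \<Longrightarrow> A i \<in> sets borel" for i by simp
    have [measurable]: "Pi\<^sub>E I A \<in> sets (PiM I (\<lambda>_. lborel))"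
      using A I by (intro sets_PiM_I_finite) auto
    have "emeasure ?D (Pi\<^sub>E I A)
      = (\<integral>\<^sup>+x. (\<Prod>i\<in>I. ennreal (std_normal_density (x i))) * indicator (Pi\<^sub>E I A) x \<partial>PiM I (\<lambda>_. lborel))"
      by (subst emeasure_density) auto
    also have "\<dots> = (\<integral>\<^sup>+x. (\<Prod>i\<in>I. ennreal (std_normal_density (x i)) * indicator (A i) (x i)) \<partial>PiM I (\<lambda>_. lborel))"
    proof (rule nn_integral_cong)
      fix x assume "x \<in> space (PiM I (\<lambda>_. lborel :: real measure))"
      then have x: "x \<in> extensional I" by (auto simp: space_PiM PiE_def)
      have "indicator (Pi\<^sub>E I A) x = (\<Prod>i\<in>I. indicator (A i) (x i) :: ennreal)"
      proof (cases "x \<in> Pi\<^sub>E I A")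
        case True
        then have "(\<Prod>i\<in>I. indicator (A i) (x i) :: ennreal) = 1"
          by (intro prod.neutral) (auto simp: PiE_mem)
        then show ?thesis using True by simp
      next
        case False
        then obtain i where "i \<in> I" "x i \<notin> A i" using x by (auto simp: PiE_def)
        then have "(\<Prod>i\<in>I. indicator (A i) (x i) :: ennreal) = 0"
          using I by (intro prod_zero) (auto intro!: bexI[of _ i])
        then show ?thesis using False by simp
      qed
      then show "(\<Prod>i\<in>I. ennreal (std_normal_density (x i))) * indicator (Pi\<^sub>E I A) x
        = (\<Prod>i\<in>I. ennreal (std_normal_density (x i)) * indicator (A i) (x i))"
        by (simp add: prod.distrib)
    qed
    also have "\<dots> = (\<Prod>i\<in>I. \<integral>\<^sup>+x. ennreal (std_normal_density x) * indicator (A i) x \<partial>lborel)"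
      by (rule L.product_nn_integral_prod[OF I]) measurable
    also have "\<dots> = (\<Prod>i\<in>I. emeasure std_normal (A i))"
      by (intro prod.cong refl) (simp add: std_normal_def emeasure_density)
    finally show "emeasure ?D (Pi\<^sub>E I A) = (\<Prod>i\<in>I. emeasure std_normal (A i))" .
  qed
  then show ?thesis by (simp add: gauss_def)
qed

lemma prod_std_normal_density:
  assumes "finite I"
  shows "(\<Prod>i\<in>I. ennreal (std_normal_density (x i)))
    = ennreal ((1 / sqrt (2 * pi)) ^ card I * exp (- (\<Sum>i\<in>I. (x i)\<^sup>2) / 2))"
proof -
  have "(\<Prod>i\<in>I. ennreal (std_normal_density (x i))) = ennreal (\<Prod>i\<in>I. std_normal_density (x i))"
    by (simp add: prod_ennreal)
  also have "(\<Prod>i\<in>I. std_normal_density (x i))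
    = (1 / sqrt (2 * pi)) ^ card I * (\<Prod>i\<in>I. exp (- (x i)\<^sup>2 / 2))"
    unfolding std_normal_density_def prod.distrib by simp
  also have "(\<Prod>i\<in>I. exp (- (x i)\<^sup>2 / 2)) = exp (- (\<Sum>i\<in>I. (x i)\<^sup>2) / 2)"
    using assms by (simp add: exp_sum[symmetric] sum_negf sum_divide_distrib)
  finally show ?thesis .
qed

section \<open>Shears of Lebesgue measure and rotations of Gaussian measure\<close>

abbreviation leb :: "'i set \<Rightarrow> ('i \<Rightarrow> real) measure"
  where "leb I \<equiv> PiM I (\<lambda>_. lborel)"

lemma lborel_PiM_translate:
  fixes c :: "'i \<Rightarrow> real"
  assumes I: "finite I"
  shows "distr (PiM I (\<lambda>_. lborel)) (PiM I (\<lambda>_. lborel)) (\<lambda>x. \<lambda>i\<in>I. x i + c i) = PiM I (\<lambda>_. lborel)"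
    (is "?D = _")
proof -
  interpret L: product_sigma_finite "\<lambda>_::'i. lborel :: real measure" by (rule psf_lborel)
  show ?thesis
  proof (rule L.PiM_eqI[OF I])
    show "sets ?D = sets (PiM I (\<lambda>_. lborel))" by simp
    fix A :: "'i \<Rightarrow> real set" assume A: "\<And>i. i \<in> I \<Longrightarrow> A i \<in> sets lborel"
    define B where "B i = (\<lambda>x. x + c i) -` A i" for i
    have B: "B i \<in> sets lborel" if "i \<in> I" for i
    proof -
      have "(\<lambda>x. x + c i) \<in> borel_measurable borel" by measurable
      then show ?thesis using measurable_sets[of "\<lambda>x. x + c i" borel borel "A i"] A[OF that]
        by (simp add: B_def)
    qed
    have "emeasure ?D (Pi\<^sub>E I A) = emeasure (PiM I (\<lambda>_. lborel))
      ((\<lambda>x. \<lambda>i\<in>I. x i + c i) -` (Pi\<^sub>E I A) \<inter> space (PiM I (\<lambda>_. lborel)))"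
      using A I by (intro emeasure_distr) (auto intro!: sets_PiM_I_finite)
    also have "(\<lambda>x. \<lambda>i\<in>I. x i + c i) -` (Pi\<^sub>E I A) \<inter> space (PiM I (\<lambda>_. lborel)) = Pi\<^sub>E I B"
      by (auto simp: B_def space_PiM PiE_def Pi_def)
    also have "emeasure (PiM I (\<lambda>_. lborel)) (Pi\<^sub>E I B) = (\<Prod>i\<in>I. emeasure lborel (B i))"
      using B by (intro L.emeasure_PiM[OF I]) auto
    also have "\<dots> = (\<Prod>i\<in>I. emeasure lborel (A i))"
    proof (rule prod.cong[OF refl])
      fix i assume i: "i \<in> I"
      have "emeasure lborel (A i) = emeasure (distr lborel borel ((+) (c i))) (A i)"
        by (simp add: lborel_distr_plus)
      also have "\<dots> = emeasure lborel (B i)"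
        using A[OF i] by (subst emeasure_distr) (auto simp: B_def add.commute vimage_def)
      finally show "emeasure lborel (B i) = emeasure lborel (A i)" by simp
    qed
    finally show "emeasure ?D (Pi\<^sub>E I A) = (\<Prod>i\<in>I. emeasure lborel (A i))" .
  qed
qed

lemma nn_integral_PiM_translate:
  fixes c :: "'i \<Rightarrow> real"
  assumes "finite I" and f: "f \<in> borel_measurable (PiM I (\<lambda>_. lborel))"
  shows "(\<integral>\<^sup>+x. f (\<lambda>i\<in>I. x i + c i) \<partial>PiM I (\<lambda>_. lborel)) = (\<integral>\<^sup>+x. f x \<partial>PiM I (\<lambda>_. lborel))"
proof -
  have "(\<integral>\<^sup>+x. f x \<partial>PiM I (\<lambda>_. lborel))
    = (\<integral>\<^sup>+x. f x \<partial>distr (PiM I (\<lambda>_. lborel)) (PiM I (\<lambda>_. lborel)) (\<lambda>x. \<lambda>i\<in>I. x i + c i))"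
    by (simp add: lborel_PiM_translate[OF assms(1)])
  also have "\<dots> = (\<integral>\<^sup>+x. f (\<lambda>i\<in>I. x i + c i) \<partial>PiM I (\<lambda>_. lborel))"
    using f by (intro nn_integral_distr) auto
  finally show ?thesis by simp
qed

lemma pair_sigma_finite_leb:
  "finite I \<Longrightarrow> finite J \<Longrightarrow> pair_sigma_finite (leb I) (leb J)"
  by (intro pair_sigma_finite.intro product_sigma_finite.sigma_finite[OF psf_lborel])

text \<open>For fixed \<open>x\<close> the map is a translation in \<open>y\<close>, so Fubini
  reduces the claim to translation invariance and no determinant appears.\<close>

lemma nn_integral_shear_snd:
  fixes B :: "('i \<Rightarrow> real) \<Rightarrow> 'j \<Rightarrow> real"
  assumes I: "finite I" and J: "finite J"
    and [measurable]: "\<And>j. j \<in> J \<Longrightarrow> (\<lambda>x. B x j) \<in> borel_measurable (leb I)"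
    and f[measurable]: "f \<in> borel_measurable (leb I \<Otimes>\<^sub>M leb J)"
  shows "(\<integral>\<^sup>+(x, y). f (x, \<lambda>j\<in>J. y j + B x j) \<partial>(leb I \<Otimes>\<^sub>M leb J)) = integral\<^sup>N (leb I \<Otimes>\<^sub>M leb J) f"
proof -
  interpret pair_sigma_finite "leb I" "leb J" by (rule pair_sigma_finite_leb[OF I J])
  have [measurable]: "(\<lambda>(x, y). f (x, \<lambda>j\<in>J. y j + B x j)) \<in> borel_measurable (leb I \<Otimes>\<^sub>M leb J)"
    by measurable
  have "(\<integral>\<^sup>+(x, y). f (x, \<lambda>j\<in>J. y j + B x j) \<partial>(leb I \<Otimes>\<^sub>M leb J))
    = (\<integral>\<^sup>+x. \<integral>\<^sup>+y. f (x, \<lambda>j\<in>J. y j + B x j) \<partial>leb J \<partial>leb I)"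
    by (subst M2.nn_integral_fst[symmetric]) auto
  also have "\<dots> = (\<integral>\<^sup>+x. \<integral>\<^sup>+y. f (x, y) \<partial>leb J \<partial>leb I)"
    by (intro nn_integral_cong nn_integral_PiM_translate[OF J]) simp
  also have "\<dots> = integral\<^sup>N (leb I \<Otimes>\<^sub>M leb J) f"
    by (rule M2.nn_integral_fst) auto
  finally show ?thesis .
qed

lemma nn_integral_shear_fst:
  fixes A :: "('j \<Rightarrow> real) \<Rightarrow> 'i \<Rightarrow> real"
  assumes I: "finite I" and J: "finite J"
    and [measurable]: "\<And>i. i \<in> I \<Longrightarrow> (\<lambda>y. A y i) \<in> borel_measurable (leb J)"
    and f[measurable]: "f \<in> borel_measurable (leb I \<Otimes>\<^sub>M leb J)"
  shows "(\<integral>\<^sup>+(x, y). f (\<lambda>i\<in>I. x i + A y i, y) \<partial>(leb I \<Otimes>\<^sub>M leb J)) = integral\<^sup>N (leb I \<Otimes>\<^sub>M leb J) f"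
proof -
  interpret pair_sigma_finite "leb I" "leb J" by (rule pair_sigma_finite_leb[OF I J])
  have [measurable]: "(\<lambda>(x, y). f (\<lambda>i\<in>I. x i + A y i, y)) \<in> borel_measurable (leb I \<Otimes>\<^sub>M leb J)"
    by measurable
  have "(\<integral>\<^sup>+(x, y). f (\<lambda>i\<in>I. x i + A y i, y) \<partial>(leb I \<Otimes>\<^sub>M leb J))
    = (\<integral>\<^sup>+y. \<integral>\<^sup>+x. f (\<lambda>i\<in>I. x i + A y i, y) \<partial>leb I \<partial>leb J)"
    by (subst nn_integral_snd[symmetric]) auto
  also have "\<dots> = (\<integral>\<^sup>+y. \<integral>\<^sup>+x. f (x, y) \<partial>leb I \<partial>leb J)"
    by (intro nn_integral_cong nn_integral_PiM_translate[OF I]) simp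
  also have "\<dots> = integral\<^sup>N (leb I \<Otimes>\<^sub>M leb J) f"
    by (rule nn_integral_snd) auto
  finally show ?thesis .
qed

lemma gauss_pair_eq_density:
  assumes I: "finite I" and J: "finite J"
  shows "gauss I \<Otimes>\<^sub>M gauss J = density (leb I \<Otimes>\<^sub>M leb J)
    (\<lambda>(x, y). ennreal ((1 / sqrt (2 * pi)) ^ (card I + card J)
        * exp (- ((\<Sum>i\<in>I. (x i)\<^sup>2) + (\<Sum>j\<in>J. (y j)\<^sup>2)) / 2)))"
proof -
  interpret pair_sigma_finite "leb I" "leb J" by (rule pair_sigma_finite_leb[OF I J])
  have "sigma_finite_measure (density (leb J) (\<lambda>x. \<Prod>i\<in>J. ennreal (std_normal_density (x i))))"
    using gauss_eq_density[OF J] sigma_finite_gauss[of J] by simp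
  then have "gauss I \<Otimes>\<^sub>M gauss J = density (leb I \<Otimes>\<^sub>M leb J)
     (\<lambda>(x, y). (\<Prod>i\<in>I. ennreal (std_normal_density (x i))) * (\<Prod>j\<in>J. ennreal (std_normal_density (y j))))"
    unfolding gauss_eq_density[OF I] gauss_eq_density[OF J]
    by (intro pair_measure_density) (auto simp: M2.sigma_finite_measure_axioms)
  also have "(\<lambda>(x, y). (\<Prod>i\<in>I. ennreal (std_normal_density (x i))) * (\<Prod>j\<in>J. ennreal (std_normal_density (y j))))
    = (\<lambda>(x, y). ennreal ((1 / sqrt (2 * pi)) ^ (card I + card J)
        * exp (- ((\<Sum>i\<in>I. (x i)\<^sup>2) + (\<Sum>j\<in>J. (y j)\<^sup>2)) / 2)))"
    by (auto simp: fun_eq_iff prod_std_normal_density[OF I] prod_std_normal_density[OF J]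
        ennreal_mult'[symmetric] power_add exp_add[symmetric] add_divide_distrib
        mult.assoc mult.left_commute diff_divide_distrib mult_exp_exp)
  finally show ?thesis .
qed

text \<open>Every plane rotation is a product of three shears; this is what makes the Gaussian measure
  invariant, since shears preserve Lebesgue measure by Fubini.\<close>

lemma gauss_pair_three_shears:
  fixes A :: "('j \<Rightarrow> real) \<Rightarrow> 'i \<Rightarrow> real" and B :: "('i \<Rightarrow> real) \<Rightarrow> 'j \<Rightarrow> real"
  assumes I: "finite I" and J: "finite J"
    and A[measurable]: "\<And>i. i \<in> I \<Longrightarrow> (\<lambda>y. A y i) \<in> borel_measurable (leb J)"
    and B[measurable]: "\<And>j. j \<in> J \<Longrightarrow> (\<lambda>x. B x j) \<in> borel_measurable (leb I)"
  defines "S \<equiv> \<lambda>(x, y). (\<lambda>i\<in>I. x i + A y i, y)" and "T \<equiv> \<lambda>(x, y). (x, \<lambda>j\<in>J. y j + B x j)"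
  assumes nrm: "\<And>x y x' y'. x \<in> extensional I \<Longrightarrow> y \<in> extensional J \<Longrightarrow> S (T (S (x, y))) = (x', y') \<Longrightarrow>
      (\<Sum>i\<in>I. (x' i)\<^sup>2) + (\<Sum>j\<in>J. (y' j)\<^sup>2) = (\<Sum>i\<in>I. (x i)\<^sup>2) + (\<Sum>j\<in>J. (y j)\<^sup>2)"
  shows "distr (gauss I \<Otimes>\<^sub>M gauss J) (gauss I \<Otimes>\<^sub>M gauss J) (\<lambda>z. S (T (S z))) = gauss I \<Otimes>\<^sub>M gauss J"
proof -
  let ?L = "leb I \<Otimes>\<^sub>M leb J" and ?G = "gauss I \<Otimes>\<^sub>M gauss J"
  define \<rho> :: "('i \<Rightarrow> real) \<times> ('j \<Rightarrow> real) \<Rightarrow> ennreal" where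
    "\<rho> = (\<lambda>(x, y). ennreal ((1 / sqrt (2 * pi)) ^ (card I + card J)
        * exp (- ((\<Sum>i\<in>I. (x i)\<^sup>2) + (\<Sum>j\<in>J. (y j)\<^sup>2)) / 2)))"
  have G: "?G = density ?L \<rho>" unfolding \<rho>_def by (rule gauss_pair_eq_density[OF I J])
  have [measurable]: "\<rho> \<in> borel_measurable ?L" unfolding \<rho>_def by measurable
  have sets_G [measurable_cong]: "sets ?G = sets ?L" unfolding G sets_density ..
  have S[measurable]: "S \<in> measurable ?L ?L" unfolding S_def by measurable
  have T[measurable]: "T \<in> measurable ?L ?L" unfolding T_def by measurable
  have Sinv: "(\<integral>\<^sup>+z. f (S z) \<partial>?L) = integral\<^sup>N ?L f" if "f \<in> borel_measurable ?L" for f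
    using nn_integral_shear_fst[OF I J A that] by (simp add: S_def case_prod_unfold)
  have Tinv: "(\<integral>\<^sup>+z. f (T z) \<partial>?L) = integral\<^sup>N ?L f" if "f \<in> borel_measurable ?L" for f
    using nn_integral_shear_snd[OF I J B that] by (simp add: T_def case_prod_unfold)
  have \<rho>: "\<rho> (S (T (S z))) = \<rho> z" if "z \<in> space ?L" for z
  proof -
    obtain x y x' y' where z: "z = (x, y)" and z': "S (T (S z)) = (x', y')"
      by (metis surj_pair)
    have "x \<in> extensional I" "y \<in> extensional J"
      using that by (auto simp: z space_pair_measure space_PiM PiE_def)
    from nrm[OF this] z z' show ?thesis by (simp add: \<rho>_def)
  qed
  show ?thesis
  proof (rule measure_eqI)
    fix X assume "X \<in> sets (distr ?G ?G (\<lambda>z. S (T (S z))))"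
    then have X[measurable]: "X \<in> sets ?L" by (simp add: sets_G)
    have STS: "(\<lambda>z. S (T (S z))) \<in> measurable ?L ?L" by measurable
    have "emeasure (distr ?G ?G (\<lambda>z. S (T (S z)))) X
      = emeasure ?G ((\<lambda>z. S (T (S z))) -` X \<inter> space ?L)"
      using X by (subst emeasure_distr) (auto simp: sets_G cong: measurable_cong_sets sets_eq_imp_space_eq[OF sets_G])
    also have "\<dots> = (\<integral>\<^sup>+z. \<rho> z * indicator ((\<lambda>z. S (T (S z))) -` X \<inter> space ?L) z \<partial>?L)"
      unfolding G using measurable_sets[OF STS X] by (intro emeasure_density) auto
    \<comment> \<open>Only the full composite is known to preserve the norm, so the density is
      rewritten along it before the shears are removed one at a time, innermost first.\<close>
    also have "\<dots> = (\<integral>\<^sup>+z. \<rho> (S (T (S z))) * indicator X (S (T (S z))) \<partial>?L)"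
      by (intro nn_integral_cong) (auto simp: \<rho> indicator_def)
    also have "\<dots> = (\<integral>\<^sup>+z. \<rho> (S (T z)) * indicator X (S (T z)) \<partial>?L)"
      by (rule Sinv[of "\<lambda>z. \<rho> (S (T z)) * indicator X (S (T z))"]) measurable
    also have "\<dots> = (\<integral>\<^sup>+z. \<rho> (S z) * indicator X (S z) \<partial>?L)"
      by (rule Tinv[of "\<lambda>z. \<rho> (S z) * indicator X (S z)"]) measurable
    also have "\<dots> = (\<integral>\<^sup>+z. \<rho> z * indicator X z \<partial>?L)"
      by (rule Sinv[of "\<lambda>z. \<rho> z * indicator X z"]) measurable
    also have "\<dots> = emeasure ?G X"
      unfolding G by (subst emeasure_density) auto
    finally show "emeasure (distr ?G ?G (\<lambda>z. S (T (S z)))) X = emeasure ?G X" .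
  qed simp
qed

lemma sum_sq_orthonormal:
  fixes W :: "'j \<Rightarrow> 'i \<Rightarrow> real"
  assumes J: "finite J"
    and W: "\<And>j j'. j \<in> J \<Longrightarrow> j' \<in> J \<Longrightarrow> (\<Sum>i\<in>I. W j i * W j' i) = (if j = j' then 1 else 0)"
  shows "(\<Sum>i\<in>I. (\<Sum>j\<in>J. W j i * c j)\<^sup>2) = (\<Sum>j\<in>J. (c j)\<^sup>2)"
proof -
  have "(\<Sum>i\<in>I. (\<Sum>j\<in>J. W j i * c j)\<^sup>2) = (\<Sum>i\<in>I. \<Sum>j\<in>J. \<Sum>j'\<in>J. c j * c j' * (W j i * W j' i))"
    by (intro sum.cong refl) (simp add: power2_eq_square sum_product mult_ac)
  also have "\<dots> = (\<Sum>j\<in>J. \<Sum>j'\<in>J. \<Sum>i\<in>I. c j * c j' * (W j i * W j' i))"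
    by (subst sum.swap, intro sum.cong refl, rule sum.swap)
  also have "\<dots> = (\<Sum>j\<in>J. \<Sum>j'\<in>J. if j = j' then (c j)\<^sup>2 else 0)"
    by (intro sum.cong refl) (auto simp: sum_distrib_left[symmetric] W power2_eq_square)
  also have "\<dots> = (\<Sum>j\<in>J. (c j)\<^sup>2)" using J by simp
  finally show ?thesis .
qed

text \<open>The rows of \<open>W\<close> span a copy of R^J inside R^I. A quarter turn exchanges
  this copy with the second factor of R^I x R^J and fixes the rest of R^I. It is an isometry made of
  three shears, and its second component is \<open>W x\<close>, which does not involve
  \<open>y\<close>; comparing marginals gives the law of \<open>W x\<close>. No completion of
  \<open>W\<close> to a square matrix is required.\<close>

lemma gauss_orthonormal_image:
  fixes W :: "'j \<Rightarrow> 'i \<Rightarrow> real"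
  assumes I: "finite I" and J: "finite J"
    and W: "\<And>j j'. j \<in> J \<Longrightarrow> j' \<in> J \<Longrightarrow> (\<Sum>i\<in>I. W j i * W j' i) = (if j = j' then 1 else 0)"
  shows "distr (gauss I) (gauss J) (\<lambda>x. \<lambda>j\<in>J. \<Sum>i\<in>I. W j i * x i) = gauss J"
proof -
  define A where "A y i = - (\<Sum>j\<in>J. W j i * y j)" for y i
  define B where "B x j = (\<Sum>i\<in>I. W j i * x i)" for x j
  define S :: "('i \<Rightarrow> real) \<times> ('j \<Rightarrow> real) \<Rightarrow> _" where "S = (\<lambda>(x, y). (\<lambda>i\<in>I. x i + A y i, y))"
  define T :: "('i \<Rightarrow> real) \<times> ('j \<Rightarrow> real) \<Rightarrow> _" where "T = (\<lambda>(x, y). (x, \<lambda>j\<in>J. y j + B x j))"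
  have BA: "B (\<lambda>i\<in>I. x i + A y i) j = B x j - y j" if "j \<in> J" for x y j
  proof -
    have "B (\<lambda>i\<in>I. x i + A y i) j = B x j - (\<Sum>i\<in>I. \<Sum>j'\<in>J. (W j i * W j' i) * y j')"
      by (simp add: B_def A_def algebra_simps sum_subtractf sum_distrib_left)
    also have "(\<Sum>i\<in>I. \<Sum>j'\<in>J. (W j i * W j' i) * y j') = (\<Sum>j'\<in>J. if j = j' then y j' else 0)"
      by (subst sum.swap) (auto intro!: sum.cong simp: sum_distrib_right[symmetric] W that)
    also have "\<dots> = y j" using J that by simp
    finally show ?thesis .
  qed
  have STS: "S (T (S (x, y))) = (\<lambda>i\<in>I. x i - (\<Sum>j\<in>J. W j i * (y j + B x j)), \<lambda>j\<in>J. B x j)" for x y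
  proof -
    have "S (T (S (x, y))) = S (\<lambda>i\<in>I. x i + A y i, \<lambda>j\<in>J. B x j)"
      by (simp add: S_def T_def BA cong: restrict_cong)
    then show ?thesis
      by (simp add: S_def fun_eq_iff A_def sum.distrib algebra_simps)
  qed
  have "distr (gauss I \<Otimes>\<^sub>M gauss J) (gauss I \<Otimes>\<^sub>M gauss J) (\<lambda>z. S (T (S z))) = gauss I \<Otimes>\<^sub>M gauss J"
  proof (rule gauss_pair_three_shears[where A = A and B = B, OF I J, folded S_def T_def])
    fix x :: "'i \<Rightarrow> real" and y :: "'j \<Rightarrow> real" and x' y'
    assume "S (T (S (x, y))) = (x', y')"
    then have x': "x' = (\<lambda>i\<in>I. x i - (\<Sum>j\<in>J. W j i * (y j + B x j)))" and y': "y' = (\<lambda>j\<in>J. B x j)"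
      by (auto simp: STS)
    have "(\<Sum>i\<in>I. (x' i)\<^sup>2) = (\<Sum>i\<in>I. (x i)\<^sup>2) - 2 * (\<Sum>i\<in>I. \<Sum>j\<in>J. W j i * x i * (y j + B x j))
        + (\<Sum>i\<in>I. (\<Sum>j\<in>J. W j i * (y j + B x j))\<^sup>2)"
      by (simp add: x' power2_diff sum.distrib sum_subtractf sum_distrib_left algebra_simps)
    also have "(\<Sum>i\<in>I. \<Sum>j\<in>J. W j i * x i * (y j + B x j)) = (\<Sum>j\<in>J. B x j * (y j + B x j))"
      by (subst sum.swap) (simp add: B_def sum_distrib_right)
    also have "(\<Sum>i\<in>I. (\<Sum>j\<in>J. W j i * (y j + B x j))\<^sup>2) = (\<Sum>j\<in>J. (y j + B x j)\<^sup>2)"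
      by (rule sum_sq_orthonormal[OF J W])
    also have "(\<Sum>j\<in>J. (y j + B x j)\<^sup>2)
      = 2 * (\<Sum>j\<in>J. B x j * (y j + B x j)) + (\<Sum>j\<in>J. (y j)\<^sup>2) - (\<Sum>j\<in>J. (B x j)\<^sup>2)"
      unfolding sum_distrib_left sum.distrib[symmetric] sum_subtractf[symmetric]
      by (intro sum.cong refl) (simp add: power2_eq_square algebra_simps)
    finally show "(\<Sum>i\<in>I. (x' i)\<^sup>2) + (\<Sum>j\<in>J. (y' j)\<^sup>2) = (\<Sum>i\<in>I. (x i)\<^sup>2) + (\<Sum>j\<in>J. (y j)\<^sup>2)"
      by (simp add: y')
  next
    show "(\<lambda>y. A y i) \<in> borel_measurable (leb J)" for i unfolding A_def by measurable
    show "(\<lambda>x. B x j) \<in> borel_measurable (leb I)" for j unfolding B_def by measurable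
  qed
  note inv = this
  interpret GI: prob_space "gauss I" by (rule prob_space_gauss)
  interpret GJ: prob_space "gauss J" by (rule prob_space_gauss)
  interpret P: pair_prob_space "gauss I" "gauss J" ..
  have B[measurable]: "(\<lambda>x. \<lambda>j\<in>J. B x j) \<in> measurable (gauss I) (gauss J)"
    unfolding B_def by measurable
  have snd_marginal: "distr (gauss I \<Otimes>\<^sub>M gauss J) (gauss J) snd = gauss J"
  proof (rule measure_eqI)
    fix X assume "X \<in> sets (distr (gauss I \<Otimes>\<^sub>M gauss J) (gauss J) snd)"
    then have X: "X \<in> sets (gauss J)" by simp
    then have "snd -` X \<inter> space (gauss I \<Otimes>\<^sub>M gauss J) = space (gauss I) \<times> X"
      using sets.sets_into_space by (fastforce simp: space_pair_measure)
    then show "emeasure (distr (gauss I \<Otimes>\<^sub>M gauss J) (gauss J) snd) X = emeasure (gauss J) X"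
      using X by (simp add: emeasure_distr GJ.emeasure_pair_measure_Times GI.emeasure_space_1)
  qed simp
  have "gauss J = distr (distr (gauss I \<Otimes>\<^sub>M gauss J) (gauss I \<Otimes>\<^sub>M gauss J) (\<lambda>z. S (T (S z)))) (gauss J) snd"
    by (simp add: inv snd_marginal)
  also have "\<dots> = distr (gauss I \<Otimes>\<^sub>M gauss J) (gauss J) (snd \<circ> (\<lambda>z. S (T (S z))))"
  proof (rule distr_distr)
    have [measurable]: "S \<in> measurable (gauss I \<Otimes>\<^sub>M gauss J) (gauss I \<Otimes>\<^sub>M gauss J)"
      unfolding S_def A_def by measurable
    have [measurable]: "T \<in> measurable (gauss I \<Otimes>\<^sub>M gauss J) (gauss I \<Otimes>\<^sub>M gauss J)"
      unfolding T_def B_def by measurable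
    show "(\<lambda>z. S (T (S z))) \<in> measurable (gauss I \<Otimes>\<^sub>M gauss J) (gauss I \<Otimes>\<^sub>M gauss J)"
      by measurable
  qed simp
  also have "snd \<circ> (\<lambda>z. S (T (S z))) = (\<lambda>x. \<lambda>j\<in>J. B x j) \<circ> fst"
    by (auto simp: fun_eq_iff STS)
  also have "distr (gauss I \<Otimes>\<^sub>M gauss J) (gauss J) ((\<lambda>x. \<lambda>j\<in>J. B x j) \<circ> fst)
    = distr (distr (gauss I \<Otimes>\<^sub>M gauss J) (gauss I) fst) (gauss J) (\<lambda>x. \<lambda>j\<in>J. B x j)"
    by (rule distr_distr[symmetric]) auto
  also have "distr (gauss I \<Otimes>\<^sub>M gauss J) (gauss I) fst = gauss I"
    by (rule GJ.distr_pair_fst)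
  finally show ?thesis unfolding B_def[abs_def] by (rule sym)
qed

lemma gauss_pair_rotate:
  assumes I: "finite I"
  shows "distr (gauss I \<Otimes>\<^sub>M gauss I) (gauss I \<Otimes>\<^sub>M gauss I)
    (\<lambda>(x, y). (\<lambda>i\<in>I. (x i - y i) / sqrt 2, \<lambda>i\<in>I. (x i + y i) / sqrt 2)) = gauss I \<Otimes>\<^sub>M gauss I"
proof -
  \<comment> \<open>A rotation by the angle \<theta> is a product of shears with coefficients
    \<open>- tan (\<theta> / 2)\<close>, \<open>sin \<theta>\<close>,
    \<open>- tan (\<theta> / 2)\<close>. Here \<theta> = \<pi> / 4, and
    \<open>tan (pi / 8) = sqrt 2 - 1\<close>.\<close>
  define A :: "('a \<Rightarrow> real) \<Rightarrow> 'a \<Rightarrow> real" where "A y i = - (sqrt 2 - 1) * y i" for y i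
  define B :: "('a \<Rightarrow> real) \<Rightarrow> 'a \<Rightarrow> real" where "B x i = x i / sqrt 2" for x i
  define S :: "('a \<Rightarrow> real) \<times> ('a \<Rightarrow> real) \<Rightarrow> _" where "S = (\<lambda>(x, y). (\<lambda>i\<in>I. x i + A y i, y))"
  define T :: "('a \<Rightarrow> real) \<times> ('a \<Rightarrow> real) \<Rightarrow> _" where "T = (\<lambda>(x, y). (x, \<lambda>j\<in>I. y j + B x j))"
  have s2: "sqrt 2 * sqrt 2 = (2::real)" "sqrt 2 * (sqrt 2 * z) = 2 * z" for z :: real by simp_all
  have STS: "(\<lambda>z. S (T (S z))) = (\<lambda>(x, y). (\<lambda>i\<in>I. (x i - y i) / sqrt 2, \<lambda>i\<in>I. (x i + y i) / sqrt 2))"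
    by (auto simp: S_def T_def A_def B_def fun_eq_iff restrict_def field_simps s2)
  have "distr (gauss I \<Otimes>\<^sub>M gauss I) (gauss I \<Otimes>\<^sub>M gauss I) (\<lambda>z. S (T (S z))) = gauss I \<Otimes>\<^sub>M gauss I"
  proof (rule gauss_pair_three_shears[where A = A and B = B, OF I I, folded S_def T_def])
    fix x y x' y' :: "'a \<Rightarrow> real"
    assume "S (T (S (x, y))) = (x', y')"
    then have x': "x' = (\<lambda>i\<in>I. (x i - y i) / sqrt 2)" and y': "y' = (\<lambda>i\<in>I. (x i + y i) / sqrt 2)"
      by (auto simp: fun_cong[OF STS])
    show "(\<Sum>i\<in>I. (x' i)\<^sup>2) + (\<Sum>j\<in>I. (y' j)\<^sup>2) = (\<Sum>i\<in>I. (x i)\<^sup>2) + (\<Sum>j\<in>I. (y j)\<^sup>2)"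
      unfolding sum.distrib[symmetric]
      by (intro sum.cong refl) (simp add: x' y' power_divide power2_eq_square field_simps)
  next
    show "(\<lambda>y. A y i) \<in> borel_measurable (leb I)" if "i \<in> I" for i unfolding A_def using that by measurable
    show "(\<lambda>x. B x j) \<in> borel_measurable (leb I)" if "j \<in> I" for j unfolding B_def using that by measurable
  qed
  then show ?thesis by (simp add: STS)
qed

section \<open>Exponential moments, tails and small balls of Gaussian vectors\<close>

lemma nn_integral_std_normal_exp:
  "(\<integral>\<^sup>+x. ennreal (exp (a * x)) \<partial>std_normal) = ennreal (exp (a\<^sup>2 / 2))"
proof -
  have eq: "std_normal_density x * exp (a * x) = exp (a\<^sup>2 / 2) * normal_density a 1 x" for x
  proof -
    have "- x\<^sup>2 / 2 + a * x = a\<^sup>2 / 2 + - (x - a)\<^sup>2 / 2"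
      by (simp add: power2_eq_square field_simps)
    then show ?thesis
      unfolding normal_density_def by (simp add: exp_add[symmetric])
  qed
  have "(\<integral>\<^sup>+x. ennreal (exp (a * x)) \<partial>std_normal)
    = (\<integral>\<^sup>+x. ennreal (std_normal_density x * exp (a * x)) \<partial>lborel)"
    unfolding std_normal_def by (subst nn_integral_density) (auto simp: ennreal_mult')
  also have "\<dots> = ennreal (exp (a\<^sup>2 / 2)) * (\<integral>\<^sup>+x. ennreal (normal_density a 1 x) \<partial>lborel)"
    unfolding eq by (subst nn_integral_cmult[symmetric]) (auto simp: ennreal_mult')
  also have "(\<integral>\<^sup>+x. ennreal (normal_density a 1 x) \<partial>lborel) = 1"
    by (subst nn_integral_eq_integral) auto
  finally show ?thesis by simp
qed

lemma nn_integral_std_normal_exp_sq: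
  assumes "s > - 1 / 2"
  shows "(\<integral>\<^sup>+x. ennreal (exp (- s * x\<^sup>2)) \<partial>std_normal) = ennreal (1 / sqrt (1 + 2 * s))"
proof -
  define \<sigma> where "\<sigma> = 1 / sqrt (1 + 2 * s)"
  have pos: "1 + 2 * s > 0" using assms by simp
  have \<sigma>: "\<sigma> > 0" "\<sigma>\<^sup>2 = 1 / (1 + 2 * s)" using pos by (auto simp: \<sigma>_def power_divide)
  have eq: "std_normal_density x * exp (- s * x\<^sup>2) = \<sigma> * normal_density 0 \<sigma> x" for x
  proof -
    have "- x\<^sup>2 / 2 + - s * x\<^sup>2 = - (x - 0)\<^sup>2 / (2 * \<sigma>\<^sup>2)"
      using pos by (simp add: \<sigma>(2) field_simps)
    moreover have "\<sigma> * (1 / sqrt (2 * pi * \<sigma>\<^sup>2)) = 1 / sqrt (2 * pi)"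
      using \<sigma>(1) by (simp add: real_sqrt_mult)
    ultimately show ?thesis
      unfolding normal_density_def[of 0 \<sigma>] std_normal_density_def
      by (metis (no_types, lifting) exp_add mult.assoc)
  qed
  have "(\<integral>\<^sup>+x. ennreal (exp (- s * x\<^sup>2)) \<partial>std_normal)
    = (\<integral>\<^sup>+x. ennreal (std_normal_density x * exp (- s * x\<^sup>2)) \<partial>lborel)"
    unfolding std_normal_def by (subst nn_integral_density) (auto simp: ennreal_mult')
  also have "\<dots> = ennreal \<sigma> * (\<integral>\<^sup>+x. ennreal (normal_density 0 \<sigma> x) \<partial>lborel)"
    unfolding eq using \<sigma> by (subst nn_integral_cmult[symmetric]) (auto simp: ennreal_mult')
  also have "(\<integral>\<^sup>+x. ennreal (normal_density 0 \<sigma> x) \<partial>lborel) = 1"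
    using \<sigma> by (subst nn_integral_eq_integral) auto
  finally show ?thesis by (simp add: \<sigma>_def)
qed

lemma nn_integral_gauss_prod:
  assumes "finite I" "\<And>i. i \<in> I \<Longrightarrow> f i \<in> borel_measurable borel"
  shows "(\<integral>\<^sup>+x. (\<Prod>i\<in>I. f i (x i)) \<partial>gauss I) = (\<Prod>i\<in>I. integral\<^sup>N std_normal (f i))"
  unfolding gauss_def using assms
  by (intro product_sigma_finite.product_nn_integral_prod psf_std_normal) auto

text \<open>Exponential Markov inequality: \<open>exp (f x)\<close> is at least 1 on
  \<open>A\<close>. If \<open>A\<close> lies outside \<open>sets M\<close>, then
  \<open>emeasure\<close> takes its default value 0.\<close>

lemma emeasure_le_nn_integral_exp:
  assumes [measurable]: "f \<in> borel_measurable M"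
    and "\<And>x. x \<in> A \<Longrightarrow> 0 \<le> f x" "A \<subseteq> space M"
  shows "emeasure M A \<le> (\<integral>\<^sup>+x. ennreal (exp (f x)) \<partial>M)"
proof (cases "A \<in> sets M")
  case True
  then have "emeasure M A = (\<integral>\<^sup>+x. indicator A x \<partial>M)" by simp
  also have "\<dots> \<le> (\<integral>\<^sup>+x. ennreal (exp (f x)) \<partial>M)"
    using assms(2) by (intro nn_integral_mono) (auto simp: indicator_def ennreal_1[symmetric] simp del: ennreal_1 intro!: ennreal_leI)
  finally show ?thesis .
qed (simp add: emeasure_notin_sets)

lemma gauss_linear_tail:
  assumes I: "finite I" and y: "(\<Sum>i\<in>I. (y i)\<^sup>2) \<le> R\<^sup>2" and R: "R > 0" and \<sigma>: "\<sigma> \<ge> 0"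
  shows "emeasure (gauss I) {g \<in> space (gauss I). (\<Sum>i\<in>I. g i * y i) \<le> - \<sigma>} \<le> ennreal (exp (- \<sigma>\<^sup>2 / (2 * R\<^sup>2)))"
proof -
  \<comment> \<open>The minimizer of \<open>- l * \<sigma> + l\<^sup>2 * R\<^sup>2 / 2\<close>,
    which bounds the exponent after integration.\<close>
  define l where "l = \<sigma> / R\<^sup>2"
  have l: "l \<ge> 0" using \<sigma> by (simp add: l_def)
  have "emeasure (gauss I) {g \<in> space (gauss I). (\<Sum>i\<in>I. g i * y i) \<le> - \<sigma>}
    \<le> (\<integral>\<^sup>+g. ennreal (exp (l * (- \<sigma> - (\<Sum>i\<in>I. g i * y i)))) \<partial>gauss I)"
    using l by (intro emeasure_le_nn_integral_exp) (auto intro!: mult_nonneg_nonneg)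
  also have "\<dots> = (\<integral>\<^sup>+g. ennreal (exp (- l * \<sigma>)) * (\<Prod>i\<in>I. ennreal (exp ((- l * y i) * g i))) \<partial>gauss I)"
  proof (rule nn_integral_cong)
    fix g
    have "l * (- \<sigma> - (\<Sum>i\<in>I. g i * y i)) = - l * \<sigma> + (\<Sum>i\<in>I. (- l * y i) * g i)"
      by (simp add: right_diff_distrib sum_distrib_left sum_negf mult_ac)
    then show "ennreal (exp (l * (- \<sigma> - (\<Sum>i\<in>I. g i * y i))))
      = ennreal (exp (- l * \<sigma>)) * (\<Prod>i\<in>I. ennreal (exp ((- l * y i) * g i)))"
      using I by (simp only: exp_add exp_sum prod_ennreal ennreal_mult exp_ge_zero prod_nonneg)
  qed
  also have "\<dots> = ennreal (exp (- l * \<sigma>)) * (\<Prod>i\<in>I. ennreal (exp ((- l * y i)\<^sup>2 / 2)))"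
  proof -
    have "(\<integral>\<^sup>+g. (\<Prod>i\<in>I. ennreal (exp ((- l * y i) * g i))) \<partial>gauss I)
      = (\<Prod>i\<in>I. ennreal (exp ((- l * y i)\<^sup>2 / 2)))"
      using nn_integral_gauss_prod[OF I, of "\<lambda>i x. ennreal (exp ((- l * y i) * x))"]
      unfolding nn_integral_std_normal_exp by simp
    then show ?thesis by (subst nn_integral_cmult) auto
  qed
  also have "\<dots> = ennreal (exp (- l * \<sigma> + (\<Sum>i\<in>I. (- l * y i)\<^sup>2 / 2)))"
    using I by (simp add: prod_ennreal ennreal_mult'[symmetric] exp_sum[symmetric] exp_add[symmetric])
  also have "\<dots> \<le> ennreal (exp (- \<sigma>\<^sup>2 / (2 * R\<^sup>2)))"
  proof -
    have "(\<Sum>i\<in>I. (- l * y i)\<^sup>2 / 2) = l\<^sup>2 / 2 * (\<Sum>i\<in>I. (y i)\<^sup>2)"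
      by (simp add: sum_distrib_left power_mult_distrib)
    also have "\<dots> \<le> l\<^sup>2 / 2 * R\<^sup>2" using y by (intro mult_left_mono) auto
    also have "\<dots> = \<sigma>\<^sup>2 / (2 * R\<^sup>2)" using R by (simp add: l_def power2_eq_square)
    finally have "- l * \<sigma> + (\<Sum>i\<in>I. (- l * y i)\<^sup>2 / 2) \<le> - (\<sigma>\<^sup>2 / R\<^sup>2) + \<sigma>\<^sup>2 / (2 * R\<^sup>2)"
      by (simp add: l_def power2_eq_square)
    also have "\<dots> = - \<sigma>\<^sup>2 / (2 * R\<^sup>2)" using R by (simp add: field_simps)
    finally show ?thesis by (intro ennreal_leI) simp
  qed
  finally show ?thesis .
qed

text \<open>Multiplying the constraint by \<open>s\<close> lets the sign of \<open>s\<close> choose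
  the side: positive \<open>s\<close> treats small balls, negative \<open>s\<close> the complements
  of large ones.\<close>

lemma gauss_sq_chernoff:
  assumes I: "finite I" and s: "s > - 1 / 2"
    and A: "A \<subseteq> space (gauss I)" "\<And>x. x \<in> A \<Longrightarrow> s * (\<Sum>i\<in>I. (x i)\<^sup>2) \<le> s * b"
  shows "emeasure (gauss I) A \<le> ennreal (exp (s * b) * (1 / sqrt (1 + 2 * s)) ^ card I)"
proof -
  have "emeasure (gauss I) A \<le> (\<integral>\<^sup>+g. ennreal (exp (s * b - s * (\<Sum>i\<in>I. (g i)\<^sup>2))) \<partial>gauss I)"
    using A by (intro emeasure_le_nn_integral_exp) auto
  also have "\<dots> = (\<integral>\<^sup>+g. ennreal (exp (s * b)) * (\<Prod>i\<in>I. ennreal (exp (- s * (g i)\<^sup>2))) \<partial>gauss I)"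
  proof (rule nn_integral_cong)
    fix g
    have "s * b - s * (\<Sum>i\<in>I. (g i)\<^sup>2) = s * b + (\<Sum>i\<in>I. - s * (g i)\<^sup>2)"
      by (simp add: sum_distrib_left sum_negf)
    then show "ennreal (exp (s * b - s * (\<Sum>i\<in>I. (g i)\<^sup>2)))
      = ennreal (exp (s * b)) * (\<Prod>i\<in>I. ennreal (exp (- s * (g i)\<^sup>2)))"
      using I by (simp only: exp_add exp_sum prod_ennreal ennreal_mult exp_ge_zero prod_nonneg)
  qed
  also have "\<dots> = ennreal (exp (s * b)) * (\<Prod>i\<in>I. ennreal (1 / sqrt (1 + 2 * s)))"
  proof -
    have "(\<integral>\<^sup>+g. (\<Prod>i\<in>I. ennreal (exp (- s * (g i)\<^sup>2))) \<partial>gauss I)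
      = (\<Prod>i\<in>I. ennreal (1 / sqrt (1 + 2 * s)))"
      using nn_integral_gauss_prod[OF I, of "\<lambda>i x. ennreal (exp (- s * x\<^sup>2))"]
      unfolding nn_integral_std_normal_exp_sq[OF s] by simp
    then show ?thesis by (subst nn_integral_cmult) auto
  qed
  also have "\<dots> = ennreal (exp (s * b) * (1 / sqrt (1 + 2 * s)) ^ card I)"
    using s by (subst prod_ennreal) (auto simp: ennreal_mult'[symmetric])
  finally show ?thesis .
qed

lemma gauss_small_ball:
  fixes e :: real
  assumes I: "finite I" and e: "e > 0"
  shows "emeasure (gauss I) {x \<in> space (gauss I). (\<Sum>i\<in>I. (x i)\<^sup>2) \<le> e\<^sup>2 * real (card I)} \<le> ennreal ((2 * e) ^ card I)"
proof -
  \<comment> \<open>With this choice each coordinate contributes \<open>exp (1 / 2) \<le> 2\<close>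
    from the exponential and \<open>1 / sqrt (1 + 1 / e\<^sup>2) \<le> e\<close> from the
    integral.\<close>
  define s where "s = 1 / (2 * e\<^sup>2)"
  have s: "s > 0" using e by (simp add: s_def)
  have 1: "exp (s * (e\<^sup>2 * real (card I))) \<le> 2 ^ card I"
  proof -
    have "exp (1 / 2 :: real) \<le> 2" using exp_half_le2 by simp
    then have "exp (1 / 2 :: real) ^ card I \<le> 2 ^ card I" by (intro power_mono) auto
    then show ?thesis using e by (simp add: s_def exp_of_nat_mult[symmetric] mult.commute)
  qed
  have 2: "1 / sqrt (1 + 2 * s) \<le> e"
  proof -
    have "1 / e = sqrt (1 / e\<^sup>2)" using e by (simp add: real_sqrt_divide)
    also have "\<dots> \<le> sqrt (1 + 2 * s)" using e by (simp add: s_def)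
    finally show ?thesis using e s by (simp add: field_simps)
  qed
  have "emeasure (gauss I) {x \<in> space (gauss I). (\<Sum>i\<in>I. (x i)\<^sup>2) \<le> e\<^sup>2 * real (card I)}
    \<le> ennreal (exp (s * (e\<^sup>2 * real (card I))) * (1 / sqrt (1 + 2 * s)) ^ card I)"
    using s by (intro gauss_sq_chernoff[OF I]) (auto intro!: mult_left_mono)
  also have "\<dots> \<le> ennreal (2 ^ card I * e ^ card I)"
    using 1 2 s by (intro ennreal_leI mult_mono power_mono) auto
  finally show ?thesis by (simp add: power_mult_distrib)
qed

lemma gauss_large_ball:
  assumes I: "finite I"
  shows "emeasure (gauss I) {x \<in> space (gauss I). 36 * real (card I) < (\<Sum>i\<in>I. (x i)\<^sup>2)} \<le> ennreal (exp (- 17 / 2 * real (card I)))"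
proof -
  \<comment> \<open>The parameter \<open>- 1 / 4\<close> yields the exponent - 36 / 4 = - 9 and a
    factor \<open>sqrt 2 \<le> exp (1 / 2)\<close> per coordinate, hence - 17 / 2 in total.\<close>
  have "emeasure (gauss I) {x \<in> space (gauss I). 36 * real (card I) < (\<Sum>i\<in>I. (x i)\<^sup>2)}
    \<le> ennreal (exp (- 1 / 4 * (36 * real (card I))) * (1 / sqrt (1 + 2 * (- 1 / 4))) ^ card I)"
    by (intro gauss_sq_chernoff[OF I]) auto
  also have "\<dots> \<le> ennreal (exp (- 9 * real (card I)) * exp (1 / 2) ^ card I)"
  proof (intro ennreal_leI mult_mono power_mono)
    have "1 / sqrt (1 + 2 * (- 1 / 4)) = sqrt (2::real)" by (simp add: real_sqrt_divide)
    also have "\<dots> \<le> 3 / 2" by (rule real_le_lsqrt) (auto simp: power2_eq_square)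
    also have "\<dots> \<le> exp (1 / 2 :: real)" using exp_ge_add_one_self[of "1 / 2 :: real"] by simp
    finally show "1 / sqrt (1 + 2 * (- 1 / 4)) \<le> exp (1 / 2 :: real)" .
  qed auto
  also have "exp (- 9 * real (card I)) * exp (1 / 2) ^ card I = exp (- 17 / 2 * real (card I))"
    by (simp add: exp_of_nat_mult[symmetric] exp_add[symmetric])
  finally show ?thesis .
qed

text \<open>The mass of the unit interval starting at \<open>sqrt s\<close> is at least the density
  at its right end. There \<open>(sqrt s + 1)\<^sup>2 \<le> 2 * s + 2\<close> gives
  \<open>exp (- s - 1)\<close>, and the normalizing constant costs another
  \<open>exp (- 2)\<close>.\<close>

lemma std_normal_lower_tail:
  assumes s: "s \<ge> 0"
  shows "ennreal (exp (- s - 3)) \<le> emeasure std_normal {sqrt s..}"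
proof -
  have "ennreal (exp (- s - 3)) \<le> ennreal (std_normal_density (sqrt s + 1))"
  proof (rule ennreal_leI)
    have "(sqrt s + 1)\<^sup>2 \<le> 2 * (sqrt s)\<^sup>2 + 2"
      using sum_squares_bound[of "sqrt s" 1] by (simp add: power2_sum)
    then have 1: "exp (- s - 1) \<le> exp (- (sqrt s + 1)\<^sup>2 / 2)" using s by simp
    have "exp (- 2) \<le> (1 / 3 :: real)"
    proof -
      have "(3::real) \<le> exp 2" using exp_ge_add_one_self[of "2::real"] by simp
      then show ?thesis by (simp add: exp_minus field_simps)
    qed
    also have "(1 / 3 :: real) \<le> 1 / sqrt (2 * pi)"
    proof -
      have "sqrt (2 * pi) \<le> 3" using pi_less_4 by (intro real_le_lsqrt) auto
      then show ?thesis by (simp add: field_simps)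
    qed
    finally have 2: "exp (- 2) \<le> 1 / sqrt (2 * pi)" .
    have "exp (- s - 3) = exp (- 2) * exp (- s - 1)" by (simp add: exp_add[symmetric])
    also have "\<dots> \<le> std_normal_density (sqrt s + 1)"
      unfolding std_normal_density_def using 1 2 by (intro mult_mono) auto
    finally show "exp (- s - 3) \<le> std_normal_density (sqrt s + 1)" .
  qed
  also have "\<dots> = (\<integral>\<^sup>+x. ennreal (std_normal_density (sqrt s + 1)) * indicator {sqrt s..sqrt s + 1} x \<partial>lborel)"
    by (simp add: nn_integral_cmult_indicator)
  also have "\<dots> \<le> (\<integral>\<^sup>+x. ennreal (std_normal_density x) * indicator {sqrt s..} x \<partial>lborel)"
  proof (intro nn_integral_mono)
    fix x
    have "std_normal_density (sqrt s + 1) \<le> std_normal_density x" if "x \<in> {sqrt s..sqrt s + 1}"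
    proof -
      have "x\<^sup>2 \<le> (sqrt s + 1)\<^sup>2"
        using that s by (intro power_mono) (auto intro: order_trans[OF real_sqrt_ge_zero[OF s]])
      then show ?thesis unfolding std_normal_density_def by (intro mult_left_mono) auto
    qed
    then show "ennreal (std_normal_density (sqrt s + 1)) * indicator {sqrt s..sqrt s + 1} x
      \<le> ennreal (std_normal_density x) * indicator {sqrt s..} x"
      by (auto simp: indicator_def intro!: ennreal_leI)
  qed
  also have "\<dots> = emeasure std_normal {sqrt s..}"
    unfolding std_normal_def by (subst emeasure_density) auto
  finally show ?thesis .
qed

text \<open>The component along \<open>w\<close> is standard normal and exceeds
  \<open>sqrt s\<close> with probability at least \<open>exp (- s - 3)\<close>. The vectors of norm
  above \<open>6 * sqrt (card I)\<close> are too rare to use this up.\<close>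

lemma gauss_direction_lower_bound:
  fixes s :: real and w :: "'i \<Rightarrow> real"
  assumes I: "finite I" and s: "1 \<le> s" "s \<le> real (card I)" and w: "(\<Sum>i\<in>I. (w i)\<^sup>2) = 1"
  shows "ennreal (exp (- 5 * s)) \<le> emeasure (gauss I)
    {x \<in> space (gauss I). sqrt s \<le> (\<Sum>i\<in>I. x i * w i) \<and> (\<Sum>i\<in>I. (x i)\<^sup>2) \<le> 36 * real (card I)}"
    (is "_ \<le> emeasure _ ?C")
proof -
  let ?A = "{x \<in> space (gauss I). sqrt s \<le> (\<Sum>i\<in>I. x i * w i)}"
  let ?B = "{x \<in> space (gauss I). 36 * real (card I) < (\<Sum>i\<in>I. (x i)\<^sup>2)}"
  have C: "?C \<in> sets (gauss I)" by measurable
  have B: "?B \<in> sets (gauss I)" by measurable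
  have A: "ennreal (exp (- s - 3)) \<le> emeasure (gauss I) ?A"
  proof -
    \<comment> \<open>The functional is treated as a matrix with the single row \<open>w\<close>,
      indexed by the unit type.\<close>
    have D: "distr (gauss I) (gauss {()}) (\<lambda>x. \<lambda>j\<in>{()}. \<Sum>i\<in>I. w i * x i) = gauss {()}"
      using I w by (intro gauss_orthonormal_image[where W = "\<lambda>_. w"]) (auto simp: power2_eq_square)
    have E: "distr (gauss {()}) std_normal (\<lambda>x. x ()) = std_normal"
      unfolding gauss_def by (rule product_sigma_finite.distr_singleton[OF psf_std_normal])
    have m1: "(\<lambda>x. x ()) \<in> measurable (gauss {()}) std_normal"
      by (auto simp: gauss_def intro!: measurable_component_singleton)
    have m2: "(\<lambda>x. \<lambda>j\<in>{()}. \<Sum>i\<in>I. w i * x i) \<in> measurable (gauss I) (gauss {()})"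
      by measurable
    have "std_normal = distr (distr (gauss I) (gauss {()}) (\<lambda>x. \<lambda>j\<in>{()}. \<Sum>i\<in>I. w i * x i)) std_normal (\<lambda>x. x ())"
      by (simp add: D E)
    also have "\<dots> = distr (gauss I) std_normal ((\<lambda>x. x ()) \<circ> (\<lambda>x. \<lambda>j\<in>{()}. \<Sum>i\<in>I. w i * x i))"
      by (rule distr_distr[OF m1 m2])
    also have "(\<lambda>x. x ()) \<circ> (\<lambda>x. \<lambda>j\<in>{()}. \<Sum>i\<in>I. w i * x i) = (\<lambda>x. \<Sum>i\<in>I. x i * w i)"
      by (auto simp: fun_eq_iff mult.commute)
    finally have N: "std_normal = distr (gauss I) std_normal (\<lambda>x. \<Sum>i\<in>I. x i * w i)" .
    have "ennreal (exp (- s - 3)) \<le> emeasure std_normal {sqrt s..}"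
      using s by (intro std_normal_lower_tail) auto
    also have "\<dots> = emeasure (gauss I) ((\<lambda>x. \<Sum>i\<in>I. x i * w i) -` {sqrt s..} \<inter> space (gauss I))"
      by (subst N, rule emeasure_distr) (auto simp: measurable_cong_sets[OF refl sets_std_normal])
    also have "(\<lambda>x. \<Sum>i\<in>I. x i * w i) -` {sqrt s..} \<inter> space (gauss I) = ?A" by auto
    finally show ?thesis .
  qed
  have "ennreal (exp (- s - 3)) \<le> emeasure (gauss I) (?C \<union> ?B)"
    by (rule order_trans[OF A]) (intro emeasure_mono sets.Un C B, auto)
  also have "\<dots> \<le> emeasure (gauss I) ?C + emeasure (gauss I) ?B"
    by (rule emeasure_subadditive[OF C B])
  also have "\<dots> \<le> emeasure (gauss I) ?C + ennreal (exp (- 17 / 2 * real (card I)))"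
    by (intro add_left_mono gauss_large_ball[OF I])
  finally have 1: "ennreal (exp (- s - 3)) \<le> emeasure (gauss I) ?C + ennreal (exp (- 17 / 2 * real (card I)))" .
  \<comment> \<open>Both exponents are at most \<open>- s - 4\<close>: the first by
    \<open>1 \<le> s\<close>, the second by \<open>1 \<le> s \<le> card I\<close>. Two such terms
    fit into \<open>exp (- s - 3)\<close> since \<open>2 \<le> exp 1\<close>.\<close>
  have "exp (- 5 * s) + exp (- 17 / 2 * real (card I)) \<le> exp (- s - 4) + exp (- s - 4)"
    using s by (intro add_mono) auto
  also have "\<dots> \<le> exp 1 * exp (- s - 4)"
    using exp_ge_add_one_self[of "1::real"] by simp
  also have "\<dots> = exp (- s - 3)" by (simp add: exp_add[symmetric])
  finally have "ennreal (exp (- 5 * s) + exp (- 17 / 2 * real (card I)))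
    \<le> emeasure (gauss I) ?C + ennreal (exp (- 17 / 2 * real (card I)))"
    using 1 by (meson ennreal_leI order_trans)
  then show ?thesis
    by (simp add: ennreal_plus ennreal_add_left_cancel_le add.commute)
qed

section \<open>Concentration of suprema of Gaussian processes\<close>

text \<open>An existential over an uncountable set need not be measurable. Here the minimum over
  \<open>K\<close> is attained, and by continuity it is approached on a countable dense subset of
  \<open>K\<close>, so the event is a countable intersection of countable unions. The events about
  vectors of \<open>K\<close> below are brought into this form.\<close>

lemma measurable_compact_ex:
  fixes f :: "'w \<Rightarrow> 'x::{metric_space, second_countable_topology} \<Rightarrow> real"
  assumes K: "compact K" and meas: "\<And>x. x \<in> K \<Longrightarrow> (\<lambda>\<omega>. f \<omega> x) \<in> borel_measurable M"
    and cont: "\<And>\<omega>. \<omega> \<in> space M \<Longrightarrow> continuous_on K (f \<omega>)"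
  shows "{\<omega> \<in> space M. \<exists>x\<in>K. f \<omega> x \<le> 0} \<in> sets M"
proof (cases "K = {}")
  case False
  obtain D where D: "countable D" "D \<subseteq> K" "K \<subseteq> closure D" by (rule separable)
  have "(\<exists>x\<in>K. f \<omega> x \<le> 0) \<longleftrightarrow> (\<forall>j::nat. \<exists>x\<in>D. f \<omega> x < 1 / Suc j)" if w: "\<omega> \<in> space M" for \<omega>
  proof
    assume "\<exists>x\<in>K. f \<omega> x \<le> 0"
    then obtain x where x: "x \<in> K" "f \<omega> x \<le> 0" by auto
    show "\<forall>j::nat. \<exists>x\<in>D. f \<omega> x < 1 / Suc j"
    proof
      fix j :: nat
      have "1 / real (Suc j) > 0" by simp
      then have "\<exists>d>0. \<forall>y\<in>K. dist y x < d \<longrightarrow> dist (f \<omega> y) (f \<omega> x) < 1 / Suc j"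
        using cont[OF w] x(1) unfolding continuous_on_iff by blast
      then obtain d where d: "d > 0" "\<And>y. y \<in> K \<Longrightarrow> dist y x < d \<Longrightarrow> dist (f \<omega> y) (f \<omega> x) < 1 / Suc j"
        by auto
      obtain y where y: "y \<in> D" "dist y x < d" using D(3) x(1) d(1) closure_approachable by blast
      then have "f \<omega> y < 1 / Suc j" using d(2)[of y] x(2) D(2) by (auto simp: dist_real_def)
      then show "\<exists>x\<in>D. f \<omega> x < 1 / Suc j" using y by blast
    qed
  next
    assume *: "\<forall>j::nat. \<exists>x\<in>D. f \<omega> x < 1 / Suc j"
    obtain x where x: "x \<in> K" "\<And>y. y \<in> K \<Longrightarrow> f \<omega> x \<le> f \<omega> y"
      using continuous_attains_inf[OF K False cont[OF w]] by auto
    have "f \<omega> x \<le> 0"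
    proof (rule ccontr)
      assume "\<not> f \<omega> x \<le> 0"
      then obtain j :: nat where j: "1 / Suc j < f \<omega> x"
        using reals_Archimedean[of "f \<omega> x"] by (auto simp: inverse_eq_divide)
      obtain y where "y \<in> D" "f \<omega> y < 1 / Suc j" using * by auto
      then show False using x(2)[of y] j D(2) by fastforce
    qed
    then show "\<exists>x\<in>K. f \<omega> x \<le> 0" using x(1) by blast
  qed
  then have "{\<omega> \<in> space M. \<exists>x\<in>K. f \<omega> x \<le> 0} = {\<omega> \<in> space M. \<forall>j::nat. \<exists>x\<in>D. f \<omega> x < 1 / Suc j}"
    by auto
  also have "\<dots> \<in> sets M"
  proof -
    have "{\<omega> \<in> space M. f \<omega> x < 1 / Suc j} \<in> sets M" if "x \<in> D" for x and j :: nat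
    proof -
      have [measurable]: "(\<lambda>\<omega>. f \<omega> x) \<in> borel_measurable M" using that D(2) by (intro meas) auto
      show ?thesis by measurable
    qed
    then show ?thesis
      by (intro sets.sets_Collect_countable_All sets.sets_Collect_countable_Ex' D(1))
  qed
  finally show ?thesis .
qed simp

definition gsup :: "'i set \<Rightarrow> ('i \<Rightarrow> real) set \<Rightarrow> ('i \<Rightarrow> real) \<Rightarrow> real"
  where "gsup I T g = (SUP y\<in>T. \<Sum>i\<in>I. g i * y i)"

lemma integrable_gauss_component:
  assumes "i \<in> I"
  shows "integrable (gauss I) (\<lambda>g. \<bar>g i\<bar>)"
proof -
  have "integrable std_normal (\<lambda>x. \<bar>x\<bar>)"
    unfolding std_normal_def using integrable_std_normal_moment_abs[of 1]
    by (subst integrable_density) (auto simp: mult.commute)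
  moreover have "distr (gauss I) std_normal (\<lambda>g. g i) = std_normal"
    unfolding gauss_def using assms prob_space_std_normal by (intro distr_PiM_component) auto
  moreover have "(\<lambda>g. g i) \<in> measurable (gauss I) std_normal"
    using assms by (auto simp: gauss_def intro!: measurable_component_singleton)
  ultimately show ?thesis
    using integrable_distr[of "\<lambda>g. g i" "gauss I" std_normal "\<lambda>x. \<bar>x\<bar>"] by simp
qed

context
  fixes I :: "'i set" and T :: "('i \<Rightarrow> real) set" and R :: real
  assumes I: "finite I" and R: "R > 0" and zero: "\<exists>y\<in>T. \<forall>i\<in>I. y i = 0"
    and bound: "\<And>y. y \<in> T \<Longrightarrow> (\<Sum>i\<in>I. (y i)\<^sup>2) \<le> R\<^sup>2"
    and attained: "\<And>g. \<exists>y\<in>T. \<forall>z\<in>T. (\<Sum>i\<in>I. g i * z i) \<le> (\<Sum>i\<in>I. g i * y i)"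
    and meas[measurable]: "gsup I T \<in> borel_measurable (gauss I)"
begin

lemma gsup_attained: "\<exists>y\<in>T. gsup I T g = (\<Sum>i\<in>I. g i * y i)"
proof -
  obtain y where y: "y \<in> T" "\<And>z. z \<in> T \<Longrightarrow> (\<Sum>i\<in>I. g i * z i) \<le> (\<Sum>i\<in>I. g i * y i)"
    using attained by blast
  then have "gsup I T g = (\<Sum>i\<in>I. g i * y i)"
    unfolding gsup_def by (intro cSup_eq_maximum) auto
  then show ?thesis using y by blast
qed

lemma gsup_ge: "z \<in> T \<Longrightarrow> (\<Sum>i\<in>I. g i * z i) \<le> gsup I T g"
  unfolding gsup_def using attained[of g] by (intro cSUP_upper) (auto simp: bdd_above_def)

lemma gsup_nonneg: "0 \<le> gsup I T g"
proof -
  obtain y where "y \<in> T" "\<forall>i\<in>I. y i = 0" using zero by blast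
  then show ?thesis using gsup_ge[of y g] by simp
qed

lemma integrable_gsup: "integrable (gauss I) (gsup I T)"
proof (rule Bochner_Integration.integrable_bound)
  show "integrable (gauss I) (\<lambda>g. \<Sum>i\<in>I. \<bar>g i\<bar> * R)"
    by (intro Bochner_Integration.integrable_sum integrable_mult_left integrable_gauss_component)
  show "AE g in gauss I. norm (gsup I T g) \<le> norm (\<Sum>i\<in>I. \<bar>g i\<bar> * R)"
  proof (rule AE_I2)
    fix g
    obtain y where y: "y \<in> T" "gsup I T g = (\<Sum>i\<in>I. g i * y i)" using gsup_attained by blast
    have "g i * y i \<le> \<bar>g i\<bar> * R" if "i \<in> I" for i
    proof -
      have "(y i)\<^sup>2 \<le> (\<Sum>i\<in>I. (y i)\<^sup>2)" using I that by (intro member_le_sum) auto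
      then have "(y i)\<^sup>2 \<le> R\<^sup>2" using bound[OF y(1)] by linarith
      then have "\<bar>y i\<bar> \<le> R" using R by (simp add: abs_le_square_iff[symmetric])
      then have "\<bar>g i\<bar> * \<bar>y i\<bar> \<le> \<bar>g i\<bar> * R" by (intro mult_left_mono) auto
      moreover have "g i * y i \<le> \<bar>g i\<bar> * \<bar>y i\<bar>" by (metis abs_ge_self abs_mult)
      ultimately show ?thesis by linarith
    qed
    then have "gsup I T g \<le> (\<Sum>i\<in>I. \<bar>g i\<bar> * R)" unfolding y(2) by (intro sum_mono)
    then show "norm (gsup I T g) \<le> norm (\<Sum>i\<in>I. \<bar>g i\<bar> * R)" using gsup_nonneg[of g] by auto
  qed
qed simp

text \<open>Markov's inequality for the nonnegative supremum. A zero mean, by which Markov could not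
  divide, forces the supremum to vanish almost everywhere.\<close>

lemma gsup_half_mass: "ennreal (1 / 2) \<le> emeasure (gauss I) {g \<in> space (gauss I). gsup I T g \<le> 2 * (\<integral>g. gsup I T g \<partial>gauss I)}"
proof -
  interpret prob_space "gauss I" by (rule prob_space_gauss)
  define l where "l = (\<integral>g. gsup I T g \<partial>gauss I)"
  have l: "l \<ge> 0" unfolding l_def by (intro integral_nonneg_AE AE_I2 gsup_nonneg)
  have "prob {g \<in> space (gauss I). 2 * l < gsup I T g} \<le> 1 / 2"
  proof (cases "l = 0")
    case True
    then have "AE g in gauss I. gsup I T g = 0"
      using integral_nonneg_eq_0_iff_AE[OF integrable_gsup] gsup_nonneg by (simp add: l_def)
    then have "prob {g \<in> space (gauss I). 2 * l < gsup I T g} = prob {}"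
      using True by (intro finite_measure_eq_AE) auto
    then show ?thesis by simp
  next
    case False
    then have "l > 0" using l by simp
    have "prob {g \<in> space (gauss I). 2 * l < gsup I T g} \<le> prob {g \<in> space (gauss I). 2 * l \<le> gsup I T g}"
      by (intro finite_measure_mono) auto
    also have "\<dots> \<le> (\<integral>g. gsup I T g \<partial>gauss I) / (2 * l)"
      using \<open>l > 0\<close> gsup_nonneg
      by (intro integral_Markov_inequality_measure[OF integrable_gsup, of "{}"]) auto
    also have "\<dots> = 1 / 2" using \<open>l > 0\<close> by (simp add: l_def)
    finally show ?thesis .
  qed
  moreover have "prob {g \<in> space (gauss I). gsup I T g \<le> 2 * l} = 1 - prob {g \<in> space (gauss I). 2 * l < gsup I T g}"
    by (subst prob_compl[symmetric]) (auto intro!: arg_cong[where f = prob])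
  ultimately show ?thesis unfolding emeasure_eq_measure l_def by (intro ennreal_leI) linarith
qed

text \<open>A discrete version of the Maurey--Pisier rotation argument: two rotations by \<open>\<pi>/4\<close> lead from \<open>g\<close> to an
  independent copy \<open>h\<close>, and in each step the supremum changes by a linear functional of a Gaussian
  vector that is independent of the point at which the supremum is taken.\<close>

lemma gsup_concentration:
  assumes \<sigma>: "\<sigma> \<ge> 0"
  shows "emeasure (gauss I) {g \<in> space (gauss I). 4 * (\<integral>g. gsup I T g \<partial>gauss I) + 3 * \<sigma> < gsup I T g}
    \<le> ennreal (4 * exp (- \<sigma>\<^sup>2 / (2 * R\<^sup>2)))"
proof -
  define G where "G = gauss I"
  define p where "p = gsup I T"
  define l where "l = (\<integral>g. p g \<partial>G)"
  define \<tau> where "\<tau> = exp (- \<sigma>\<^sup>2 / (2 * R\<^sup>2))"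
  interpret G: prob_space G unfolding G_def by (rule prob_space_gauss)
  interpret P: pair_prob_space G G ..
  have [measurable]: "p \<in> borel_measurable G" unfolding p_def G_def by measurable
  have mid[measurable]: "(\<lambda>(h, g). \<lambda>i\<in>I. (h i + g i) / sqrt 2) \<in> measurable (G \<Otimes>\<^sub>M G) G"
    unfolding G_def by measurable
  \<comment> \<open>\<open>Z\<close> is the event that one rotation, from \<open>snd z\<close> to
    the normalized sum of both components, loses more than \<open>\<sigma>\<close>.\<close>
  define Z where "Z = {z \<in> space (G \<Otimes>\<^sub>M G). sqrt 2 * p (\<lambda>i\<in>I. (fst z i + snd z i) / sqrt 2) < p (snd z) - \<sigma>}"
  have Z[measurable]: "Z \<in> sets (G \<Otimes>\<^sub>M G)"
  proof -
    have [measurable]: "(\<lambda>z. p (\<lambda>i\<in>I. (fst z i + snd z i) / sqrt 2)) \<in> borel_measurable (G \<Otimes>\<^sub>M G)"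
      using measurable_compose[OF mid, of p borel] by (simp add: case_prod_unfold)
    show ?thesis unfolding Z_def by measurable
  qed
  have "emeasure (G \<Otimes>\<^sub>M G) Z = (\<integral>\<^sup>+g. emeasure G ((\<lambda>h. (h, g)) -` Z) \<partial>G)"
    by (rule P.emeasure_pair_measure_alt2) fact
  also have "\<dots> \<le> (\<integral>\<^sup>+g. ennreal \<tau> \<partial>G)"
  proof (rule nn_integral_mono)
    fix g assume "g \<in> space G"
    \<comment> \<open>The maximizer \<open>y\<close> depends on \<open>g\<close> alone. For fixed
      \<open>g\<close> the change is therefore a Gaussian linear functional of \<open>h\<close> with
      variance at most \<open>R\<^sup>2\<close>.\<close>
    obtain y where y: "y \<in> T" "p g = (\<Sum>i\<in>I. g i * y i)" unfolding p_def using gsup_attained by blast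
    have "emeasure G ((\<lambda>h. (h, g)) -` Z) \<le> emeasure G {h \<in> space G. (\<Sum>i\<in>I. h i * y i) \<le> - \<sigma>}"
    proof (rule emeasure_mono)
      show "{h \<in> space G. (\<Sum>i\<in>I. h i * y i) \<le> - \<sigma>} \<in> sets G" unfolding G_def by measurable
      show "(\<lambda>h. (h, g)) -` Z \<subseteq> {h \<in> space G. (\<Sum>i\<in>I. h i * y i) \<le> - \<sigma>}"
      proof safe
        fix h assume h: "(h, g) \<in> Z"
        then show "h \<in> space G" by (auto simp: Z_def space_pair_measure)
        define m where "m = (\<lambda>i\<in>I. (h i + g i) / sqrt 2)"
        have "(\<Sum>i\<in>I. m i * y i) = ((\<Sum>i\<in>I. h i * y i) + p g) / sqrt 2"
          by (simp add: m_def y(2) sum.distrib[symmetric] sum_divide_distrib algebra_simps)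
        moreover have "(\<Sum>i\<in>I. m i * y i) \<le> p m"
          unfolding p_def by (rule gsup_ge[OF y(1)])
        ultimately have "((\<Sum>i\<in>I. h i * y i) + p g) / sqrt 2 \<le> p m" by simp
        then have "(\<Sum>i\<in>I. h i * y i) + p g \<le> sqrt 2 * p m"
          by (simp add: pos_divide_le_eq mult.commute)
        also have "\<dots> < p g - \<sigma>" using h by (simp add: Z_def m_def)
        finally show "(\<Sum>i\<in>I. h i * y i) \<le> - \<sigma>" by simp
      qed
    qed
    also have "\<dots> \<le> ennreal \<tau>"
      unfolding G_def \<tau>_def by (rule gauss_linear_tail[OF I bound[OF y(1)] R \<sigma>])
    finally show "emeasure G ((\<lambda>h. (h, g)) -` Z) \<le> ennreal \<tau>" .
  qed
  also have "\<dots> = ennreal \<tau>" by (simp add: G.emeasure_space_1)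
  finally have Z_le: "emeasure (G \<Otimes>\<^sub>M G) Z \<le> ennreal \<tau>" .
  \<comment> \<open>The second component of \<open>rot (h, g)\<close> is the midpoint
    \<open>m\<close>, and the normalized sum of its two components is \<open>h\<close> again. So
    \<open>Z\<close> at \<open>rot (h, g)\<close> describes the second rotation, from
    \<open>m\<close> to \<open>h\<close>.\<close>
  define rot where "rot = (\<lambda>(x, y). (\<lambda>i\<in>I. (x i - y i) / sqrt 2 :: real, \<lambda>i\<in>I. (x i + y i) / sqrt 2 :: real))"
  have [measurable]: "rot \<in> measurable (G \<Otimes>\<^sub>M G) (G \<Otimes>\<^sub>M G)" unfolding rot_def G_def by measurable
  have "emeasure (G \<Otimes>\<^sub>M G) (rot -` Z \<inter> space (G \<Otimes>\<^sub>M G)) = emeasure (distr (G \<Otimes>\<^sub>M G) (G \<Otimes>\<^sub>M G) rot) Z"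
    by (simp add: emeasure_distr)
  also have "distr (G \<Otimes>\<^sub>M G) (G \<Otimes>\<^sub>M G) rot = G \<Otimes>\<^sub>M G"
    unfolding G_def rot_def by (rule gauss_pair_rotate[OF I])
  finally have rotZ_le: "emeasure (G \<Otimes>\<^sub>M G) (rot -` Z \<inter> space (G \<Otimes>\<^sub>M G)) \<le> ennreal \<tau>"
    using Z_le by simp
  define A where "A = {g \<in> space G. p g \<le> 2 * l}"
  \<comment> \<open>Outside both exceptional events
    \<open>p g \<le> 2 * p h + (1 + sqrt 2) * \<sigma>\<close>. With \<open>p h \<le> 2 * l\<close>
    on \<open>A\<close> and \<open>1 + sqrt 2 \<le> 3\<close> this excludes
    \<open>B\<close>.\<close>
  define B where "B = {g \<in> space G. 4 * l + 3 * \<sigma> < p g}"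
  have [measurable]: "A \<in> sets G" "B \<in> sets G" unfolding A_def B_def by measurable
  have sub: "A \<times> B \<subseteq> Z \<union> (rot -` Z \<inter> space (G \<Otimes>\<^sub>M G))"
  proof (rule subsetI, rule ccontr)
    fix z assume z: "z \<in> A \<times> B" "z \<notin> Z \<union> (rot -` Z \<inter> space (G \<Otimes>\<^sub>M G))"
    obtain h g where hg: "z = (h, g)" by force
    have sp: "h \<in> space G" "g \<in> space G" using z hg by (auto simp: A_def B_def)
    have spz: "z \<in> space (G \<Otimes>\<^sub>M G)" using sp by (simp add: hg space_pair_measure)
    define m where "m = (\<lambda>i\<in>I. (h i + g i) / sqrt 2)"
    have 1: "p g - \<sigma> \<le> sqrt 2 * p m" using z spz by (auto simp: Z_def hg m_def)
    have "rot z \<in> space (G \<Otimes>\<^sub>M G)" using spz by (rule measurable_space[rotated]) measurable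
    moreover have "(\<lambda>i\<in>I. (fst (rot z) i + snd (rot z) i) / sqrt 2) = h"
    proof
      fix i show "(\<lambda>i\<in>I. (fst (rot z) i + snd (rot z) i) / sqrt 2) i = h i"
        using sp(1) by (auto simp: hg rot_def G_def space_gauss extensional_def field_simps)
    qed
    moreover have "snd (rot z) = m" by (simp add: hg rot_def m_def)
    ultimately have 2: "p m - \<sigma> \<le> sqrt 2 * p h" using z spz by (auto simp: Z_def)
    have "sqrt 2 * p m \<le> sqrt 2 * (\<sigma> + sqrt 2 * p h)" using 2 by (intro mult_left_mono) auto
    also have "\<dots> = sqrt 2 * \<sigma> + 2 * p h" by (simp add: algebra_simps)
    also have "\<dots> \<le> 2 * \<sigma> + 2 * p h"
    proof -
      have "sqrt 2 \<le> (2::real)" by (rule real_le_lsqrt) auto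
      then show ?thesis using \<sigma> by (intro add_right_mono mult_right_mono) auto
    qed
    finally have "p g \<le> 3 * \<sigma> + 2 * p h" using 1 by linarith
    moreover have "p h \<le> 2 * l" "4 * l + 3 * \<sigma> < p g" using z by (auto simp: hg A_def B_def)
    ultimately show False by linarith
  qed
  have half: "ennreal (1 / 2) \<le> emeasure G A"
    using gsup_half_mass unfolding A_def l_def p_def G_def .
  have "ennreal (1 / 2) * emeasure G B \<le> emeasure G A * emeasure G B"
    by (intro mult_right_mono half) auto
  also have "\<dots> = emeasure (G \<Otimes>\<^sub>M G) (A \<times> B)"
    by (rule G.emeasure_pair_measure_Times[symmetric]) auto
  also have "\<dots> \<le> emeasure (G \<Otimes>\<^sub>M G) (Z \<union> (rot -` Z \<inter> space (G \<Otimes>\<^sub>M G)))"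
    by (rule emeasure_mono[OF sub]) measurable
  also have "\<dots> \<le> emeasure (G \<Otimes>\<^sub>M G) Z + emeasure (G \<Otimes>\<^sub>M G) (rot -` Z \<inter> space (G \<Otimes>\<^sub>M G))"
    by (rule emeasure_subadditive) measurable
  also have "\<dots> \<le> ennreal \<tau> + ennreal \<tau>" by (intro add_mono Z_le rotZ_le)
  also have "\<dots> = ennreal (2 * \<tau>)" by (subst ennreal_plus[symmetric]) (auto simp: \<tau>_def)
  finally have "ennreal (1 / 2) * ennreal (G.prob B) \<le> ennreal (2 * \<tau>)"
    by (simp only: G.emeasure_eq_measure)
  then have "ennreal (1 / 2 * G.prob B) \<le> ennreal (2 * \<tau>)"
    by (subst ennreal_mult) auto
  then have "G.prob B \<le> 4 * \<tau>" by (subst (asm) ennreal_le_iff) (auto simp: \<tau>_def)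
  then show ?thesis
    unfolding G_def[symmetric] p_def[symmetric] l_def[symmetric] \<tau>_def[symmetric] B_def[symmetric]
    by (simp add: G.emeasure_eq_measure ennreal_leI)
qed

end

section \<open>Orthonormal families and the Grassmannian\<close>

lemma RN_iff: "x \<in> RN N \<longleftrightarrow> (\<forall>i\<ge>N. x i = 0)"
  by (simp add: topspace_Euclidean_space)

lemma sum_fun_apply: "(\<Sum>j\<in>A. f j) i = (\<Sum>j\<in>A. f j i)" for f :: "'j \<Rightarrow> 'i \<Rightarrow> real"
  by (induction A rule: infinite_finite_induct) auto

lemma scaleR_fun_apply [simp]: "(c *\<^sub>R f) i = c * f i" for f :: "'i \<Rightarrow> real"
  by (simp add: scaleR_fun_def)

lemma inner_N_commute: "inner_N N x y = inner_N N y x"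
  by (simp add: inner_N_def mult.commute)

lemma inner_N_add_left: "inner_N N (x + y) z = inner_N N x z + inner_N N y z"
  by (simp add: inner_N_def algebra_simps sum.distrib)

lemma inner_N_diff_left: "inner_N N (x - y) z = inner_N N x z - inner_N N y z"
  by (simp add: inner_N_def algebra_simps sum_subtractf)

lemma inner_N_scaleR_left: "inner_N N (c *\<^sub>R x) z = c * inner_N N x z"
  by (simp add: inner_N_def sum_distrib_left mult.assoc)

lemma inner_N_zero_left [simp]: "inner_N N 0 z = 0"
  by (simp add: inner_N_def)

lemma inner_N_sum_left: "inner_N N (\<Sum>j\<in>A. f j) z = (\<Sum>j\<in>A. inner_N N (f j) z)"
  unfolding inner_N_def sum_fun_apply sum_distrib_right by (rule sum.swap)

lemma inner_N_add_right: "inner_N N z (x + y) = inner_N N z x + inner_N N z y"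
  and inner_N_scaleR_right: "inner_N N z (c *\<^sub>R x) = c * inner_N N z x"
  and inner_N_sum_right: "inner_N N z (\<Sum>j\<in>A. f j) = (\<Sum>j\<in>A. inner_N N z (f j))"
  by (simp_all add: inner_N_commute[of N z] inner_N_add_left inner_N_scaleR_left inner_N_sum_left)

lemma inner_N_self_nonneg: "0 \<le> inner_N N x x"
  by (simp add: inner_N_def sum_nonneg)

lemma norm_N_sq: "(norm_N N x)\<^sup>2 = inner_N N x x"
  by (simp add: norm_N_def inner_N_self_nonneg)

lemma norm_N_nonneg: "0 \<le> norm_N N x"
  by (simp add: norm_N_def inner_N_self_nonneg)

lemma inner_N_self_eq_0: "x \<in> RN N \<Longrightarrow> inner_N N x x = 0 \<longleftrightarrow> x = 0"
proof
  assume x: "x \<in> RN N" and "inner_N N x x = 0"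
  then have "\<forall>i\<in>{..<N}. x i * x i = 0"
    unfolding inner_N_def by (subst (asm) sum_nonneg_eq_0_iff) auto
  then have "x i = 0" for i using x by (cases "i < N") (auto simp: RN_iff)
  then show "x = 0" by (simp add: fun_eq_iff)
qed simp

lemma subspace_RN: "subspace (RN N)"
  by (auto simp: subspace_def RN_iff)

text \<open>A family on all of \<open>nat\<close> of which only the first \<open>d\<close> members
  count, so initial segments and extensions of a basis need no reindexing.\<close>

definition orthonormal :: "nat \<Rightarrow> (nat \<Rightarrow> nat \<Rightarrow> real) \<Rightarrow> nat \<Rightarrow> bool"
  where "orthonormal N b d \<longleftrightarrow> (\<forall>i<d. b i \<in> RN N) \<and>
    (\<forall>i<d. \<forall>j<d. inner_N N (b i) (b j) = (if i = j then 1 else 0))"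

lemma orthonormalD:
  assumes "orthonormal N b d"
  shows "i < d \<Longrightarrow> b i \<in> RN N"
    and "i < d \<Longrightarrow> j < d \<Longrightarrow> inner_N N (b i) (b j) = (if i = j then 1 else 0)"
  using assms by (auto simp: orthonormal_def)

lemma orthonormal_mono: "orthonormal N b d \<Longrightarrow> d' \<le> d \<Longrightarrow> orthonormal N b d'"
  by (auto simp: orthonormal_def)

lemma orthonormal_inj: "orthonormal N b d \<Longrightarrow> inj_on b {..<d}"
  by (rule inj_onI) (metis lessThan_iff orthonormalD(2) zero_neq_one)

lemma inner_N_lincomb_orthonormal:
  assumes b: "orthonormal N b d" and j: "j < d"
  shows "inner_N N (\<Sum>i<d. c i *\<^sub>R b i) (b j) = c j"
proof -
  have "inner_N N (\<Sum>i<d. c i *\<^sub>R b i) (b j) = (\<Sum>i<d. if i = j then c i else 0)"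
    unfolding inner_N_sum_left inner_N_scaleR_left
    using j by (intro sum.cong refl) (auto simp: orthonormalD(2)[OF b])
  then show ?thesis using j by simp
qed

lemma orthonormal_independent:
  assumes b: "orthonormal N b d"
  shows "independent (b ` {..<d})"
proof (rule independent_if_scalars_zero)
  fix f x assume *: "(\<Sum>x\<in>b ` {..<d}. f x *\<^sub>R x) = 0" and "x \<in> b ` {..<d}"
  then obtain j where j: "j < d" "x = b j" by auto
  have "(\<Sum>i<d. f (b i) *\<^sub>R b i) = 0"
    using * sum.reindex[OF orthonormal_inj[OF b], of "\<lambda>x. f x *\<^sub>R x"] by (simp add: o_def)
  then show "f x = 0" using inner_N_lincomb_orthonormal[OF b j(1), of "\<lambda>i. f (b i)"] j by simp
qed simp

lemma card_orthonormal: "orthonormal N b d \<Longrightarrow> card (b ` {..<d}) = d"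
  by (simp add: card_image orthonormal_inj)

lemma dim_span_orthonormal: "orthonormal N b d \<Longrightarrow> dim (span (b ` {..<d})) = d"
  using dim_span_eq_card_independent[OF orthonormal_independent] card_orthonormal by simp

lemma span_orthonormal_subset: "orthonormal N b d \<Longrightarrow> span (b ` {..<d}) \<subseteq> RN N"
  by (intro span_minimal subspace_RN) (auto dest: orthonormalD(1))

lemma lincomb_in_span: "(\<Sum>i<d. c i *\<^sub>R b i) \<in> span (b ` {..<d})" for b :: "nat \<Rightarrow> nat \<Rightarrow> real"
  by (intro span_sum span_scale span_base) auto

lemma inner_N_span_zero:
  assumes "\<And>y. y \<in> B \<Longrightarrow> inner_N N x y = 0" and z: "z \<in> span B"
  shows "inner_N N x z = 0"
  using z
proof (rule span_induct)
  show "subspace {z. inner_N N x z = 0}"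
    by (auto simp: subspace_def inner_N_add_right inner_N_scaleR_right inner_N_commute[of N x 0])
qed (use assms in auto)

lemma span_orthonormal_expand:
  assumes b: "orthonormal N b d" and x: "x \<in> span (b ` {..<d})"
  shows "x = (\<Sum>i<d. inner_N N x (b i) *\<^sub>R b i)"
proof -
  define y where "y = x - (\<Sum>i<d. inner_N N x (b i) *\<^sub>R b i)"
  have y: "y \<in> span (b ` {..<d})" unfolding y_def by (intro span_diff x lincomb_in_span)
  have "inner_N N y z = 0" if "z \<in> b ` {..<d}" for z
    using that by (auto simp: y_def inner_N_diff_left inner_N_lincomb_orthonormal[OF b])
  then have "inner_N N y y = 0" using inner_N_span_zero y by blast
  moreover have "y \<in> RN N" using y span_orthonormal_subset[OF b] by blast
  ultimately show ?thesis using inner_N_self_eq_0 by (simp add: y_def)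
qed

definition unit_N :: "nat \<Rightarrow> nat \<Rightarrow> real"
  where "unit_N j = (\<lambda>i. if i = j then 1 else 0)"

lemma inner_N_unit: "j < N \<Longrightarrow> inner_N N x (unit_N j) = x j"
  by (simp add: inner_N_def unit_N_def if_distrib[of "\<lambda>z. _ * z"] cong: if_cong)

lemma orthonormal_unit: "orthonormal N unit_N N"
  by (auto simp: orthonormal_def RN_iff inner_N_unit) (auto simp: unit_N_def)

lemma span_unit: "span (unit_N ` {..<N}) = RN N"
proof (intro equalityI span_orthonormal_subset orthonormal_unit subsetI)
  fix x assume x: "x \<in> RN N"
  have "x = (\<Sum>i<N. x i *\<^sub>R unit_N i)"
    using x by (auto simp: fun_eq_iff sum_fun_apply RN_iff unit_N_def if_distrib[of "\<lambda>z. _ * z"] cong: if_cong)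
  then show "x \<in> span (unit_N ` {..<N})" using lincomb_in_span[of x unit_N N] by simp
qed

lemma dim_RN: "dim (RN N) = N"
  using dim_span_orthonormal[OF orthonormal_unit, of N] by (simp add: span_unit)

text \<open>The ambient space of sequences has infinite dimension; finiteness has to come from the
  \<open>N\<close> unit vectors spanning \<open>RN N\<close>.\<close>

lemma independent_RN_card:
  assumes "independent B" "B \<subseteq> S" "subspace S" "S \<subseteq> RN N"
  shows "finite B" "card B \<le> dim S"
proof -
  obtain C where C: "C \<subseteq> S" "independent C" "S \<subseteq> span C" "card C = dim S"
    by (rule basis_exists)
  have fin: "finite D" if "independent D" "D \<subseteq> RN N" for D
    using independent_span_bound[of "unit_N ` {..<N}" D] that by (auto simp: span_unit)
  show "finite B" using fin assms by blast
  have "finite C" using fin C assms(4) by blast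
  then show "card B \<le> dim S" using independent_span_bound[of C B] assms C by auto
qed

lemma orthonormal_le_dim:
  assumes b: "orthonormal N b d" "b ` {..<d} \<subseteq> S" and S: "subspace S" "S \<subseteq> RN N"
  shows "d \<le> dim S"
  using independent_RN_card(2)[OF orthonormal_independent[OF b(1)] b(2) S] card_orthonormal[OF b(1)] by simp

lemma orthonormal_extend_step:
  assumes b: "orthonormal N b d" "b ` {..<d} \<subseteq> S" and S: "subspace S" "S \<subseteq> RN N"
    and x: "x \<in> S" "x \<notin> span (b ` {..<d})"
  shows "\<exists>y\<in>S. orthonormal N (b(d := y)) (Suc d)"
proof -
  define z where "z = x - (\<Sum>i<d. inner_N N x (b i) *\<^sub>R b i)"
  have "span (b ` {..<d}) \<subseteq> S" using b S by (intro span_minimal)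
  then have "(\<Sum>i<d. inner_N N x (b i) *\<^sub>R b i) \<in> S"
    by (rule subsetD) (rule lincomb_in_span)
  then have zS: "z \<in> S" unfolding z_def by (intro subspace_diff S x)
  have "z \<noteq> 0" using x lincomb_in_span[of "\<lambda>i. inner_N N x (b i)" b d] by (auto simp: z_def)
  then have z0: "inner_N N z z > 0"
    using inner_N_self_eq_0[of z N] inner_N_self_nonneg[of N z] zS S by fastforce
  have zb: "inner_N N z (b i) = 0" if "i < d" for i
    using that by (simp add: z_def inner_N_diff_left inner_N_lincomb_orthonormal[OF b(1)])
  define y where "y = (1 / sqrt (inner_N N z z)) *\<^sub>R z"
  have yS: "y \<in> S" unfolding y_def using zS S by (intro subspace_scale)
  have yb: "inner_N N y (b i) = 0" if "i < d" for i
    by (simp add: y_def inner_N_scaleR_left zb[OF that])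
  have yy: "inner_N N y y = 1"
    using z0 by (simp add: y_def inner_N_scaleR_left inner_N_scaleR_right field_simps)
  have "orthonormal N (b(d := y)) (Suc d)"
    unfolding orthonormal_def
  proof (intro conjI allI impI)
    fix i j assume i: "i < Suc d" and j: "j < Suc d"
    show "(b(d := y)) i \<in> RN N" using yS S(2) orthonormalD(1)[OF b(1), of i] i by (cases "i = d") auto
    show "inner_N N ((b(d := y)) i) ((b(d := y)) j) = (if i = j then 1 else 0)"
      using yy yb[of i] yb[of j] i j orthonormalD(2)[OF b(1), of i j] inner_N_commute[of N y "b i"]
      by (cases "i = d"; cases "j = d") auto
  qed
  then show ?thesis using yS by blast
qed

text \<open>Gram-Schmidt, which must stop because no orthonormal family in \<open>S\<close> is
  longer than \<open>dim S\<close>. The given vectors stay in front, so a basis can be adapted to a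
  subspace first and completed to all of R^N afterwards.\<close>

lemma orthonormal_extend:
  assumes b: "orthonormal N b d" "b ` {..<d} \<subseteq> S" and S: "subspace S" "S \<subseteq> RN N"
  shows "\<exists>b'. (\<forall>i<d. b' i = b i) \<and> orthonormal N b' (dim S) \<and> S = span (b' ` {..<dim S})"
  using b
proof (induction "dim S - d" arbitrary: b d rule: less_induct)
  case less
  have d: "d \<le> dim S" by (rule orthonormal_le_dim[OF less(2,3) S])
  have sub: "span (b ` {..<d}) \<subseteq> S" using less(3) S by (intro span_minimal)
  show ?case
  proof (cases "S \<subseteq> span (b ` {..<d})")
    case True
    then have eq: "S = span (b ` {..<d})" using sub by auto
    then have "dim S = d" using dim_span_orthonormal[OF less(2)] by simp
    then show ?thesis using eq less(2) by blast
  next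
    case False
    then obtain x where "x \<in> S" "x \<notin> span (b ` {..<d})" by auto
    then obtain y where y: "y \<in> S" "orthonormal N (b(d := y)) (Suc d)"
      using orthonormal_extend_step[OF less(2,3) S] by blast
    have im: "(b(d := y)) ` {..<Suc d} \<subseteq> S" using y(1) less(3) by (auto simp: less_Suc_eq)
    have "Suc d \<le> dim S" by (rule orthonormal_le_dim[OF y(2) im S])
    then obtain b' where "\<forall>i<Suc d. b' i = (b(d := y)) i" "orthonormal N b' (dim S)" "S = span (b' ` {..<dim S})"
      using less(1)[OF _ y(2) im] by (metis Suc_le_lessD diff_less_mono2 lessI)
    then show ?thesis by (intro exI[of _ b']) auto
  qed
qed

lemma orthonormal_full_span: "orthonormal N b N \<Longrightarrow> span (b ` {..<N}) = RN N"
proof -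
  assume b: "orthonormal N b N"
  then have "b ` {..<N} \<subseteq> RN N" by (auto dest: orthonormalD(1))
  from orthonormal_extend[OF b this subspace_RN subset_refl]
  obtain b' where "\<forall>i<N. b' i = b i" "RN N = span (b' ` {..<N})" unfolding dim_RN by blast
  then show ?thesis by (metis image_cong lessThan_iff)
qed

lemma orthonormal_expand:
  assumes "orthonormal N b N" "x \<in> RN N"
  shows "x = (\<Sum>i<N. inner_N N x (b i) *\<^sub>R b i)"
  using span_orthonormal_expand[OF assms(1)] assms(2) by (simp add: orthonormal_full_span[OF assms(1)])

section \<open>Subspaces of fixed codimension, their projections and rotations\<close>

lemma grassmannian_basis_extend:
  assumes E: "E \<in> grassmannian N k" and b: "orthonormal N b d" "b ` {..<d} \<subseteq> E"
  shows "\<exists>b'. (\<forall>i<d. b' i = b i) \<and> orthonormal N b' N \<and> E = span (b' ` {..<N - k})"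
proof -
  have S: "subspace E" "E \<subseteq> RN N" "dim E = N - k" using E by (auto simp: grassmannian_def)
  obtain b1 where b1: "\<forall>i<d. b1 i = b i" "orthonormal N b1 (N - k)" "E = span (b1 ` {..<N - k})"
    using orthonormal_extend[OF b S(1,2)] S(3) by auto
  have "b1 ` {..<N - k} \<subseteq> RN N" using b1(2) by (auto dest: orthonormalD(1))
  from orthonormal_extend[OF b1(2) this subspace_RN subset_refl]
  obtain b' where b': "\<forall>i<N - k. b' i = b1 i" "orthonormal N b' N" unfolding dim_RN by blast
  have "d \<le> N - k" using orthonormal_le_dim[OF b S(1,2)] S(3) by simp
  moreover have "b' ` {..<N - k} = b1 ` {..<N - k}" using b'(1) by (intro image_cong) auto
  ultimately show ?thesis using b1 b' by (intro exI[of _ b']) auto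
qed

lemma grassmannian_basis:
  assumes "E \<in> grassmannian N k"
  obtains b where "orthonormal N b N" "E = span (b ` {..<N - k})"
  using grassmannian_basis_extend[OF assms, of "\<lambda>_. 0" 0] by (auto simp: orthonormal_def)

lemma span_in_grassmannian:
  assumes "orthonormal N b N" "k \<le> N"
  shows "span (b ` {..<N - k}) \<in> grassmannian N k"
  using assms dim_span_orthonormal[OF orthonormal_mono[OF assms(1)], of "N - k"]
    span_orthonormal_subset[OF orthonormal_mono[OF assms(1)], of "N - k"]
  by (simp add: grassmannian_def)

lemma orth_proj_span:
  assumes b: "orthonormal N b d"
  shows "orth_proj N (span (b ` {..<d})) x = (\<Sum>i<d. inner_N N x (b i) *\<^sub>R b i)" (is "_ = ?y")
  unfolding orth_proj_def
proof (rule the_equality)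
  show y: "?y \<in> span (b ` {..<d}) \<and> (\<forall>z\<in>span (b ` {..<d}). inner_N N (x - ?y) z = 0)"
  proof (intro conjI ballI lincomb_in_span)
    fix z assume "z \<in> span (b ` {..<d})"
    then show "inner_N N (x - ?y) z = 0"
      by (rule inner_N_span_zero[rotated]) (auto simp: inner_N_diff_left inner_N_lincomb_orthonormal[OF b])
  qed
  fix y assume *: "y \<in> span (b ` {..<d}) \<and> (\<forall>z\<in>span (b ` {..<d}). inner_N N (x - y) z = 0)"
  have "inner_N N x (b i) = inner_N N y (b i)" if "i < d" for i
    using * that by (auto simp: inner_N_diff_left intro: span_base)
  then have "?y = (\<Sum>i<d. inner_N N y (b i) *\<^sub>R b i)" by (intro sum.cong refl) auto
  then show "y = ?y" using span_orthonormal_expand[OF b, of y] * by simp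
qed

text \<open>Reduces the projection of any sequence, also of a Gaussian one that is
  \<open>undefined\<close> from index \<open>N\<close> on, to the matrix entries that carry the
  Borel structure of the Grassmannian.\<close>

lemma orth_proj_expand:
  assumes "F \<in> grassmannian N n"
  shows "orth_proj N F x k = (\<Sum>i<N. x i * orth_proj N F (unit_N i) k)"
proof -
  obtain b where b: "orthonormal N b N" "F = span (b ` {..<N - n})" by (rule grassmannian_basis[OF assms])
  have o: "orthonormal N b (N - n)" using b by (intro orthonormal_mono[OF b(1)]) auto
  have *: "inner_N N x (b j) = (\<Sum>i<N. x i * inner_N N (unit_N i) (b j))" for j
    by (subst inner_N_def) (intro sum.cong refl, simp add: inner_N_commute[of N "unit_N _"] inner_N_unit)
  show ?thesis
    unfolding b(2) orth_proj_span[OF o] sum_fun_apply scaleR_fun_apply *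
    by (simp add: sum_distrib_left sum_distrib_right mult.assoc) (rule sum.swap)
qed

lemma norm_sq_lincomb:
  assumes "orthonormal N b d"
  shows "inner_N N (\<Sum>i<d. c i *\<^sub>R b i) (\<Sum>i<d. c i *\<^sub>R b i) = (\<Sum>i<d. (c i)\<^sup>2)"
  unfolding inner_N_sum_right inner_N_scaleR_right
  by (intro sum.cong refl) (simp add: inner_N_lincomb_orthonormal[OF assms] power2_eq_square)

text \<open>For orthonormal bases this is the rotation sending \<open>b j\<close> to
  \<open>c j\<close>, with inverse \<open>basis_map N c b\<close> on R^N. Rotations of this form
  already act transitively on each Grassmannian.\<close>

definition basis_map :: "nat \<Rightarrow> (nat \<Rightarrow> nat \<Rightarrow> real) \<Rightarrow> (nat \<Rightarrow> nat \<Rightarrow> real) \<Rightarrow> (nat \<Rightarrow> real) \<Rightarrow> nat \<Rightarrow> real"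
  where "basis_map N b c x = (\<Sum>j<N. inner_N N x (b j) *\<^sub>R c j)"

context
  fixes N b c assumes b: "orthonormal N b N" and c: "orthonormal N c N"
begin

lemma basis_map_in_RN: "basis_map N b c x \<in> RN N"
  using span_orthonormal_subset[OF c] lincomb_in_span[of "\<lambda>j. inner_N N x (b j)" c N]
  by (auto simp: basis_map_def)

lemma inner_N_basis_map: "j < N \<Longrightarrow> inner_N N (basis_map N b c x) (c j) = inner_N N x (b j)"
  unfolding basis_map_def by (rule inner_N_lincomb_orthonormal[OF c])

lemma inner_N_parseval:
  assumes "x \<in> RN N \<or> y \<in> RN N"
  shows "inner_N N x y = (\<Sum>j<N. inner_N N x (b j) * inner_N N y (b j))"
proof -
  have *: "inner_N N x y = (\<Sum>j<N. inner_N N x (b j) * inner_N N y (b j))" if "x \<in> RN N" for x y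
  proof -
    have "inner_N N x y = inner_N N (\<Sum>i<N. inner_N N x (b i) *\<^sub>R b i) y"
      using orthonormal_expand[OF b that] by simp
    then show ?thesis by (simp add: inner_N_sum_left inner_N_scaleR_left inner_N_commute[of N y])
  qed
  show ?thesis using assms *[of x y] *[of y x] by (auto simp: inner_N_commute[of N y x] mult.commute)
qed

lemma basis_map_linear: "linear (basis_map N b c)"
  by (rule linearI)
    (simp_all add: basis_map_def inner_N_add_left inner_N_scaleR_left scaleR_add_left sum.distrib
      scaleR_sum_right)

lemma basis_map_rotation: "rotation N (basis_map N b c)"
  unfolding rotation_def
proof (intro conjI ballI basis_map_linear basis_map_in_RN)
  fix x assume "x \<in> RN N"
  then show "norm_N N (basis_map N b c x) = norm_N N x"
    unfolding norm_N_def using inner_N_parseval[of x x]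
    by (simp add: basis_map_def norm_sq_lincomb[OF c] power2_eq_square)
qed

lemma basis_map_image_span:
  assumes "d \<le> N"
  shows "basis_map N b c ` span (b ` {..<d}) = span (c ` {..<d})"
proof -
  have "basis_map N b c (b i) = c i" if "i < d" for i
  proof -
    have "basis_map N b c (b i) = (\<Sum>j<N. if j = i then c j else 0)"
      unfolding basis_map_def using that assms by (intro sum.cong refl) (auto simp: orthonormalD(2)[OF b])
    then show ?thesis using that assms by simp
  qed
  then have "basis_map N b c ` b ` {..<d} = c ` {..<d}" by (force simp: image_image)
  then show ?thesis using linear_span_image[OF basis_map_linear, of "b ` {..<d}"] by simp
qed

lemma inner_N_basis_map_left:
  assumes "y \<in> RN N"
  shows "inner_N N (basis_map N b c x) (basis_map N b c y) = inner_N N x y"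
proof -
  have "inner_N N (basis_map N b c x) (basis_map N b c y) = (\<Sum>j<N. inner_N N x (b j) * inner_N N y (b j))"
    unfolding basis_map_def[of N b c y] inner_N_sum_right inner_N_scaleR_right
    by (intro sum.cong refl) (simp add: inner_N_basis_map)
  then show ?thesis using inner_N_parseval assms by simp
qed

end

text \<open>An orthonormal basis adapted to \<open>F\<close> is carried to one adapted to the image.
  The second claim is the conjugation formula P_UF = U P_F U^-1, and the third says that projecting
  commutes with the rotation up to an isometry.\<close>

lemma basis_map_image_grassmannian:
  assumes b: "orthonormal N b N" and c: "orthonormal N c N" and F: "F \<in> grassmannian N n"
  shows "basis_map N b c ` F \<in> grassmannian N n"
    and "orth_proj N (basis_map N b c ` F) x = basis_map N b c (orth_proj N F (basis_map N c b x))"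
    and "inner_N N (orth_proj N (basis_map N b c ` F) (basis_map N b c y)) (orth_proj N (basis_map N b c ` F) (basis_map N b c y))
      = inner_N N (orth_proj N F y) (orth_proj N F y)"
proof -
  let ?U = "basis_map N b c"
  obtain q where q: "orthonormal N q N" "F = span (q ` {..<N - n})" by (rule grassmannian_basis[OF F])
  have n: "n \<le> N" using F by (auto simp: grassmannian_def)
  define q' where "q' = (\<lambda>i. ?U (q i))"
  have q'N: "orthonormal N q' N"
    unfolding orthonormal_def
  proof (intro conjI allI impI)
    fix i j assume "i < N" "j < N"
    then show "q' i \<in> RN N" "inner_N N (q' i) (q' j) = (if i = j then 1 else 0)"
      unfolding q'_def using basis_map_in_RN[OF b c] inner_N_basis_map_left[OF b c orthonormalD(1)[OF q(1)]]
        orthonormalD(2)[OF q(1)] by (auto simp only:)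
  qed
  have UF: "?U ` F = span (q' ` {..<N - n})"
    unfolding q(2) using linear_span_image[OF basis_map_linear[OF b c], of "q ` {..<N - n}"]
    by (simp add: q'_def image_image)
  show "?U ` F \<in> grassmannian N n" unfolding UF by (rule span_in_grassmannian[OF q'N n])
  have q': "orthonormal N q' (N - n)" and q0: "orthonormal N q (N - n)"
    by (auto intro: orthonormal_mono[OF q'N] orthonormal_mono[OF q(1)])
  have UV: "inner_N N x (q' i) = inner_N N (basis_map N c b x) (q i)" if "i < N" for i x
  proof -
    have "inner_N N (basis_map N c b x) (q i) = (\<Sum>j<N. inner_N N (basis_map N c b x) (b j) * inner_N N (q i) (b j))"
      using orthonormalD(1)[OF q(1) that] by (intro inner_N_parseval[OF b c]) auto
    also have "\<dots> = (\<Sum>j<N. inner_N N x (c j) * inner_N N (q' i) (c j))"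
      by (intro sum.cong refl) (simp add: q'_def inner_N_basis_map[OF b c] inner_N_basis_map[OF c b])
    also have "\<dots> = inner_N N x (q' i)"
      using orthonormalD(1)[OF q'N that] by (intro inner_N_parseval[OF c b, symmetric]) auto
    finally show ?thesis by simp
  qed
  show "orth_proj N (?U ` F) x = ?U (orth_proj N F (basis_map N c b x))" for x
  proof -
    have "?U (orth_proj N F (basis_map N c b x))
      = (\<Sum>i<N - n. inner_N N (basis_map N c b x) (q i) *\<^sub>R q' i)"
      unfolding q(2) orth_proj_span[OF q0]
      by (simp add: linear_sum[OF basis_map_linear[OF b c]] linear_scale[OF basis_map_linear[OF b c]] q'_def)
    also have "\<dots> = orth_proj N (?U ` F) x"
      unfolding UF orth_proj_span[OF q'] using UV by (intro sum.cong refl) auto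
    finally show ?thesis by simp
  qed
  have "inner_N N (basis_map N b c y) (q' i) = inner_N N y (q i)" if "i < N" for i
    unfolding q'_def using orthonormalD(1)[OF q(1) that] by (intro inner_N_basis_map_left[OF b c])
  then show "inner_N N (orth_proj N (?U ` F) (?U y)) (orth_proj N (?U ` F) (?U y))
      = inner_N N (orth_proj N F y) (orth_proj N F y)"
    unfolding UF orth_proj_span[OF q'] norm_sq_lincomb[OF q']
    unfolding q(2) orth_proj_span[OF q0] norm_sq_lincomb[OF q0]
    by (intro sum.cong refl) auto
qed

lemma orthonormal_columns:
  assumes c: "orthonormal N c N" and "i < N" "i' < N"
  shows "(\<Sum>j<N. c j i * c j i') = (if i = i' then 1 else 0)"
proof -
  have "unit_N i = (\<Sum>j<N. inner_N N (unit_N i) (c j) *\<^sub>R c j)"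
    using orthonormalD(1)[OF orthonormal_unit assms(2)] by (rule orthonormal_expand[OF c])
  then have "unit_N i i' = (\<Sum>j<N. inner_N N (unit_N i) (c j) *\<^sub>R c j) i'" by (rule fun_cong)
  also have "\<dots> = (\<Sum>j<N. c j i * c j i')"
    using assms(2) by (simp add: sum_fun_apply inner_N_commute[of N "unit_N i"] inner_N_unit)
  finally show ?thesis by (auto simp: unit_N_def)
qed

lemma orthonormal_complement:
  fixes \<gamma> :: "'j \<Rightarrow> nat \<Rightarrow> real"
  assumes \<gamma>: "\<And>j. j \<in> A \<Longrightarrow> \<gamma> j \<in> RN N" and A: "finite A" "card A \<le> p" "p \<le> N"
  shows "\<exists>q. orthonormal N q N \<and> (\<forall>i<N - p. \<forall>j\<in>A. inner_N N (\<gamma> j) (q i) = 0)"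
proof -
  let ?S = "span (\<gamma> ` A)"
  have S: "subspace ?S" "?S \<subseteq> RN N" by simp (rule span_minimal[OF image_subsetI[OF \<gamma>] subspace_RN])
  have dS: "dim ?S \<le> p"
    using dim_le_card[of "?S" "\<gamma> ` A"] card_image_le[of A \<gamma>] A by simp
  then have "?S \<in> grassmannian N (N - dim ?S)" using S A by (simp add: grassmannian_def)
  then obtain q where q: "orthonormal N q N" "?S = span (q ` {..<dim ?S})"
    using grassmannian_basis[of ?S N "N - dim ?S"] dS A by (metis diff_diff_cancel order_trans)
  \<comment> \<open>The reversal moves the vectors orthogonal to the span to the front. As
    \<open>dim ?S \<le> p\<close>, the first \<open>N - p\<close> of them never reach the span, even
    if the \<open>\<gamma> j\<close> are linearly dependent.\<close>
  define q' where "q' i = q (N - 1 - i)" for i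
  have q': "orthonormal N q' N"
    using q(1) by (auto simp: orthonormal_def q'_def simp del: topspace_Euclidean_space)
  have "inner_N N (\<gamma> a) (q' i) = 0" if "a \<in> A" "i < N - p" for a i
  proof -
    have "\<gamma> a \<in> span (q ` {..<dim ?S})" unfolding q(2)[symmetric] using that by (intro span_base) auto
    moreover have "inner_N N (q' i) z = 0" if "z \<in> q ` {..<dim ?S}" for z
    proof -
      from that obtain j where j: "j < dim ?S" "z = q j" by auto
      have "N - 1 - i < N" "j < N" "N - 1 - i \<noteq> j" using \<open>i < N - p\<close> j dS A by auto
      then show ?thesis using orthonormalD(2)[OF q(1)] by (simp add: q'_def j)
    qed
    ultimately show ?thesis using inner_N_span_zero by (metis inner_N_commute)
  qed
  then show ?thesis using q' by blast
qed

lemma inner_N_cauchy_schwarz: "(inner_N N x y)\<^sup>2 \<le> inner_N N x x * inner_N N y y"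
  using Cauchy_Schwarz_ineq_sum[of x y "{..<N}"] by (simp add: inner_N_def power2_eq_square)

lemma inner_N_orth_proj:
  assumes "F \<in> grassmannian N n" "x \<in> F"
  shows "inner_N N (orth_proj N F g) x = inner_N N g x"
proof -
  obtain b where b: "orthonormal N b N" "F = span (b ` {..<N - n})" by (rule grassmannian_basis[OF assms(1)])
  have o: "orthonormal N b (N - n)" by (rule orthonormal_mono[OF b(1)]) simp
  have "inner_N N g x = inner_N N g (\<Sum>i<N - n. inner_N N x (b i) *\<^sub>R b i)"
    using span_orthonormal_expand[OF o] assms(2) b(2) by metis
  also have "\<dots> = inner_N N (orth_proj N F g) x"
    unfolding b(2) orth_proj_span[OF o] inner_N_sum_left inner_N_sum_right inner_N_scaleR_left inner_N_scaleR_right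
    by (intro sum.cong refl) (simp add: inner_N_commute[of N x])
  finally show ?thesis by simp
qed

lemma continuous_on_inner_N: "continuous_on K (\<lambda>x. inner_N N x y)"
  unfolding inner_N_def
  by (intro continuous_on_sum continuous_on_mult continuous_on_const
      continuous_on_subset[OF continuous_on_product_coordinates]) auto

section \<open>Comparison of the Haar measure with a Gaussian matrix\<close>

text \<open>The squared Hilbert-Schmidt norm of \<Gamma> restricted to \<open>F\<close>. For
  \<open>F\<close> in the Grassmannian it vanishes exactly when \<open>F\<close> lies in the kernel
  of \<Gamma>.\<close>

definition proj_sq :: "nat \<Rightarrow> nat \<Rightarrow> (nat \<Rightarrow> real) set \<Rightarrow> (nat \<times> nat \<Rightarrow> real) \<Rightarrow> real"
  where "proj_sq N n F \<Gamma> = (\<Sum>a<n. inner_N N (orth_proj N F (\<lambda>i. \<Gamma> (a, i))) (orth_proj N F (\<lambda>i. \<Gamma> (a, i))))"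

text \<open>The same quantity with an arbitrary matrix \<open>A\<close> in place of the projection.
  It is a polynomial in all entries, from which openness and joint measurability can be read
  off.\<close>

definition mat_sq :: "nat \<Rightarrow> nat \<Rightarrow> (nat \<Rightarrow> nat \<Rightarrow> real) \<Rightarrow> (nat \<times> nat \<Rightarrow> real) \<Rightarrow> real"
  where "mat_sq N n A \<Gamma> = (\<Sum>a<n. \<Sum>k<N. (\<Sum>i<N. \<Gamma> (a, i) * A i k)\<^sup>2)"

lemma proj_sq_eq_mat_sq:
  assumes "F \<in> grassmannian N m"
  shows "proj_sq N n F \<Gamma> = mat_sq N n (\<lambda>i. orth_proj N F (unit_N i)) \<Gamma>"
  unfolding proj_sq_def mat_sq_def inner_N_def power2_eq_square
  by (intro sum.cong refl arg_cong2[where f = "(*)"] orth_proj_expand[OF assms])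

definition row_map :: "nat \<Rightarrow> nat \<Rightarrow> (nat \<Rightarrow> nat \<Rightarrow> real) \<Rightarrow> (nat \<Rightarrow> nat \<Rightarrow> real) \<Rightarrow> (nat \<times> nat \<Rightarrow> real) \<Rightarrow> nat \<times> nat \<Rightarrow> real"
  where "row_map N n b c \<Gamma> = (\<lambda>p\<in>{..<n} \<times> {..<N}. basis_map N b c (\<lambda>i. \<Gamma> (fst p, i)) (snd p))"

lemma basis_map_apply: "basis_map N b c x k = (\<Sum>i<N. (\<Sum>j<N. c j k * b j i) * x i)"
proof -
  have "basis_map N b c x k = (\<Sum>j<N. \<Sum>i<N. c j k * b j i * x i)"
    by (simp add: basis_map_def sum_fun_apply inner_N_def sum_distrib_left mult_ac)
  also have "\<dots> = (\<Sum>i<N. \<Sum>j<N. c j k * b j i * x i)" by (rule sum.swap)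
  finally show ?thesis by (simp add: sum_distrib_right)
qed

lemma measurable_gauss_component: "i \<in> I \<Longrightarrow> (\<lambda>x. x i) \<in> borel_measurable (gauss I)"
  by (simp add: measurable_cong_sets[OF sets_gauss refl] measurable_component_singleton)

lemma measurable_row_map:
  "row_map N n b c \<in> measurable (gauss ({..<n} \<times> {..<N})) (gauss ({..<n} \<times> {..<N}))"
  unfolding measurable_cong_sets[OF refl sets_gauss] row_map_def
proof (rule measurable_restrict)
  fix p :: "nat \<times> nat" assume "p \<in> {..<n} \<times> {..<N}"
  then show "(\<lambda>\<Gamma>. basis_map N b c (\<lambda>i. \<Gamma> (fst p, i)) (snd p)) \<in> borel_measurable (gauss ({..<n} \<times> {..<N}))"
    unfolding basis_map_apply
    by (intro borel_measurable_sum borel_measurable_times borel_measurable_const measurable_gauss_component) auto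
qed

lemma distr_row_map:
  fixes n :: nat
  assumes b: "orthonormal N b N" and c: "orthonormal N c N"
  defines "I \<equiv> {..<n} \<times> {..<N}"
  shows "distr (gauss I) (gauss I) (row_map N n b c) = gauss I"
proof -
  \<comment> \<open>The block diagonal matrix consisting of \<open>n\<close> copies of the rotation,
    written on pairs of indices.\<close>
  define W where "W p q = (if fst p = fst q then (\<Sum>j<N. c j (snd p) * b j (snd q)) else 0)" for p q :: "nat \<times> nat"
  have "row_map N n b c = (\<lambda>x. \<lambda>p\<in>I. \<Sum>q\<in>I. W p q * x q)"
  proof (intro ext)
    fix x p
    show "row_map N n b c x p = (\<lambda>p\<in>I. \<Sum>q\<in>I. W p q * x q) p"
    proof (cases "p \<in> I")
      case True
      then obtain a k where p: "p = (a, k)" "a < n" "k < N" by (auto simp: I_def)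
      have "(\<Sum>q\<in>I. W p q * x q) = (\<Sum>a'<n. \<Sum>i<N. W p (a', i) * x (a', i))"
        unfolding I_def by (simp add: sum.cartesian_product)
      also have "\<dots> = (\<Sum>a'<n. if a = a' then basis_map N b c (\<lambda>i. x (a', i)) k else 0)"
        by (intro sum.cong refl) (auto simp: W_def p basis_map_apply)
      also have "\<dots> = basis_map N b c (\<lambda>i. x (a, i)) k" using p by simp
      finally show ?thesis using True by (simp add: row_map_def I_def p)
    qed (auto simp: row_map_def I_def)
  qed
  moreover have "distr (gauss I) (gauss I) (\<lambda>x. \<lambda>p\<in>I. \<Sum>q\<in>I. W p q * x q) = gauss I"
  proof (rule gauss_orthonormal_image)
    fix p p' assume "p \<in> I" "p' \<in> I"
    then obtain a k a' k' where p: "p = (a, k)" "a < n" "k < N" "p' = (a', k')" "a' < n" "k' < N"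
      by (auto simp: I_def)
    have "(\<Sum>q\<in>I. W p q * W p' q) = (\<Sum>a''<n. \<Sum>i<N. W p (a'', i) * W p' (a'', i))"
      unfolding I_def by (simp add: sum.cartesian_product)
    also have "\<dots> = (\<Sum>a''<n. if a = a'' then (if a = a' then
        (\<Sum>i<N. (\<Sum>j<N. b j i * c j k) * (\<Sum>j<N. b j i * c j k')) else 0) else 0)"
      by (intro sum.cong refl) (auto simp: W_def p mult.commute)
    also have "\<dots> = (if a = a' then (\<Sum>i<N. (\<Sum>j<N. b j i * c j k) * (\<Sum>j<N. b j i * c j k')) else 0)"
      using p by simp
    also have "(\<Sum>i<N. (\<Sum>j<N. b j i * c j k) * (\<Sum>j<N. b j i * c j k'))
      = inner_N N (\<Sum>j<N. c j k *\<^sub>R b j) (\<Sum>j<N. c j k' *\<^sub>R b j)"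
      by (simp add: inner_N_def sum_fun_apply mult.commute)
    also have "\<dots> = (\<Sum>j<N. c j k * c j k')"
      unfolding inner_N_sum_right inner_N_scaleR_right
      by (intro sum.cong refl) (simp add: inner_N_lincomb_orthonormal[OF b])
    also have "\<dots> = (if k = k' then 1 else 0)" using p by (intro orthonormal_columns[OF c])
    finally show "(\<Sum>q\<in>I. W p q * W p' q) = (if p = p' then 1 else 0)" by (simp add: p)
  qed (auto simp: I_def)
  ultimately show ?thesis by simp
qed

text \<open>Rotating the subspace together with all rows changes none of the projected lengths. This
  is the invariance on which the coupling rests.\<close>

lemma proj_sq_row_map:
  assumes b: "orthonormal N b N" and c: "orthonormal N c N" and F: "F \<in> grassmannian N m"
  shows "proj_sq N n (basis_map N b c ` F) (row_map N n b c \<Gamma>) = proj_sq N n F \<Gamma>"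
proof -
  let ?U = "basis_map N b c"
  have UF: "?U ` F \<in> grassmannian N m" by (rule basis_map_image_grassmannian(1)[OF b c F])
  have "orth_proj N (?U ` F) (\<lambda>i. row_map N n b c \<Gamma> (a, i)) = orth_proj N (?U ` F) (?U (\<lambda>i. \<Gamma> (a, i)))"
    if "a < n" for a
  proof
    fix k
    show "orth_proj N (?U ` F) (\<lambda>i. row_map N n b c \<Gamma> (a, i)) k = orth_proj N (?U ` F) (?U (\<lambda>i. \<Gamma> (a, i))) k"
      unfolding orth_proj_expand[OF UF, of "\<lambda>i. row_map N n b c \<Gamma> (a, i)"]
        orth_proj_expand[OF UF, of "?U (\<lambda>i. \<Gamma> (a, i))"]
      using that by (intro sum.cong refl) (simp add: row_map_def)
  qed
  then show ?thesis
    unfolding proj_sq_def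
    by (intro sum.cong refl) (simp add: basis_map_image_grassmannian(3)[OF b c F])
qed

section \<open>The Haar measure and approximate kernels\<close>

context
  fixes N n :: nat and M :: "(nat \<Rightarrow> real) set measure"
  assumes haar: "haar_grassmannian N n M"
begin

lemma haar_prob: "prob_space M" and haar_space: "space M = grassmannian N n"
  and haar_sets: "sets M = sets (grassmannian_borel N n)"
  using haar by (auto simp: haar_grassmannian_def)

lemma haar_n_le: "n \<le> N"
proof -
  have "space M \<noteq> {}" by (rule prob_space.not_empty[OF haar_prob])
  then show ?thesis by (auto simp: haar_space grassmannian_def)
qed

lemma measurable_orth_proj [measurable]: "(\<lambda>F. orth_proj N F x k) \<in> borel_measurable M"
proof -
  have "(\<lambda>F j. orth_proj N F (unit_N j)) \<in> borel_measurable (grassmannian_borel N n)"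
    unfolding grassmannian_borel_def unit_N_def by (rule measurable_vimage_algebra1) auto
  then have "(\<lambda>F j. orth_proj N F (unit_N j)) \<in> borel_measurable M"
    by (simp add: measurable_cong_sets[OF haar_sets refl])
  then have "(\<lambda>F. orth_proj N F (unit_N j)) \<in> borel_measurable M" for j
    by (rule measurable_product_then_coordinatewise)
  then have [measurable]: "(\<lambda>F. orth_proj N F (unit_N j) k) \<in> borel_measurable M" for j k
    by (rule measurable_product_then_coordinatewise)
  have "(\<lambda>F. \<Sum>i<N. x i * orth_proj N F (unit_N i) k) \<in> borel_measurable M" by measurable
  then show ?thesis
    by (rule measurable_cong[THEN iffD1, rotated]) (simp add: haar_space orth_proj_expand[symmetric])
qed

text \<open>The invariance of \<open>M\<close> is stated through \<open>distr\<close>, which is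
  evaluated by preimages only for measurable maps. By the conjugation formula the entries of the
  rotated projection are linear in projections onto \<open>F\<close>.\<close>

lemma measurable_image_basis_map:
  assumes b: "orthonormal N b N" and c: "orthonormal N c N"
  shows "(`) (basis_map N b c) \<in> measurable M M"
proof -
  have "(`) (basis_map N b c) \<in> measurable M (grassmannian_borel N n)"
    unfolding grassmannian_borel_def
  proof (rule measurable_vimage_algebra2)
    show "(`) (basis_map N b c) \<in> space M \<rightarrow> grassmannian N n"
      using basis_map_image_grassmannian(1)[OF b c] by (auto simp: haar_space)
    have "(\<lambda>F. orth_proj N (basis_map N b c ` F) (unit_N j) k) \<in> borel_measurable M" for j k
    proof (rule measurable_cong[THEN iffD2])
      fix F assume "F \<in> space M"
      then show "orth_proj N (basis_map N b c ` F) (unit_N j) k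
        = (\<Sum>i<N. (\<Sum>j<N. c j k * b j i) * orth_proj N F (basis_map N c b (unit_N j)) i)"
        by (simp add: haar_space basis_map_image_grassmannian(2)[OF b c] basis_map_apply)
    qed measurable
    then show "(\<lambda>F j. orth_proj N (basis_map N b c ` F) (\<lambda>i. if i = j then 1 else 0)) \<in> borel_measurable M"
      unfolding unit_N_def[symmetric] by (intro measurable_coordinatewise_then_product)
  qed
  then show ?thesis by (simp add: measurable_cong_sets[OF refl haar_sets])
qed

text \<open>The set of subspaces inside the kernel of \<Gamma> may be null; this thickening of it
  has positive measure, so one can condition on it.\<close>

definition near :: "real \<Rightarrow> (nat \<times> nat \<Rightarrow> real) \<Rightarrow> (nat \<Rightarrow> real) set set"
  where "near d \<Gamma> = {F \<in> space M. proj_sq N n F \<Gamma> < d}"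

lemma near_sets [measurable]: "near d \<Gamma> \<in> sets M"
proof -
  have "near d \<Gamma> = {F \<in> space M. mat_sq N n (\<lambda>i. orth_proj N F (unit_N i)) \<Gamma> < d}"
    unfolding near_def by (auto simp: haar_space proj_sq_eq_mat_sq)
  then show ?thesis unfolding mat_sq_def by simp
qed

lemma emeasure_near_row_map:
  assumes b: "orthonormal N b N" and c: "orthonormal N c N"
  shows "emeasure M (near d (row_map N n b c \<Gamma>)) = emeasure M (near d \<Gamma>)"
proof -
  have inv: "distr M M ((`) (basis_map N b c)) = M"
    using haar basis_map_rotation[OF b c] by (auto simp: haar_grassmannian_def)
  have "emeasure M (near d (row_map N n b c \<Gamma>))
    = emeasure (distr M M ((`) (basis_map N b c))) (near d (row_map N n b c \<Gamma>))"
    by (simp add: inv)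
  also have "\<dots> = emeasure M ((`) (basis_map N b c) -` near d (row_map N n b c \<Gamma>) \<inter> space M)"
    by (intro emeasure_distr measurable_image_basis_map[OF b c] near_sets)
  also have "(`) (basis_map N b c) -` near d (row_map N n b c \<Gamma>) \<inter> space M = near d \<Gamma>"
    using basis_map_image_grassmannian(1)[OF b c] proj_sq_row_map[OF b c]
    by (auto simp: near_def haar_space)
  finally show ?thesis .
qed

text \<open>The rows of \<open>\<Gamma>\<close> are orthogonal to some subspace in the Grassmannian; its rotated copies have
  neighbourhoods of the same measure, countably many of which cover the Grassmannian.\<close>

lemma emeasure_near_pos:
  assumes d: "d > 0"
  shows "emeasure M (near d \<Gamma>) > 0"
proof (rule ccontr)
  assume "\<not> emeasure M (near d \<Gamma>) > 0"
  then have zero: "emeasure M (near d \<Gamma>) = 0" by simp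
  \<comment> \<open>The rows of \<Gamma>, cut off to members of \<open>RN N\<close>;
    \<open>inner_N\<close> does not see the difference.\<close>
  define \<gamma> where "\<gamma> a = (\<Sum>i<N. \<Gamma> (a, i) *\<^sub>R unit_N i)" for a
  have \<gamma>: "inner_N N (\<lambda>i. \<Gamma> (a, i)) y = inner_N N (\<gamma> a) y" for a y
    by (simp add: \<gamma>_def inner_N_sum_left inner_N_scaleR_left inner_N_commute[of N "unit_N _"] inner_N_unit)
      (simp add: inner_N_def)
  have \<gamma>RN: "\<gamma> a \<in> RN N" for a
    using lincomb_in_span[of "\<lambda>i. \<Gamma> (a, i)" unit_N N] by (simp only: \<gamma>_def span_unit)
  obtain q' where q': "orthonormal N q' N"
    and perp: "\<forall>i<N - n. \<forall>a\<in>{..<n}. inner_N N (\<gamma> a) (q' i) = 0"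
    using orthonormal_complement[of "{..<n}" \<gamma> N n, OF \<gamma>RN] haar_n_le by auto
  define F0 where "F0 = span (q' ` {..<N - n})"
  have oq': "orthonormal N q' (N - n)" by (rule orthonormal_mono[OF q']) simp
  have "inner_N N (\<gamma> a) (q' i) = 0" if "a < n" "i < N - n" for a i
    using perp that by auto
  then have F0: "proj_sq N n F0 \<Gamma> = 0"
    unfolding proj_sq_def F0_def orth_proj_span[OF oq'] \<gamma>
    by (intro sum.neutral ballI) simp
  \<comment> \<open>The cover consists of open sets of matrices, whose space is second countable, so
    Lindelof's theorem applies. The Grassmannian itself is equipped only with a Borel
    structure.\<close>
  define \<U> where "\<U> = (\<lambda>\<Gamma>'. {A. mat_sq N n A \<Gamma>' < d}) ` {\<Gamma>'. emeasure M (near d \<Gamma>') = 0}"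
  have coord: "continuous_on UNIV (\<lambda>A :: nat \<Rightarrow> nat \<Rightarrow> real. A i k)" for i k
    by (rule continuous_on_product_then_coordinatewise[OF continuous_on_product_coordinates])
  have "open {A. mat_sq N n A \<Gamma>' < d}" for \<Gamma>'
    unfolding mat_sq_def
    by (intro open_Collect_less continuous_on_sum continuous_on_power continuous_on_mult
        continuous_on_const coord)
  then have "\<And>S. S \<in> \<U> \<Longrightarrow> open S" by (auto simp: \<U>_def)
  then obtain \<V> where \<V>: "\<V> \<subseteq> \<U>" "countable \<V>" "\<Union>\<V> = \<Union>\<U>" by (rule Lindelof)
  define mat where "mat F = (\<lambda>i. orth_proj N F (unit_N i))" for F
  have cover: "mat F \<in> \<Union>\<U>" if F: "F \<in> space M" for F
  proof -
    obtain f where f: "orthonormal N f N" "F = span (f ` {..<N - n})"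
      using grassmannian_basis F haar_space by metis
    have UF: "basis_map N q' f ` F0 = F"
      unfolding F0_def f(2) by (rule basis_map_image_span[OF q' f(1)]) simp
    have F0G: "F0 \<in> grassmannian N n" unfolding F0_def by (rule span_in_grassmannian[OF q' haar_n_le])
    have "mat_sq N n (mat F) (row_map N n q' f \<Gamma>) = proj_sq N n F (row_map N n q' f \<Gamma>)"
      using F by (simp add: mat_def proj_sq_eq_mat_sq[of F N n] haar_space)
    also have "\<dots> = 0" using proj_sq_row_map[OF q' f(1) F0G, of n \<Gamma>] by (simp add: UF F0)
    finally have "mat F \<in> {A. mat_sq N n A (row_map N n q' f \<Gamma>) < d}" using d by simp
    moreover have "emeasure M (near d (row_map N n q' f \<Gamma>)) = 0"
      using emeasure_near_row_map[OF q' f(1)] zero by simp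
    ultimately show ?thesis unfolding \<U>_def by blast
  qed
  have null: "{F \<in> space M. mat F \<in> S} \<in> null_sets M" if S: "S \<in> \<V>" for S
  proof -
    obtain \<Gamma>' where \<Gamma>': "S = {A. mat_sq N n A \<Gamma>' < d}" "emeasure M (near d \<Gamma>') = 0"
      using S \<V>(1) by (auto simp: \<U>_def)
    have "{F \<in> space M. mat F \<in> S} = near d \<Gamma>'"
      by (auto simp: \<Gamma>'(1) near_def mat_def haar_space proj_sq_eq_mat_sq)
    then show ?thesis using \<Gamma>'(2) by (auto intro: null_setsI)
  qed
  have "(\<Union>S\<in>\<V>. {F \<in> space M. mat F \<in> S}) \<in> null_sets M"
    using null by (intro null_sets_UN' \<V>(2)) auto
  moreover have "(\<Union>S\<in>\<V>. {F \<in> space M. mat F \<in> S}) = space M" using cover \<V>(3) by blast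
  ultimately have "emeasure M (space M) = 0" by auto
  then show False using prob_space.emeasure_space_1[OF haar_prob] by simp
qed

text \<open>The kernel \<open>\<kappa>(F, \<Gamma>) = 1[F \<in> near d \<Gamma>] / M(near d \<Gamma>)\<close> is invariant under rotations, so its integral over
  \<open>\<Gamma>\<close> does not depend on \<open>F\<close>; by Fubini this constant is 1. Thus a random \<open>F\<close> is coupled with a Gaussian
  matrix \<open>\<Gamma>\<close> that almost annihilates it.\<close>

lemma haar_le_gauss:
  assumes d: "d > 0" and B[measurable]: "B \<in> sets M" and B'[measurable]: "B' \<in> sets (gauss ({..<n} \<times> {..<N}))"
    and imp: "\<And>F \<Gamma>. F \<in> B \<Longrightarrow> F \<in> grassmannian N n \<Longrightarrow> \<Gamma> \<in> space (gauss ({..<n} \<times> {..<N})) \<Longrightarrow> proj_sq N n F \<Gamma> < d \<Longrightarrow> \<Gamma> \<in> B'"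
  shows "emeasure M B \<le> emeasure (gauss ({..<n} \<times> {..<N})) B'"
proof -
  define I where "I = {..<n} \<times> {..<N}"
  define G where "G = gauss I"
  have [measurable_cong]: "sets G = sets (PiM I (\<lambda>_. borel))" unfolding G_def by (rule sets_gauss)
  interpret M: prob_space M by (rule haar_prob)
  interpret G: prob_space G unfolding G_def by (rule prob_space_gauss)
  interpret P: pair_prob_space G M ..
  define Q where "Q = {z \<in> space (G \<Otimes>\<^sub>M M). mat_sq N n (\<lambda>i. orth_proj N (snd z) (unit_N i)) (fst z) < d}"
  have comp: "(\<lambda>\<Gamma>. \<Gamma> (a, i)) \<in> borel_measurable G" if "a < n" "i < N" for a i
    using that unfolding G_def by (intro measurable_gauss_component) (auto simp: I_def)
  have Q[measurable]: "Q \<in> sets (G \<Otimes>\<^sub>M M)"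
  proof -
    have "(\<lambda>z. mat_sq N n (\<lambda>i. orth_proj N (snd z) (unit_N i)) (fst z)) \<in> borel_measurable (G \<Otimes>\<^sub>M M)"
      unfolding mat_sq_def
    proof (intro borel_measurable_sum borel_measurable_power borel_measurable_times)
      fix a k i assume "a \<in> {..<n}" "i \<in> {..<N}"
      then show "(\<lambda>z. fst z (a, i)) \<in> borel_measurable (G \<Otimes>\<^sub>M M)"
        using measurable_compose[OF measurable_fst comp] by simp
      show "(\<lambda>z. orth_proj N (snd z) (unit_N i) k) \<in> borel_measurable (G \<Otimes>\<^sub>M M)"
        by measurable
    qed
    then show ?thesis unfolding Q_def by measurable
  qed
  have Qiff: "(\<Gamma>, F) \<in> Q \<longleftrightarrow> \<Gamma> \<in> space G \<and> F \<in> near d \<Gamma>" for \<Gamma> F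
    by (auto simp: Q_def near_def space_pair_measure haar_space proj_sq_eq_mat_sq)
  define h where "h \<Gamma> = emeasure M (near d \<Gamma>)" for \<Gamma>
  have h[measurable]: "h \<in> borel_measurable G"
  proof -
    have "(\<lambda>\<Gamma>. emeasure M (Pair \<Gamma> -` Q)) \<in> borel_measurable G" by (rule M.measurable_emeasure_Pair[OF Q])
    moreover have "emeasure M (Pair \<Gamma> -` Q) = h \<Gamma>" if "\<Gamma> \<in> space G" for \<Gamma>
      unfolding h_def using that by (intro arg_cong[where f = "emeasure M"]) (auto simp: Qiff)
    ultimately show ?thesis by (simp cong: measurable_cong)
  qed
  have hpos: "h \<Gamma> \<noteq> 0" "h \<Gamma> < top" for \<Gamma>
    using emeasure_near_pos[OF d, of \<Gamma>] M.emeasure_eq_measure[of "near d \<Gamma>"] by (auto simp: h_def)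
  define \<kappa> where "\<kappa> \<Gamma> F = indicator Q (\<Gamma>, F) / h \<Gamma>" for \<Gamma> F
  have \<kappa>[measurable]: "(\<lambda>(\<Gamma>, F). \<kappa> \<Gamma> F) \<in> borel_measurable (G \<Otimes>\<^sub>M M)"
    unfolding \<kappa>_def by measurable
  have int_M: "(\<integral>\<^sup>+F. \<kappa> \<Gamma> F \<partial>M) = 1" if "\<Gamma> \<in> space G" for \<Gamma>
  proof -
    have "(\<integral>\<^sup>+F. \<kappa> \<Gamma> F \<partial>M) = (\<integral>\<^sup>+F. indicator (near d \<Gamma>) F / h \<Gamma> \<partial>M)"
      using that by (intro nn_integral_cong) (auto simp: \<kappa>_def Qiff indicator_def)
    also have "\<dots> = h \<Gamma> / h \<Gamma>" by (subst nn_integral_divide) (auto simp: h_def)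
    finally show ?thesis using hpos[of \<Gamma>] by simp
  qed
  define g where "g F = (\<integral>\<^sup>+\<Gamma>. \<kappa> \<Gamma> F \<partial>G)" for F
  have g_rot: "g (basis_map N b c ` F) = g F"
    if b: "orthonormal N b N" and c: "orthonormal N c N" and F: "F \<in> grassmannian N n" for b c F
  proof -
    let ?U = "basis_map N b c"
    have D: "distr G G (row_map N n b c) = G"
      unfolding G_def I_def by (rule distr_row_map[OF b c])
    have R[measurable]: "row_map N n b c \<in> measurable G G"
      unfolding G_def I_def by (rule measurable_row_map)
    have UF: "?U ` F \<in> grassmannian N n" by (rule basis_map_image_grassmannian(1)[OF b c F])
    have UFs: "?U ` F \<in> space M" and Fs: "F \<in> space M" using UF F by (auto simp: haar_space)
    have [measurable]: "(\<lambda>\<Gamma>. \<kappa> \<Gamma> F) \<in> borel_measurable G" if "F \<in> space M" for F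
      using measurable_Pair2'[OF that, of G] measurable_compose[OF _ \<kappa>, of "\<lambda>\<Gamma>. (\<Gamma>, F)" G] that by simp
    have "g (?U ` F) = (\<integral>\<^sup>+\<Gamma>. \<kappa> \<Gamma> (?U ` F) \<partial>distr G G (row_map N n b c))" by (simp add: g_def D)
    also have "\<dots> = (\<integral>\<^sup>+\<Gamma>. \<kappa> (row_map N n b c \<Gamma>) (?U ` F) \<partial>G)"
      using UFs by (intro nn_integral_distr) measurable
    also have "\<dots> = g F"
      unfolding g_def
    proof (rule nn_integral_cong)
      fix \<Gamma> assume \<Gamma>: "\<Gamma> \<in> space G"
      have "row_map N n b c \<Gamma> \<in> space G" by (rule measurable_space[OF R \<Gamma>])
      then have "(row_map N n b c \<Gamma>, ?U ` F) \<in> Q \<longleftrightarrow> (\<Gamma>, F) \<in> Q"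
        using \<Gamma> UFs Fs by (simp add: Qiff near_def proj_sq_row_map[OF b c F])
      then show "\<kappa> (row_map N n b c \<Gamma>) (?U ` F) = \<kappa> \<Gamma> F"
        using emeasure_near_row_map[OF b c] by (simp add: \<kappa>_def h_def indicator_def)
    qed
    finally show ?thesis .
  qed
  obtain F0 where F0: "F0 \<in> grassmannian N n" using M.not_empty haar_space by auto
  have g_const: "g F = g F0" if F: "F \<in> space M" for F
  proof -
    obtain b where b: "orthonormal N b N" "F0 = span (b ` {..<N - n})" by (rule grassmannian_basis[OF F0])
    obtain c where c: "orthonormal N c N" "F = span (c ` {..<N - n})"
      using grassmannian_basis F haar_space by metis
    have "basis_map N b c ` F0 = F"
      unfolding b(2) c(2) by (rule basis_map_image_span[OF b(1) c(1)]) simp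
    then show ?thesis using g_rot[OF b(1) c(1) F0] by simp
  qed
  have "g F0 = (\<integral>\<^sup>+F. g F \<partial>M)" using g_const by (simp add: M.emeasure_space_1 cong: nn_integral_cong)
  also have "\<dots> = (\<integral>\<^sup>+\<Gamma>. \<integral>\<^sup>+F. \<kappa> \<Gamma> F \<partial>M \<partial>G)" unfolding g_def by (rule P.Fubini'[OF \<kappa>])
  also have "\<dots> = 1" using int_M by (simp add: G.emeasure_space_1 cong: nn_integral_cong)
  finally have g1: "g F = 1" if "F \<in> space M" for F using g_const[OF that] by simp
  \<comment> \<open>Because \<open>g = 1\<close>, inserting it costs nothing and brings in \<Gamma>.
    Where the kernel is nonzero, \<open>F \<in> B\<close> forces \<open>\<Gamma> \<in> B'\<close>;
    after this replacement \<open>F\<close> integrates out to 1.\<close>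
  have "emeasure M B = (\<integral>\<^sup>+F. indicator B F * g F \<partial>M)"
    using g1 by (simp cong: nn_integral_cong)
  also have "\<dots> = (\<integral>\<^sup>+F. (\<integral>\<^sup>+\<Gamma>. indicator B F * \<kappa> \<Gamma> F \<partial>G) \<partial>M)"
    unfolding g_def by (intro nn_integral_cong nn_integral_cmult[symmetric]) measurable
  also have "\<dots> \<le> (\<integral>\<^sup>+F. (\<integral>\<^sup>+\<Gamma>. indicator B' \<Gamma> * \<kappa> \<Gamma> F \<partial>G) \<partial>M)"
  proof (intro nn_integral_mono)
    fix F \<Gamma> assume "F \<in> space M" "\<Gamma> \<in> space G"
    then show "indicator B F * \<kappa> \<Gamma> F \<le> indicator B' \<Gamma> * \<kappa> \<Gamma> F"
      using imp[of F \<Gamma>] by (auto simp: \<kappa>_def indicator_def Qiff near_def haar_space G_def I_def)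
  qed
  also have "\<dots> = (\<integral>\<^sup>+\<Gamma>. \<integral>\<^sup>+F. indicator B' \<Gamma> * \<kappa> \<Gamma> F \<partial>M \<partial>G)"
  proof (rule P.Fubini')
    have [measurable]: "B' \<in> sets G" using B' by (simp add: G_def I_def)
    show "(\<lambda>(\<Gamma>, F). indicator B' \<Gamma> * \<kappa> \<Gamma> F) \<in> borel_measurable (G \<Otimes>\<^sub>M M)" by measurable
  qed
  also have "\<dots> = (\<integral>\<^sup>+\<Gamma>. indicator B' \<Gamma> * 1 \<partial>G)"
  proof (rule nn_integral_cong)
    fix \<Gamma> assume \<Gamma>: "\<Gamma> \<in> space G"
    have [measurable]: "(\<lambda>F. \<kappa> \<Gamma> F) \<in> borel_measurable M"
      using measurable_compose[OF measurable_Pair1'[OF \<Gamma>, of M] \<kappa>] by simp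
    show "(\<integral>\<^sup>+F. indicator B' \<Gamma> * \<kappa> \<Gamma> F \<partial>M) = indicator B' \<Gamma> * 1"
      using int_M[OF \<Gamma>] by (subst nn_integral_cmult) auto
  qed
  also have "\<dots> = emeasure G B'" using B' by (simp add: G_def I_def)
  finally show ?thesis by (simp add: G_def I_def)
qed

end

section \<open>Kernels of Gaussian matrices\<close>

text \<open>Fubini with an exceptional set: slices over \<open>Z\<close> are bounded by 1, all
  others by \<beta>. Used in this form, it replaces conditioning on a block of columns.\<close>

lemma gauss_fold_le:
  fixes J1 J2 :: "'i set"
  assumes J: "finite J1" "finite J2" "J1 \<inter> J2 = {}" and B: "B \<in> sets (gauss (J1 \<union> J2))"
    and Z: "Z \<in> sets (gauss J1)" "emeasure (gauss J1) Z \<le> \<alpha>"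
    and slice: "\<And>y. y \<in> space (gauss J1) \<Longrightarrow> y \<notin> Z \<Longrightarrow>
      emeasure (gauss J2) ((\<lambda>z. merge J1 J2 (y, z)) -` B \<inter> space (gauss J2)) \<le> \<beta>"
  shows "emeasure (gauss (J1 \<union> J2)) B \<le> \<alpha> + \<beta>"
proof -
  interpret G1: prob_space "gauss J1" by (rule prob_space_gauss)
  interpret G2: prob_space "gauss J2" by (rule prob_space_gauss)
  have "emeasure (gauss (J1 \<union> J2)) B
    = (\<integral>\<^sup>+y. emeasure (gauss J2) ((\<lambda>z. merge J1 J2 (y, z)) -` B \<inter> space (gauss J2)) \<partial>gauss J1)"
    using B unfolding gauss_def
    by (intro product_sigma_finite.emeasure_fold_integral psf_std_normal J)
  also have "\<dots> \<le> (\<integral>\<^sup>+y. indicator Z y + \<beta> \<partial>gauss J1)"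
  proof (rule nn_integral_mono)
    fix y assume y: "y \<in> space (gauss J1)"
    show "emeasure (gauss J2) ((\<lambda>z. merge J1 J2 (y, z)) -` B \<inter> space (gauss J2)) \<le> indicator Z y + \<beta>"
    proof (cases "y \<in> Z")
      case True
      then show ?thesis using G2.emeasure_le_1 by (auto intro: order_trans add_increasing2)
    qed (use slice[OF y] in auto)
  qed
  also have "\<dots> = emeasure (gauss J1) Z + \<beta>"
    using Z(1) by (subst nn_integral_add) (auto simp: G1.emeasure_space_1)
  finally show ?thesis using Z(2) by (meson add_right_mono order_trans)
qed

lemma gauss_slice_sets:
  assumes B: "B \<in> sets (gauss (J1 \<union> J2))" and y: "y \<in> space (gauss J1)"
  shows "(\<lambda>z. merge J1 J2 (y, z)) -` B \<inter> space (gauss J2) \<in> sets (gauss J2)"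
proof -
  have "merge J1 J2 \<in> measurable (gauss J1 \<Otimes>\<^sub>M gauss J2) (gauss (J1 \<union> J2))"
    unfolding gauss_def by (rule measurable_merge)
  then have "(\<lambda>z. merge J1 J2 (y, z)) \<in> measurable (gauss J2) (gauss (J1 \<union> J2))"
    by (rule measurable_compose[OF measurable_Pair1'[OF y]])
  then show ?thesis using B by (rule measurable_sets)
qed

section \<open>Gaussian suprema over a body in orthonormal coordinates\<close>

lemma compact_attains_lincomb:
  fixes K :: "(nat \<Rightarrow> real) set"
  assumes "compact K" "K \<noteq> {}"
  shows "\<exists>x\<in>K. \<forall>z\<in>K. (\<Sum>j\<in>J. g j * inner_N N z (b j)) \<le> (\<Sum>j\<in>J. g j * inner_N N x (b j))"
  by (intro continuous_attains_sup assms continuous_on_sum continuous_on_mult continuous_on_const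
      continuous_on_inner_N)

text \<open>All coordinates are kept, because one set has to serve both the supremum over the
  coordinates below \<open>d\<close> and the kernel estimate, which reads the others as
  well.\<close>

definition coords :: "nat \<Rightarrow> (nat \<Rightarrow> nat \<Rightarrow> real) \<Rightarrow> (nat \<Rightarrow> real) set \<Rightarrow> (nat \<Rightarrow> real) set"
  where "coords N b K = (\<lambda>x j. inner_N N x (b j)) ` K"

text \<open>The supremum is attained, so its superlevel sets are existentials over the compact set
  \<open>K\<close>.\<close>

lemma measurable_gsup_coords:
  fixes K :: "(nat \<Rightarrow> real) set"
  assumes K: "compact K" "K \<noteq> {}"
  shows "gsup J (coords N b K) \<in> borel_measurable (gauss J)"
proof (rule borel_measurableI_ge)
  fix c :: real
  have "c \<le> gsup J (coords N b K) g \<longleftrightarrow> (\<exists>x\<in>K. c - (\<Sum>j\<in>J. g j * inner_N N x (b j)) \<le> 0)" for g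
  proof -
    obtain x where x: "x \<in> K" "\<forall>z\<in>K. (\<Sum>j\<in>J. g j * inner_N N z (b j)) \<le> (\<Sum>j\<in>J. g j * inner_N N x (b j))"
      using compact_attains_lincomb[OF K] by blast
    have "gsup J (coords N b K) g = (\<Sum>j\<in>J. g j * inner_N N x (b j))"
      unfolding gsup_def coords_def image_image using x by (intro cSup_eq_maximum) auto
    then show ?thesis using x by force
  qed
  then have "{g \<in> space (gauss J). c \<le> gsup J (coords N b K) g}
    = {g \<in> space (gauss J). \<exists>x\<in>K. c - (\<Sum>j\<in>J. g j * inner_N N x (b j)) \<le> 0}" by auto
  also have "\<dots> \<in> sets (gauss J)"
    by (intro measurable_compact_ex K borel_measurable_diff borel_measurable_const borel_measurable_sum
        borel_measurable_times measurable_gauss_component continuous_on_diff continuous_on_const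
        continuous_on_sum continuous_on_mult continuous_on_inner_N)
  finally show "{g \<in> space (gauss J). c \<le> gsup J (coords N b K) g} \<in> sets (gauss J)" .
qed

text \<open>Pairing a Gaussian vector with a projected point involves only its coordinates along
  \<open>b\<close>, and these form a standard Gaussian vector of dimension \<open>d\<close>.\<close>

lemma integral_gsup_coords:
  assumes b: "orthonormal N b d" and E: "E = span (b ` {..<d})" and K: "compact K" "K \<noteq> {}"
  shows "(\<integral>g. gsup {..<d} (coords N b K) g \<partial>gauss {..<d}) = ell_star N (orth_proj N E ` K)"
proof -
  define f where "f x = (\<lambda>j\<in>{..<d}. \<Sum>i<N. b j i * x i)" for x :: "nat \<Rightarrow> real"
  have D: "distr (gauss {..<N}) (gauss {..<d}) f = gauss {..<d}"
    unfolding f_def using orthonormalD(2)[OF b]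
    by (intro gauss_orthonormal_image) (auto simp: inner_N_def)
  have f: "f \<in> measurable (gauss {..<N}) (gauss {..<d})"
    unfolding f_def measurable_cong_sets[OF refl sets_gauss]
    by (intro measurable_restrict borel_measurable_sum borel_measurable_times borel_measurable_const
        measurable_gauss_component)
  have "gsup {..<d} (coords N b K) (f g) = (SUP y\<in>orth_proj N E ` K. inner_N N g y)" for g
  proof -
    have "(\<Sum>j<d. f g j * inner_N N x (b j)) = inner_N N g (orth_proj N E x)" for x
      unfolding E orth_proj_span[OF b] inner_N_sum_right inner_N_scaleR_right
      by (intro sum.cong refl) (simp add: f_def inner_N_def mult.commute)
    then show ?thesis unfolding gsup_def coords_def by (simp add: image_image)
  qed
  then have "ell_star N (orth_proj N E ` K) = (\<integral>g. gsup {..<d} (coords N b K) (f g) \<partial>gauss {..<N})"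
    unfolding ell_star_def std_gaussian_eq_gauss by simp
  also have "\<dots> = (\<integral>g. gsup {..<d} (coords N b K) g \<partial>distr (gauss {..<N}) (gauss {..<d}) f)"
    by (intro integral_distr[symmetric] f measurable_gsup_coords K)
  finally show ?thesis by (simp add: D)
qed

lemma gsup_coords_tail:
  assumes b: "orthonormal N b d" and E: "E = span (b ` {..<d})" and K: "compact K" "0 \<in> K"
    and R: "R > 0" "\<And>x. x \<in> K \<Longrightarrow> norm_N N (orth_proj N E x) \<le> R" and \<sigma>: "\<sigma> \<ge> 0"
  shows "emeasure (gauss {..<d}) {g \<in> space (gauss {..<d}).
      4 * ell_star N (orth_proj N E ` K) + 3 * \<sigma> < gsup {..<d} (coords N b K) g}
    \<le> ennreal (4 * exp (- \<sigma>\<^sup>2 / (2 * R\<^sup>2)))"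
proof -
  have K0: "K \<noteq> {}" using K by auto
  have "emeasure (gauss {..<d}) {g \<in> space (gauss {..<d}).
      4 * (\<integral>g. gsup {..<d} (coords N b K) g \<partial>gauss {..<d}) + 3 * \<sigma> < gsup {..<d} (coords N b K) g}
    \<le> ennreal (4 * exp (- \<sigma>\<^sup>2 / (2 * R\<^sup>2)))"
  proof (rule gsup_concentration[OF _ R(1) _ _ _ measurable_gsup_coords[OF K(1) K0] \<sigma>])
    show "\<exists>y\<in>coords N b K. \<forall>i\<in>{..<d}. y i = 0"
      unfolding coords_def using K(2) by (intro bexI[OF _ imageI[OF K(2)]]) auto
    show "\<exists>y\<in>coords N b K. \<forall>z\<in>coords N b K. (\<Sum>i<d. g i * z i) \<le> (\<Sum>i<d. g i * y i)" for g
      unfolding coords_def using compact_attains_lincomb[OF K(1) K0, where J = "{..<d}" and g = g and N = N and b = b] by simp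
    fix y assume "y \<in> coords N b K"
    then obtain x where x: "x \<in> K" "y = (\<lambda>j. inner_N N x (b j))" by (auto simp: coords_def)
    have "(\<Sum>i<d. (y i)\<^sup>2) = (norm_N N (orth_proj N E x))\<^sup>2"
      unfolding norm_N_sq E orth_proj_span[OF b] norm_sq_lincomb[OF b] by (simp add: x)
    also have "\<dots> \<le> R\<^sup>2" using R x(1) by (intro power_mono norm_N_nonneg) auto
    finally show "(\<Sum>i<d. (y i)\<^sup>2) \<le> R\<^sup>2" .
  qed auto
  then show ?thesis by (simp add: integral_gsup_coords[OF b E K(1) K0])
qed

text \<open>Fix the columns \<open>d < j < N\<close> of the matrix and let \<open>v\<close> be the unit vector orthogonal to them in the
  direction of the projection of column \<open>d\<close>. Testing \<open>G x \<approx> 0\<close> against \<open>v\<close> bounds the coordinate \<open>x d\<close> by the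
  supremum of a Gaussian process in the columns \<open>j < d\<close>, over the length of that projection.\<close>

lemma gauss_matrix_kernel_coordinate:
  fixes X :: "(nat \<Rightarrow> real) set" and n d N :: nat
  defines "I \<equiv> {..<n} \<times> {..<N}"
  assumes B: "{G \<in> space (gauss I). \<exists>x\<in>X. (\<Sum>a<n. (\<Sum>j<N. G (a, j) * x j)\<^sup>2) \<le> \<rho>\<^sup>2 \<and> t \<le> x d} \<in> sets (gauss I)"
    (is "?B \<in> _")
    and d: "d < N" "N - d \<le> n" and m: "m = n - (N - d) + 1" and e: "e > 0" and \<rho>: "\<rho> > 0" and t: "t \<ge> 0"
    and tail: "emeasure (gauss {..<d}) {g \<in> space (gauss {..<d}). c < gsup {..<d} X g} \<le> \<beta>"
    and tail_meas: "gsup {..<d} X \<in> borel_measurable (gauss {..<d})"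
    and ge: "\<And>g x. x \<in> X \<Longrightarrow> (\<Sum>j<d. g j * x j) \<le> gsup {..<d} X g"
    and c: "\<rho> + c < e * sqrt m * t"
  shows "emeasure (gauss I) ?B \<le> ennreal ((2 * e) ^ m) + \<beta>"
proof -
  \<comment> \<open>The order of conditioning is: columns beyond \<open>d\<close>, then column
    \<open>d\<close>, then columns below \<open>d\<close>. The unit vector \<open>v\<close> is thus
    already fixed when the columns carrying the Gaussian process are drawn.\<close>
  define J0 where "J0 = {..<n} \<times> {d<..<N}"
  define J1 where "J1 = {..<n} \<times> {d}"
  define J2 where "J2 = {..<n} \<times> {..<d}"
  have J: "finite J0" "finite J1" "finite J2" "J0 \<inter> (J1 \<union> J2) = {}" "J1 \<inter> J2 = {}"
    by (auto simp: J0_def J1_def J2_def)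
  have I: "I = J0 \<union> (J1 \<union> J2)" using d by (auto simp: I_def J0_def J1_def J2_def)
  have cols: "(\<Sum>j<N. f j) = (\<Sum>j<d. f j) + f d + (\<Sum>j\<in>{d<..<N}. f j)" for f :: "nat \<Rightarrow> real"
  proof -
    have "(\<Sum>j<N. f j) = (\<Sum>j\<in>({..<d} \<union> {d}) \<union> {d<..<N}. f j)"
      using d by (intro sum.cong) auto
    also have "\<dots> = (\<Sum>j\<in>{..<d} \<union> {d}. f j) + (\<Sum>j\<in>{d<..<N}. f j)" by (rule sum.union_disjoint) auto
    also have "(\<Sum>j\<in>{..<d} \<union> {d}. f j) = (\<Sum>j<d. f j) + (\<Sum>j\<in>{d}. f j)" by (rule sum.union_disjoint) auto
    finally show ?thesis by simp
  qed
  have "emeasure (gauss (J0 \<union> (J1 \<union> J2))) ?B \<le> 0 + (ennreal ((2 * e) ^ m) + \<beta>)"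
  proof (rule gauss_fold_le[where Z = "{}"])
    show "?B \<in> sets (gauss (J0 \<union> (J1 \<union> J2)))" using B by (simp add: I)
    fix x assume x: "x \<in> space (gauss J0)"
    define Bx where "Bx = (\<lambda>w. merge J0 (J1 \<union> J2) (x, w)) -` ?B \<inter> space (gauss (J1 \<union> J2))"
    have Bx: "Bx \<in> sets (gauss (J1 \<union> J2))"
      unfolding Bx_def using B x by (intro gauss_slice_sets) (simp_all add: I)
    define \<gamma> where "\<gamma> j = (\<lambda>a. if a < n then x (a, j) else 0)" for j
    \<comment> \<open>There are \<open>N - d - 1\<close> columns beyond \<open>d\<close>, so at
      least \<open>n - (N - d - 1) = m\<close> orthonormal directions of R^n are orthogonal to
      them.\<close>
    have "\<exists>q. orthonormal n q n \<and> (\<forall>i<n - (N - d - 1). \<forall>j\<in>{d<..<N}. inner_N n (\<gamma> j) (q i) = 0)"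
      using d by (intro orthonormal_complement) (auto simp: \<gamma>_def RN_iff)
    moreover have m': "n - (N - d - 1) = m" "m \<le> n" "m \<ge> 1" using d m by auto
    ultimately obtain q where q: "orthonormal n q n" "\<And>i j. i < m \<Longrightarrow> j \<in> {d<..<N} \<Longrightarrow> inner_N n (\<gamma> j) (q i) = 0"
      by auto
    have qm: "orthonormal n q m" by (rule orthonormal_mono[OF q(1) m'(2)])
    define A where "A y = (\<lambda>i\<in>{..<m}. \<Sum>p\<in>J1. q i (fst p) * y p)" for y :: "nat \<times> nat \<Rightarrow> real"
    have A_eq: "A y i = (\<Sum>a<n. q i a * y (a, d))" if "i < m" for y i
      using that by (simp add: A_def J1_def sum.cartesian_product')
    have DA: "distr (gauss J1) (gauss {..<m}) A = gauss {..<m}"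
      unfolding A_def using orthonormalD(2)[OF qm]
      by (intro gauss_orthonormal_image J)
        (auto simp: J1_def sum.cartesian_product' inner_N_def)
    have A: "A \<in> measurable (gauss J1) (gauss {..<m})"
      unfolding A_def measurable_cong_sets[OF refl sets_gauss]
      by (intro measurable_restrict borel_measurable_sum borel_measurable_times borel_measurable_const
          measurable_gauss_component)
    define Z0 where "Z0 = {u \<in> space (gauss {..<m}). (\<Sum>i<m. (u i)\<^sup>2) \<le> e\<^sup>2 * real m}"
    have Z0: "Z0 \<in> sets (gauss {..<m})"
    proof -
      have "(\<lambda>u. \<Sum>i<m. (u i)\<^sup>2) \<in> borel_measurable (gauss {..<m})"
        by (intro borel_measurable_sum borel_measurable_power measurable_gauss_component)
      then show ?thesis unfolding Z0_def by measurable
    qed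
    define Z where "Z = A -` Z0 \<inter> space (gauss J1)"
    have Z: "Z \<in> sets (gauss J1)" unfolding Z_def by (rule measurable_sets[OF A Z0])
    have "emeasure (gauss (J1 \<union> J2)) Bx \<le> ennreal ((2 * e) ^ m) + \<beta>"
    proof (rule gauss_fold_le[OF J(2,3,5) Bx Z])
      have "emeasure (gauss J1) Z = emeasure (distr (gauss J1) (gauss {..<m}) A) Z0"
        unfolding Z_def by (rule emeasure_distr[OF A Z0, symmetric])
      then show "emeasure (gauss J1) Z \<le> ennreal ((2 * e) ^ m)"
        using gauss_small_ball[of "{..<m}" e] e by (simp add: DA Z0_def)
      fix y assume y: "y \<in> space (gauss J1)" "y \<notin> Z"
      have Ay: "e\<^sup>2 * real m < (\<Sum>i<m. (A y i)\<^sup>2)"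
        using y measurable_space[OF A y(1)] by (auto simp: Z_def Z0_def)
      \<comment> \<open>\<open>s\<close> is the length of the projection of column \<open>d\<close>,
        to which the small ball estimate applies; \<open>\<rho>\<close> is here the tolerance of the
        approximate kernel.\<close>
      define s where "s = sqrt (\<Sum>i<m. (A y i)\<^sup>2)"
      have s: "e * sqrt m \<le> s" 
      proof -
        have "e * sqrt m = sqrt (e\<^sup>2 * real m)" using e by (simp add: real_sqrt_mult)
        also have "\<dots> \<le> s" unfolding s_def using Ay by simp
        finally show ?thesis .
      qed
      have spos: "s > 0" using s e m'(3) by (smt (verit) mult_pos_pos of_nat_0_less_iff real_sqrt_gt_zero less_le_trans zero_less_one)
      have s2: "s\<^sup>2 = (\<Sum>i<m. (A y i)\<^sup>2)" unfolding s_def by (simp add: sum_nonneg)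
      define v where "v = (\<Sum>i<m. (A y i / s) *\<^sub>R q i)"
      have v1: "inner_N n v v = 1"
        unfolding v_def norm_sq_lincomb[OF qm] using spos
        by (simp add: power_divide sum_divide_distrib[symmetric] s2[symmetric])
      have v\<gamma>: "(\<Sum>a<n. v a * x (a, j)) = 0" if "j \<in> {d<..<N}" for j
      proof -
        have "(\<Sum>a<n. v a * x (a, j)) = inner_N n v (\<gamma> j)"
          by (simp add: inner_N_def \<gamma>_def)
        also have "\<dots> = (\<Sum>i<m. A y i / s * inner_N n (q i) (\<gamma> j))"
          by (simp add: v_def inner_N_sum_left inner_N_scaleR_left)
        also have "\<dots> = 0" using q(2)[OF _ that] by (intro sum.neutral) (simp add: inner_N_commute[of n "q _"])
        finally show ?thesis .
      qed
      have vy: "(\<Sum>a<n. v a * y (a, d)) = s"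
      proof -
        have "(\<Sum>a<n. v a * y (a, d)) = inner_N n v (\<lambda>a. y (a, d))" by (simp add: inner_N_def)
        also have "\<dots> = (\<Sum>i<m. A y i / s * inner_N n (q i) (\<lambda>a. y (a, d)))"
          by (simp add: v_def inner_N_sum_left inner_N_scaleR_left)
        also have "\<dots> = (\<Sum>i<m. (A y i)\<^sup>2 / s)"
          by (intro sum.cong refl) (simp add: A_eq inner_N_def power2_eq_square)
        also have "\<dots> = s\<^sup>2 / s" unfolding s2 by (rule sum_divide_distrib[symmetric])
        also have "\<dots> = s" using spos by (simp add: power2_eq_square)
        finally show ?thesis .
      qed
      \<comment> \<open>The columns below \<open>d\<close> combined with the weights
        \<open>- v\<close>. As \<open>v\<close> is a fixed unit vector at this stage, the result is
        standard Gaussian; the sign turns the kernel equation into an upper bound for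
        \<open>s * \<xi> d\<close>.\<close>
      define H where "H z = (\<lambda>j\<in>{..<d}. \<Sum>p\<in>J2. (if j = snd p then - v (fst p) else 0) * z p)" for z :: "nat \<times> nat \<Rightarrow> real"
      have H_eq: "H z j = - (\<Sum>a<n. v a * z (a, j))" if "j < d" for z j
      proof -
        have "H z j = (\<Sum>a<n. \<Sum>j'<d. if j = j' then - v a * z (a, j') else 0)"
          using that by (simp add: H_def J2_def sum.cartesian_product' if_distrib[of "\<lambda>u. u * _"] cong: if_cong)
        also have "\<dots> = - (\<Sum>a<n. v a * z (a, j))" using that by (simp add: sum_negf)
        finally show ?thesis .
      qed
      have DH: "distr (gauss J2) (gauss {..<d}) H = gauss {..<d}"
        unfolding H_def
      proof (intro gauss_orthonormal_image J)
        fix j j' assume j: "j \<in> {..<d}" "j' \<in> {..<d}"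
        have "(\<Sum>p\<in>J2. (if j = snd p then - v (fst p) else 0) * (if j' = snd p then - v (fst p) else 0))
          = (\<Sum>a<n. \<Sum>j''<d. if j = j'' then (if j = j' then v a * v a else 0) else 0)"
          unfolding J2_def sum.cartesian_product by (intro sum.cong refl) auto
        also have "\<dots> = (if j = j' then 1 else 0)" using j v1 by (simp add: inner_N_def)
        finally show "(\<Sum>p\<in>J2. (if j = snd p then - v (fst p) else 0) * (if j' = snd p then - v (fst p) else 0))
          = (if j = j' then 1 else 0)" .
      qed simp
      have H: "H \<in> measurable (gauss J2) (gauss {..<d})"
        unfolding H_def measurable_cong_sets[OF refl sets_gauss]
        by (intro measurable_restrict borel_measurable_sum borel_measurable_times borel_measurable_const
            measurable_gauss_component)
      define T where "T = {g \<in> space (gauss {..<d}). c < gsup {..<d} X g}"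
      have T: "T \<in> sets (gauss {..<d})" unfolding T_def using tail_meas by measurable
      have "(\<lambda>z. merge J1 J2 (y, z)) -` Bx \<inter> space (gauss J2) \<subseteq> H -` T \<inter> space (gauss J2)"
      proof (rule subsetI)
        fix z assume "z \<in> (\<lambda>z. merge J1 J2 (y, z)) -` Bx \<inter> space (gauss J2)"
        then have z: "z \<in> space (gauss J2)" "merge J1 J2 (y, z) \<in> Bx" by auto
        define G where "G = merge J0 (J1 \<union> J2) (x, merge J1 J2 (y, z))"
        have G0: "G (a, j) = x (a, j)" if "a < n" "j \<in> {d<..<N}" for a j
          using that by (simp add: G_def J0_def merge_def)
        have G1: "G (a, d) = y (a, d)" if "a < n" for a
          using that by (simp add: G_def J0_def J1_def merge_def)
        have G2: "G (a, j) = z (a, j)" if "a < n" "j < d" for a j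
          using that by (simp add: G_def J0_def J1_def J2_def merge_def)
        have "G \<in> ?B" using z(2) by (simp add: Bx_def G_def)
        then obtain \<xi> where \<xi>: "\<xi> \<in> X" "(\<Sum>a<n. (\<Sum>j<N. G (a, j) * \<xi> j)\<^sup>2) \<le> \<rho>\<^sup>2" "t \<le> \<xi> d" by auto
        define W where "W = (\<lambda>a. \<Sum>j<N. G (a, j) * \<xi> j)"
        have "inner_N n v W = (\<Sum>j<N. (\<Sum>a<n. v a * G (a, j)) * \<xi> j)"
          by (simp add: inner_N_def W_def sum_distrib_left sum_distrib_right mult.assoc) (rule sum.swap)
        also have "\<dots> = (\<Sum>j<d. (\<Sum>a<n. v a * z (a, j)) * \<xi> j) + s * \<xi> d"
          using v\<gamma> vy by (simp add: cols G0 G1 G2)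
        also have "(\<Sum>j<d. (\<Sum>a<n. v a * z (a, j)) * \<xi> j) = - (\<Sum>j<d. H z j * \<xi> j)"
          by (simp add: H_eq sum_negf)
        finally have vW: "inner_N n v W = s * \<xi> d - (\<Sum>j<d. H z j * \<xi> j)" by simp
        have "(inner_N n v W)\<^sup>2 \<le> \<rho>\<^sup>2"
          using inner_N_cauchy_schwarz[of n v W] \<xi>(2) v1 by (simp add: inner_N_def W_def power2_eq_square)
        then have "inner_N n v W \<le> \<rho>" using \<rho> by (simp add: abs_le_square_iff[symmetric])
        then have "s * \<xi> d \<le> \<rho> + gsup {..<d} X (H z)" using vW ge[OF \<xi>(1), of "H z"] by linarith
        moreover have "e * sqrt m * t \<le> s * \<xi> d" using s t \<xi>(3) spos by (intro mult_mono) auto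
        ultimately have "c < gsup {..<d} X (H z)" using c by linarith
        then show "z \<in> H -` T \<inter> space (gauss J2)" using z(1) measurable_space[OF H z(1)] by (simp add: T_def)
      qed
      then have "emeasure (gauss J2) ((\<lambda>z. merge J1 J2 (y, z)) -` Bx \<inter> space (gauss J2))
        \<le> emeasure (gauss J2) (H -` T \<inter> space (gauss J2))"
        by (intro emeasure_mono measurable_sets[OF H T])
      also have "\<dots> = emeasure (distr (gauss J2) (gauss {..<d}) H) T" by (rule emeasure_distr[OF H T, symmetric])
      also have "\<dots> \<le> \<beta>" using tail by (simp add: DH T_def)
      finally show "emeasure (gauss J2) ((\<lambda>z. merge J1 J2 (y, z)) -` Bx \<inter> space (gauss J2)) \<le> \<beta>" .
    qed
    then show "emeasure (gauss (J1 \<union> J2)) ((\<lambda>w. merge J0 (J1 \<union> J2) (x, w)) -` ?B \<inter> space (gauss (J1 \<union> J2)))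
      \<le> ennreal ((2 * e) ^ m) + \<beta>" by (simp add: Bx_def)
  qed (use J in auto)
  then show ?thesis by (simp add: I)
qed

section \<open>Long vectors in a random subspace\<close>

text \<open>Expresses membership through a quantity that is continuous in \<open>x\<close> and
  measurable in \<open>F\<close>, as \<open>measurable_compact_ex\<close> demands.\<close>

lemma mem_grassmannian_iff:
  assumes "F \<in> grassmannian N n" "x \<in> RN N"
  shows "x \<in> F \<longleftrightarrow> (\<Sum>k<N. (orth_proj N F x k - x k)\<^sup>2) \<le> 0"
proof -
  obtain b where b: "orthonormal N b N" "F = span (b ` {..<N - n})" by (rule grassmannian_basis[OF assms(1)])
  have o: "orthonormal N b (N - n)" by (rule orthonormal_mono[OF b(1)]) simp
  have P: "orth_proj N F x = (\<Sum>i<N - n. inner_N N x (b i) *\<^sub>R b i)"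
    unfolding b(2) by (rule orth_proj_span[OF o])
  have PF: "orth_proj N F x \<in> F" by (subst P) (simp only: b(2) lincomb_in_span)
  have FRN: "F \<subseteq> RN N" using assms(1) by (simp add: grassmannian_def)
  have "x \<in> F \<longleftrightarrow> orth_proj N F x = x"
    using PF P span_orthonormal_expand[OF o, of x] b(2) by metis
  also have "\<dots> \<longleftrightarrow> (\<Sum>k<N. (orth_proj N F x k - x k)\<^sup>2) \<le> 0"
  proof
    assume "(\<Sum>k<N. (orth_proj N F x k - x k)\<^sup>2) \<le> 0"
    then have "inner_N N (orth_proj N F x - x) (orth_proj N F x - x) = 0"
      using inner_N_self_nonneg[of N "orth_proj N F x - x"] by (simp add: inner_N_def power2_eq_square)
    moreover have "orth_proj N F x - x \<in> RN N"
      using PF FRN assms(2) by (intro subspace_diff subspace_RN) auto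
    ultimately show "orth_proj N F x = x" using inner_N_self_eq_0 by fastforce
  qed simp
  finally show ?thesis .
qed

lemma continuous_on_coordinate: "continuous_on K (\<lambda>x :: nat \<Rightarrow> real. x i)"
  by (rule continuous_on_subset[OF continuous_on_product_coordinates]) simp

lemma continuous_on_norm_N: "continuous_on K (norm_N N)"
  unfolding norm_N_def inner_N_def
  by (intro continuous_on_real_sqrt continuous_on_sum continuous_on_mult continuous_on_coordinate)

lemma continuous_on_orth_proj:
  assumes "F \<in> grassmannian N n"
  shows "continuous_on K (\<lambda>x. orth_proj N F x k)"
proof -
  have "(\<lambda>x. orth_proj N F x k) = (\<lambda>x. \<Sum>i<N. x i * orth_proj N F (unit_N i) k)"
    by (rule ext) (rule orth_proj_expand[OF assms])
  then show ?thesis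
    by (simp only:) (intro continuous_on_sum continuous_on_mult continuous_on_coordinate continuous_on_const)
qed

text \<open>Membership and the sign of \<open>f\<close> are merged into one inequality by
  \<open>max\<close>. The map \<Phi> allows the random subspace to be one component of a product
  space.\<close>

lemma measurable_subspace_meets:
  assumes haar: "haar_grassmannian N n M" and K: "compact K" "K \<subseteq> RN N"
    and \<Phi>: "\<Phi> \<in> measurable W M"
    and meas: "\<And>x. x \<in> K \<Longrightarrow> (\<lambda>w. f w x) \<in> borel_measurable W"
    and cont: "\<And>w. w \<in> space W \<Longrightarrow> continuous_on K (f w)"
  shows "{w \<in> space W. \<exists>x\<in>K. x \<in> \<Phi> w \<and> 0 \<le> (f w x :: real)} \<in> sets W"
proof -
  define g where "g w x = max (\<Sum>k<N. (orth_proj N (\<Phi> w) x k - x k)\<^sup>2) (- f w x)" for w x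
  have \<Phi>G: "\<Phi> w \<in> grassmannian N n" if "w \<in> space W" for w
    using measurable_space[OF \<Phi> that] by (simp add: haar_space[OF haar])
  have "x \<in> \<Phi> w \<and> 0 \<le> f w x \<longleftrightarrow> g w x \<le> 0" if "w \<in> space W" "x \<in> K" for w x
    using mem_grassmannian_iff[OF \<Phi>G[OF that(1)], of x] that(2) K(2) by (auto simp: g_def)
  then have "{w \<in> space W. \<exists>x\<in>K. x \<in> \<Phi> w \<and> 0 \<le> f w x} = {w \<in> space W. \<exists>x\<in>K. g w x \<le> 0}"
    by blast
  also have "\<dots> \<in> sets W"
  proof (rule measurable_compact_ex[OF K(1)])
    fix x assume x: "x \<in> K"
    have "(\<lambda>w. orth_proj N (\<Phi> w) x k) \<in> borel_measurable W" for k
      by (rule measurable_compose[OF \<Phi> measurable_orth_proj[OF haar]])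
    then show "(\<lambda>w. g w x) \<in> borel_measurable W"
      unfolding g_def using meas[OF x]
      by (intro borel_measurable_max borel_measurable_sum borel_measurable_power borel_measurable_diff
          borel_measurable_const borel_measurable_uminus)
  next
    fix w assume w: "w \<in> space W"
    show "continuous_on K (g w)"
      unfolding g_def
      by (intro continuous_on_max continuous_on_sum continuous_on_power continuous_on_diff
          continuous_on_orth_proj[OF \<Phi>G[OF w]] continuous_on_coordinate continuous_on_minus cont[OF w])
  qed
  finally show ?thesis .
qed

text \<open>With \<open>u\<close> placed directly after the basis of \<open>E\<close>, the
  coordinate of index \<open>N - k\<close> is the component along \<open>u\<close> and the
  coordinates before it describe the projection onto \<open>E\<close>.\<close>

lemma grassmannian_basis_direction:
  assumes E: "E \<in> grassmannian N k" and k: "1 \<le> k"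
    and u: "u \<in> RN N" "inner_N N u u = 1" "\<And>z. z \<in> E \<Longrightarrow> inner_N N u z = 0"
  obtains b where "orthonormal N b N" "E = span (b ` {..<N - k})" "b (N - k) = u"
proof -
  have kN: "k \<le> N" using E by (auto simp: grassmannian_def)
  obtain b0 where b0: "orthonormal N b0 N" "E = span (b0 ` {..<N - k})" by (rule grassmannian_basis[OF E])
  have bE: "b0 i \<in> E" if "i < N - k" for i unfolding b0(2) using that by (intro span_base) auto
  define b1 where "b1 = b0(N - k := u)"
  have b1: "orthonormal N b1 (Suc (N - k))"
    unfolding orthonormal_def
  proof (intro conjI allI impI)
    fix i j assume i: "i < Suc (N - k)" and j: "j < Suc (N - k)"
    show "b1 i \<in> RN N" using u(1) orthonormalD(1)[OF b0(1), of i] i k kN by (cases "i = N - k") (auto simp: b1_def)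
    show "inner_N N (b1 i) (b1 j) = (if i = j then 1 else 0)"
      using u(2) u(3)[OF bE, of i] u(3)[OF bE, of j] i j orthonormalD(2)[OF b0(1), of i j]
        inner_N_commute[of N u "b0 i"] k kN
      by (cases "i = N - k"; cases "j = N - k") (auto simp: b1_def)
  qed
  have "b1 ` {..<Suc (N - k)} \<subseteq> RN N" using orthonormalD(1)[OF b1] by blast
  from orthonormal_extend[OF b1 this subspace_RN subset_refl]
  obtain b where b: "\<forall>i<Suc (N - k). b i = b1 i" "orthonormal N b N" unfolding dim_RN by blast
  have "b ` {..<N - k} = b0 ` {..<N - k}" using b(1) by (intro image_cong) (auto simp: b1_def)
  then have "E = span (b ` {..<N - k})" by (simp add: b0(2))
  moreover have "b (N - k) = u" using b(1) by (simp add: b1_def)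
  ultimately show ?thesis using b(2) that by blast
qed

context
  fixes N n k :: nat and M :: "(nat \<Rightarrow> real) set measure" and E K :: "(nat \<Rightarrow> real) set" and R :: real
  assumes haar: "haar_grassmannian N n M" and E: "E \<in> grassmannian N k" and k: "1 \<le> k" "k \<le> n"
    and K: "compact K" "K \<subseteq> RN N" "0 \<in> K"
    and R: "R > 0" "\<And>x. x \<in> K \<Longrightarrow> norm_N N (orth_proj N E x) \<le> R"
begin

text \<open>Boundedness of \<open>K\<close> gives one tolerance for all its points: for
  \<open>x \<in> F\<close>, Cauchy-Schwarz bounds the squared norm of \<Gamma> \<open>x\<close> by
  \<open>proj_sq\<close> times that of \<open>x\<close>. A sufficiently small value of
  \<open>proj_sq\<close> therefore turns the event for \<open>F\<close> into the matrix event of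
  \<open>gauss_matrix_kernel_coordinate\<close>, read in the basis \<open>b\<close>.\<close>

lemma haar_fixed_direction:
  assumes u: "u \<in> RN N" "inner_N N u u = 1" "\<And>z. z \<in> E \<Longrightarrow> inner_N N u z = 0"
    and e: "e > 0" and t: "t \<ge> 0" and \<sigma>: "\<sigma> \<ge> 0"
    and large: "4 * ell_star N (orth_proj N E ` K) + 3 * \<sigma> < e * sqrt (real (n - k + 1)) * t"
  shows "emeasure M {F \<in> space M. \<exists>x\<in>K. x \<in> F \<and> 0 \<le> inner_N N x u - t}
    \<le> ennreal ((2 * e) ^ (n - k + 1)) + ennreal (4 * exp (- \<sigma>\<^sup>2 / (2 * R\<^sup>2)))"
    (is "emeasure M ?B \<le> ?p")
proof -
  obtain b where b: "orthonormal N b N" "E = span (b ` {..<N - k})" "b (N - k) = u"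
    using grassmannian_basis_direction[OF E k(1) u] by metis
  define d where "d = N - k"
  have kN: "k \<le> N" using E by (auto simp: grassmannian_def)
  have d: "d < N" "N - d \<le> n" "n - (N - d) = n - k" using k kN by (auto simp: d_def)
  have bd: "orthonormal N b d" by (rule orthonormal_mono[OF b(1)]) (simp add: d_def)
  have Ed: "E = span (b ` {..<d})" by (simp add: b(2) d_def)
  have K0: "K \<noteq> {}" using K by auto
  define X where "X = coords N b K"
  define c where "c = 4 * ell_star N (orth_proj N E ` K) + 3 * \<sigma>"
  \<comment> \<open>Half of the gap in \<open>large\<close>: a positive tolerance that keeps the
    inequality strict.\<close>
  define \<rho> where "\<rho> = (e * sqrt (real (n - k + 1)) * t - c) / 2"
  have \<rho>: "\<rho> > 0" "\<rho> + c < e * sqrt (real (n - k + 1)) * t"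
    using large by (auto simp: \<rho>_def c_def field_simps)
  define I where "I = {..<n} \<times> {..<N}"
  define B2 where "B2 = {G \<in> space (gauss I). \<exists>y\<in>X. (\<Sum>a<n. (\<Sum>j<N. G (a, j) * y j)\<^sup>2) \<le> \<rho>\<^sup>2 \<and> t \<le> y d}"
  have B2: "B2 \<in> sets (gauss I)"
  proof -
    define f where "f G x = max ((\<Sum>a<n. (\<Sum>j<N. G (a, j) * inner_N N x (b j))\<^sup>2) - \<rho>\<^sup>2) (t - inner_N N x u)"
      for G :: "nat \<times> nat \<Rightarrow> real" and x
    have "B2 = {G \<in> space (gauss I). \<exists>x\<in>K. f G x \<le> 0}"
      by (auto simp: B2_def X_def coords_def f_def b(3) d_def)
    also have "\<dots> \<in> sets (gauss I)"
      unfolding f_def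
      by (intro measurable_compact_ex K(1) borel_measurable_max borel_measurable_diff borel_measurable_sum
          borel_measurable_power borel_measurable_times borel_measurable_const measurable_gauss_component
          continuous_on_max continuous_on_diff continuous_on_sum continuous_on_power continuous_on_mult
          continuous_on_const continuous_on_inner_N) (auto simp: I_def)
    finally show ?thesis .
  qed
  have ge: "(\<Sum>j<d. g j * y j) \<le> gsup {..<d} X g" if "y \<in> X" for g y
  proof -
    obtain x where "x \<in> K" "\<forall>z\<in>K. (\<Sum>j<d. g j * inner_N N z (b j)) \<le> (\<Sum>j<d. g j * inner_N N x (b j))"
      using compact_attains_lincomb[OF K(1) K0, where J = "{..<d}" and g = g and N = N and b = b] by blast
    then show ?thesis unfolding gsup_def using that
      by (intro cSUP_upper) (auto simp: bdd_above_def X_def coords_def)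
  qed
  have B2_le: "emeasure (gauss I) B2 \<le> ?p"
    unfolding B2_def I_def
  proof (rule gauss_matrix_kernel_coordinate[OF _ d(1,2) _ e \<rho>(1) t _ _ ge])
    show "emeasure (gauss {..<d}) {g \<in> space (gauss {..<d}). c < gsup {..<d} X g}
      \<le> ennreal (4 * exp (- \<sigma>\<^sup>2 / (2 * R\<^sup>2)))"
      unfolding c_def X_def by (rule gsup_coords_tail[OF bd Ed K(1,3) R \<sigma>])
    show "gsup {..<d} X \<in> borel_measurable (gauss {..<d})"
      unfolding X_def by (rule measurable_gsup_coords[OF K(1) K0])
  qed (use B2 \<rho>(2) d(3) in \<open>simp_all add: B2_def I_def\<close>)
  \<comment> \<open>Passing from the unit vectors to the basis \<open>b\<close> is a rotation of the
    rows and leaves the Gaussian law unchanged.\<close>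
  define B1 where "B1 = row_map N n b unit_N -` B2 \<inter> space (gauss I)"
  have rm: "row_map N n b unit_N \<in> measurable (gauss I) (gauss I)"
    unfolding I_def by (rule measurable_row_map)
  have B1: "B1 \<in> sets (gauss I)" unfolding B1_def by (rule measurable_sets[OF rm B2])
  have "emeasure (gauss I) B1 = emeasure (distr (gauss I) (gauss I) (row_map N n b unit_N)) B2"
    unfolding B1_def by (rule emeasure_distr[OF rm B2, symmetric])
  also have "distr (gauss I) (gauss I) (row_map N n b unit_N) = gauss I"
    unfolding I_def by (rule distr_row_map[OF b(1) orthonormal_unit])
  finally have B1_le: "emeasure (gauss I) B1 \<le> ?p" using B2_le by simp
  obtain x0 where x0: "x0 \<in> K" "\<And>x. x \<in> K \<Longrightarrow> norm_N N x \<le> norm_N N x0"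
    using continuous_attains_sup[OF K(1) K0 continuous_on_norm_N] by blast
  define L where "L = inner_N N x0 x0"
  have L: "inner_N N x x \<le> L" if "x \<in> K" for x
    using power_mono[OF x0(2)[OF that] norm_N_nonneg, of 2] by (simp add: norm_N_sq L_def)
  have L0: "L \<ge> 0" unfolding L_def by (rule inner_N_self_nonneg)
  \<comment> \<open>\<open>L\<close> is the largest squared norm in \<open>K\<close>; adding 1 keeps
    the denominator positive when \<open>K = {0}\<close>.\<close>
  define \<delta> where "\<delta> = \<rho>\<^sup>2 / (L + 1)"
  have \<delta>: "\<delta> > 0" using \<rho> L0 by (simp add: \<delta>_def)
  have "emeasure M ?B \<le> emeasure (gauss I) B1"
    unfolding I_def
  proof (rule haar_le_gauss[OF haar \<delta>])
    show "?B \<in> sets M"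
      by (intro measurable_subspace_meets[OF haar K(1,2) measurable_ident_sets[OF refl]] borel_measurable_const
          continuous_on_diff continuous_on_inner_N continuous_on_const)
    show "B1 \<in> sets (gauss ({..<n} \<times> {..<N}))" using B1 by (simp add: I_def)
    fix F \<Gamma> assume FB: "F \<in> ?B" and F: "F \<in> grassmannian N n"
      and \<Gamma>: "\<Gamma> \<in> space (gauss ({..<n} \<times> {..<N}))" and near: "proj_sq N n F \<Gamma> < \<delta>"
    obtain x where x: "x \<in> K" "x \<in> F" "t \<le> inner_N N x u" using FB by auto
    define G where "G = row_map N n b unit_N \<Gamma>"
    have G_eq: "G (a, j) = inner_N N (\<lambda>i. \<Gamma> (a, i)) (b j)" if "a < n" "j < N" for a j
    proof -
      have "G (a, j) = basis_map N b unit_N (\<lambda>i. \<Gamma> (a, i)) j" using that by (simp add: G_def row_map_def)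
      also have "\<dots> = (\<Sum>i<N. if i = j then inner_N N (\<lambda>i. \<Gamma> (a, i)) (b i) else 0)"
        by (simp add: basis_map_def sum_fun_apply unit_N_def if_distrib[of "\<lambda>z. _ * z"] eq_commute cong: if_cong)
      also have "\<dots> = inner_N N (\<lambda>i. \<Gamma> (a, i)) (b j)" using that by simp
      finally show ?thesis .
    qed
    have "(\<Sum>a<n. (\<Sum>j<N. G (a, j) * inner_N N x (b j))\<^sup>2) \<le> (\<Sum>a<n. inner_N N (orth_proj N F (\<lambda>i. \<Gamma> (a, i))) (orth_proj N F (\<lambda>i. \<Gamma> (a, i))) * L)"
    proof (rule sum_mono)
      fix a assume a: "a \<in> {..<n}"
      let ?g = "\<lambda>i. \<Gamma> (a, i)"
      have "(\<Sum>j<N. G (a, j) * inner_N N x (b j)) = inner_N N ?g x"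
        using a inner_N_parseval[OF b(1) b(1), of ?g x] K(2) x(1) by (auto simp: G_eq)
      also have "\<dots> = inner_N N (orth_proj N F ?g) x" by (rule inner_N_orth_proj[OF F x(2), symmetric])
      finally have "(\<Sum>j<N. G (a, j) * inner_N N x (b j))\<^sup>2
        \<le> inner_N N (orth_proj N F ?g) (orth_proj N F ?g) * inner_N N x x"
        using inner_N_cauchy_schwarz by metis
      also have "\<dots> \<le> inner_N N (orth_proj N F ?g) (orth_proj N F ?g) * L"
        using L[OF x(1)] by (intro mult_left_mono inner_N_self_nonneg)
      finally show "(\<Sum>j<N. G (a, j) * inner_N N x (b j))\<^sup>2 \<le> inner_N N (orth_proj N F ?g) (orth_proj N F ?g) * L" .
    qed
    also have "\<dots> = proj_sq N n F \<Gamma> * L" by (simp add: proj_sq_def sum_distrib_right)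
    also have "\<dots> \<le> \<delta> * (L + 1)" using near L0 \<delta> by (intro mult_mono) auto
    also have "\<dots> = \<rho>\<^sup>2" using L0 by (simp add: \<delta>_def)
    finally have "(\<Sum>a<n. (\<Sum>j<N. G (a, j) * inner_N N x (b j))\<^sup>2) \<le> \<rho>\<^sup>2" .
    moreover have "(\<lambda>j. inner_N N x (b j)) \<in> X" using x(1) by (auto simp: X_def coords_def)
    moreover have "G \<in> space (gauss I)" unfolding G_def using measurable_space[OF rm] \<Gamma> by (simp add: I_def)
    moreover have "t \<le> inner_N N x (b d)" using x(3) b(3) by (simp add: d_def)
    ultimately have "G \<in> B2"
      unfolding B2_def by (intro CollectI conjI bexI[of _ "\<lambda>j. inner_N N x (b j)"])
    then show "\<Gamma> \<in> B1" using \<Gamma> by (simp add: B1_def G_def I_def)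
  qed
  then show ?thesis using B1_le by (rule order_trans)
qed

text \<open>A standard Gaussian \<open>\<xi>\<close> in the orthogonal complement of \<open>E\<close> has, with probability exponential in
  \<open>s\<close>, a component of size \<open>sqrt s\<close> in the direction of a given long vector of \<open>F \<inter> K\<close>; this reduces the
  norm of that vector to its inner product with a fixed direction.\<close>

lemma haar_long_vector:
  assumes c: "R < c" and e: "e > 0" and \<sigma>: "\<sigma> \<ge> 0" and s: "1 \<le> s" "s \<le> real k"
    and large: "4 * ell_star N (orth_proj N E ` K) + 3 * \<sigma>
      < e * sqrt (real (n - k + 1)) * (sqrt s * (c - R) / (6 * sqrt (real k)))"
  shows "ennreal (exp (- 5 * s)) * emeasure M {F \<in> space M. \<exists>x\<in>K. x \<in> F \<and> 0 \<le> norm_N N x - c}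
    \<le> ennreal ((2 * e) ^ (n - k + 1)) + ennreal (4 * exp (- \<sigma>\<^sup>2 / (2 * R\<^sup>2)))"
    (is "_ * emeasure M ?B \<le> ?p")
proof -
  interpret M: prob_space M by (rule haar_prob[OF haar])
  define X where "X = gauss {..<k}"
  interpret X: prob_space X unfolding X_def by (rule prob_space_gauss)
  interpret P: pair_prob_space M X ..
  obtain b where b: "orthonormal N b N" "E = span (b ` {..<N - k})" by (rule grassmannian_basis[OF E])
  have kN: "k \<le> N" using E by (auto simp: grassmannian_def)
  have bd: "orthonormal N b (N - k)" by (rule orthonormal_mono[OF b(1)]) simp
  define p where "p i = b (N - k + i)" for i
  have p: "orthonormal N p k" using b(1) kN by (auto simp: orthonormal_def p_def simp del: topspace_Euclidean_space)
  define \<tau> where "\<tau> = c - R"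
  have \<tau>: "\<tau> > 0" using c by (simp add: \<tau>_def)
  \<comment> \<open>\<open>Z\<close> is integrated in both orders. For fixed
    \<open>F \<in> ?B\<close> its slice has probability at least \<open>exp (- 5 * s)\<close>; for
    fixed \<open>\<xi>\<close> its slice is an event for a fixed direction. The second condition
    bounds the length by which \<open>\<xi>\<close> is normalized.\<close>
  define Z where "Z = {z \<in> space (M \<Otimes>\<^sub>M X). \<exists>x\<in>K. x \<in> fst z \<and> 0 \<le> (\<Sum>i<k. snd z i * inner_N N x (p i)) - sqrt s * \<tau>}
    \<inter> {z \<in> space (M \<Otimes>\<^sub>M X). (\<Sum>i<k. (snd z i)\<^sup>2) \<le> 36 * real k}"
  have comp: "(\<lambda>z. snd z i) \<in> borel_measurable (M \<Otimes>\<^sub>M X)" if "i \<in> {..<k}" for i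
    unfolding X_def by (rule measurable_compose[OF measurable_snd measurable_gauss_component[OF that]])
  have Z: "Z \<in> sets (M \<Otimes>\<^sub>M X)"
    unfolding Z_def
  proof (intro sets.Int)
    show "{z \<in> space (M \<Otimes>\<^sub>M X). \<exists>x\<in>K. x \<in> fst z \<and> 0 \<le> (\<Sum>i<k. snd z i * inner_N N x (p i)) - sqrt s * \<tau>} \<in> sets (M \<Otimes>\<^sub>M X)"
      by (intro measurable_subspace_meets[OF haar K(1,2) measurable_fst] borel_measurable_diff
          borel_measurable_sum borel_measurable_times borel_measurable_const comp
          continuous_on_diff continuous_on_sum continuous_on_mult continuous_on_inner_N continuous_on_const)
    have "(\<lambda>z. \<Sum>i<k. (snd z i)\<^sup>2) \<in> borel_measurable (M \<Otimes>\<^sub>M X)"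
      by (intro borel_measurable_sum borel_measurable_power comp)
    then show "{z \<in> space (M \<Otimes>\<^sub>M X). (\<Sum>i<k. (snd z i)\<^sup>2) \<le> 36 * real k} \<in> sets (M \<Otimes>\<^sub>M X)"
      by measurable
  qed
  have B: "?B \<in> sets M"
    by (intro measurable_subspace_meets[OF haar K(1,2) measurable_ident_sets[OF refl]] borel_measurable_const
        continuous_on_diff continuous_on_norm_N continuous_on_const)
  have "ennreal (exp (- 5 * s)) * emeasure M ?B = (\<integral>\<^sup>+F. ennreal (exp (- 5 * s)) * indicator ?B F \<partial>M)"
    by (rule nn_integral_cmult_indicator[OF B, symmetric])
  also have "\<dots> \<le> (\<integral>\<^sup>+F. emeasure X (Pair F -` Z) \<partial>M)"
  proof (rule nn_integral_mono)
    fix F assume F: "F \<in> space M"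
    show "ennreal (exp (- 5 * s)) * indicator ?B F \<le> emeasure X (Pair F -` Z)"
    proof (cases "F \<in> ?B")
      case True
      then obtain x where x: "x \<in> K" "x \<in> F" "c \<le> norm_N N x" by auto
      define w where "w i = inner_N N x (p i)" for i
      define l where "l = sqrt (\<Sum>i<k. (w i)\<^sup>2)"
      have split: "{..<N} = {..<N - k} \<union> {N - k..<N}" using kN by auto
      have "(norm_N N x)\<^sup>2 = (\<Sum>j<N. (inner_N N x (b j))\<^sup>2)"
        using inner_N_parseval[OF b(1) b(1), of x x] K(2) x(1) norm_N_sq[of N x]
        by (auto simp: power2_eq_square)
      also have "\<dots> = (\<Sum>j<N - k. (inner_N N x (b j))\<^sup>2) + (\<Sum>j\<in>{N - k..<N}. (inner_N N x (b j))\<^sup>2)"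
        unfolding split by (rule sum.union_disjoint) auto
      also have "(\<Sum>j<N - k. (inner_N N x (b j))\<^sup>2) = (norm_N N (orth_proj N E x))\<^sup>2"
        unfolding b(2) orth_proj_span[OF bd] norm_N_sq norm_sq_lincomb[OF bd] ..
      also have "(\<Sum>j\<in>{N - k..<N}. (inner_N N x (b j))\<^sup>2) = (\<Sum>i<k. (w i)\<^sup>2)"
        using sum.shift_bounds_nat_ivl[of "\<lambda>j. (inner_N N x (b j))\<^sup>2" 0 "N - k" k] kN
        by (simp add: w_def p_def atLeast0LessThan add.commute)
      also have "\<dots> = l\<^sup>2" by (simp add: l_def sum_nonneg)
      finally have nx: "(norm_N N x)\<^sup>2 = (norm_N N (orth_proj N E x))\<^sup>2 + l\<^sup>2" .
      have l0: "l \<ge> 0" by (simp add: l_def sum_nonneg)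
      \<comment> \<open>The part of \<open>x\<close> in \<open>E\<close> has norm at most
        \<open>R\<close>, which leaves a length of at least \<open>c - R\<close> orthogonal to
        \<open>E\<close>.\<close>
      have "(norm_N N x)\<^sup>2 \<le> (norm_N N (orth_proj N E x) + l)\<^sup>2"
        using nx l0 norm_N_nonneg[of N "orth_proj N E x"] by (simp add: power2_sum)
      then have "norm_N N x \<le> norm_N N (orth_proj N E x) + l"
        by (rule power2_le_imp_le) (use l0 norm_N_nonneg in auto)
      then have l: "\<tau> \<le> l" using R(2)[OF x(1)] x(3) by (simp add: \<tau>_def)
      then have lpos: "l > 0" using \<tau> by linarith
      have "ennreal (exp (- 5 * s)) \<le> emeasure X {\<xi> \<in> space X. sqrt s \<le> (\<Sum>i<k. \<xi> i * (w i / l)) \<and> (\<Sum>i<k. (\<xi> i)\<^sup>2) \<le> 36 * real k}"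
      proof -
        have "(\<Sum>i<k. (w i / l)\<^sup>2) = l\<^sup>2 / l\<^sup>2"
          by (simp add: power_divide sum_divide_distrib[symmetric]) (simp add: l_def sum_nonneg)
        then have "(\<Sum>i<k. (w i / l)\<^sup>2) = 1" using lpos by simp
        then show ?thesis using gauss_direction_lower_bound[of "{..<k}" s "\<lambda>i. w i / l"] s by (simp add: X_def)
      qed
      also have "\<dots> \<le> emeasure X (Pair F -` Z)"
      proof (rule emeasure_mono)
        show "Pair F -` Z \<in> sets X" by (rule sets_Pair1[OF Z])
        show "{\<xi> \<in> space X. sqrt s \<le> (\<Sum>i<k. \<xi> i * (w i / l)) \<and> (\<Sum>i<k. (\<xi> i)\<^sup>2) \<le> 36 * real k} \<subseteq> Pair F -` Z"
        proof (rule subsetI)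
          fix \<xi> assume "\<xi> \<in> {\<xi> \<in> space X. sqrt s \<le> (\<Sum>i<k. \<xi> i * (w i / l)) \<and> (\<Sum>i<k. (\<xi> i)\<^sup>2) \<le> 36 * real k}"
          then have \<xi>: "\<xi> \<in> space X" "sqrt s \<le> (\<Sum>i<k. \<xi> i * (w i / l))" "(\<Sum>i<k. (\<xi> i)\<^sup>2) \<le> 36 * real k" by auto
          have "sqrt s \<le> (\<Sum>i<k. \<xi> i * w i) / l" using \<xi>(2) by (simp add: sum_divide_distrib)
          then have "sqrt s * l \<le> (\<Sum>i<k. \<xi> i * w i)" using lpos by (simp add: pos_le_divide_eq)
          moreover have "sqrt s * \<tau> \<le> sqrt s * l" using l s by (intro mult_left_mono) auto
          ultimately have "0 \<le> (\<Sum>i<k. \<xi> i * inner_N N x (p i)) - sqrt s * \<tau>" by (simp add: w_def)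
          then show "\<xi> \<in> Pair F -` Z" using \<xi> x F by (auto simp: Z_def space_pair_measure)
        qed
      qed
      finally show ?thesis using True by simp
    qed simp
  qed
  also have "\<dots> = emeasure (M \<Otimes>\<^sub>M X) Z" by (rule X.emeasure_pair_measure_alt[OF Z, symmetric])
  also have "\<dots> = (\<integral>\<^sup>+\<xi>. emeasure M ((\<lambda>F. (F, \<xi>)) -` Z) \<partial>X)" by (rule P.emeasure_pair_measure_alt2[OF Z])
  also have "\<dots> \<le> (\<integral>\<^sup>+\<xi>. ?p \<partial>X)"
  proof (rule nn_integral_mono)
    fix \<xi> assume \<xi>: "\<xi> \<in> space X"
    define l where "l = sqrt (\<Sum>i<k. (\<xi> i)\<^sup>2)"
    have l2: "l\<^sup>2 = (\<Sum>i<k. (\<xi> i)\<^sup>2)" by (simp add: l_def sum_nonneg)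
    have l0: "l \<ge> 0" by (simp add: l_def sum_nonneg)
    show "emeasure M ((\<lambda>F. (F, \<xi>)) -` Z) \<le> ?p"
    \<comment> \<open>In the first case the slice is empty: a zero \<open>\<xi>\<close> cannot reach
      the positive level \<open>sqrt s * \<tau>\<close>, and a long one violates the second
      condition of \<open>Z\<close>.\<close>
    proof (cases "l = 0 \<or> 36 * real k < (\<Sum>i<k. (\<xi> i)\<^sup>2)")
      case True
      have "(\<lambda>F. (F, \<xi>)) -` Z = {}"
      proof (cases "l = 0")
        case True
        then have "\<forall>i\<in>{..<k}. (\<xi> i)\<^sup>2 = 0" using l2 by (subst (asm) eq_commute) (simp add: sum_nonneg_eq_0_iff)
        then have "(\<Sum>i<k. \<xi> i * inner_N N x (p i)) = 0" for x by (intro sum.neutral) auto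
        moreover have "sqrt s * \<tau> > 0" using s \<tau> by simp
        ultimately show ?thesis by (auto simp: Z_def)
      qed (use True in \<open>auto simp: Z_def\<close>)
      then show ?thesis by simp
    next
      case False
      then have lpos: "l > 0" and l36: "l\<^sup>2 \<le> 36 * real k" using l0 l2 by auto
      have l6: "l \<le> 6 * sqrt (real k)"
        using real_sqrt_le_mono[OF l36] l0 by (simp add: real_sqrt_mult)
      define u where "u = (\<Sum>i<k. (\<xi> i / l) *\<^sub>R p i)"
      have u: "u \<in> RN N" "inner_N N u u = 1"
      proof -
        show "u \<in> RN N" using lincomb_in_span[of "\<lambda>i. \<xi> i / l" p k] span_orthonormal_subset[OF p] unfolding u_def by (rule subsetD[rotated])
        have "inner_N N u u = (\<Sum>i<k. (\<xi> i)\<^sup>2) / l\<^sup>2"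
          unfolding u_def norm_sq_lincomb[OF p] by (simp add: power_divide sum_divide_distrib)
        then show "inner_N N u u = 1" using lpos by (simp add: l2[symmetric])
      qed
      have uE: "inner_N N u z = 0" if "z \<in> E" for z
      proof (rule inner_N_span_zero[OF _ that[unfolded b(2)]])
        fix y assume "y \<in> b ` {..<N - k}"
        then obtain j where "j < N - k" "y = b j" by auto
        then show "inner_N N u y = 0"
          using kN by (auto simp: u_def inner_N_sum_left inner_N_scaleR_left p_def orthonormalD(2)[OF b(1)]
              intro!: sum.neutral)
      qed
      \<comment> \<open>The level \<open>sqrt s * \<tau>\<close> after division by the largest
        admissible length \<open>6 * sqrt k\<close> of \<open>\<xi>\<close>.\<close>
      define t where "t = sqrt s * \<tau> / (6 * sqrt (real k))"
      have t: "t \<ge> 0" using s \<tau> by (simp add: t_def)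
      have "(\<lambda>F. (F, \<xi>)) -` Z \<subseteq> {F \<in> space M. \<exists>x\<in>K. x \<in> F \<and> 0 \<le> inner_N N x u - t}"
      proof (rule subsetI)
        fix F assume "F \<in> (\<lambda>F. (F, \<xi>)) -` Z"
        then obtain x where x: "F \<in> space M" "x \<in> K" "x \<in> F" "sqrt s * \<tau> \<le> (\<Sum>i<k. \<xi> i * inner_N N x (p i))"
          by (auto simp: Z_def space_pair_measure)
        have "inner_N N x u = (\<Sum>i<k. \<xi> i * inner_N N x (p i)) / l"
          by (simp add: u_def inner_N_sum_right inner_N_scaleR_right sum_divide_distrib)
        moreover have "sqrt s * \<tau> / l \<le> (\<Sum>i<k. \<xi> i * inner_N N x (p i)) / l"
          using x(4) lpos by (intro divide_right_mono) auto
        moreover have "t \<le> sqrt s * \<tau> / l"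
          unfolding t_def using l6 lpos s \<tau> by (intro divide_left_mono mult_nonneg_nonneg mult_pos_pos) auto
        ultimately show "F \<in> {F \<in> space M. \<exists>x\<in>K. x \<in> F \<and> 0 \<le> inner_N N x u - t}" using x by auto
      qed
      then have "emeasure M ((\<lambda>F. (F, \<xi>)) -` Z) \<le> emeasure M {F \<in> space M. \<exists>x\<in>K. x \<in> F \<and> 0 \<le> inner_N N x u - t}"
        by (intro emeasure_mono measurable_subspace_meets[OF haar K(1,2) measurable_ident_sets[OF refl]] borel_measurable_const
          continuous_on_diff continuous_on_inner_N continuous_on_const)
      also have "\<dots> \<le> ?p"
        using large by (intro haar_fixed_direction u uE e t \<sigma>) (simp_all add: t_def \<tau>_def)
      finally show ?thesis .
    qed
  qed
  also have "\<dots> = ?p" by (simp add: X.emeasure_space_1)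
  finally show ?thesis .
qed

end

section \<open>The random radius\<close>

lemma convex_bodyD:
  assumes "convex_body N K"
  shows "compact K" "K \<subseteq> RN N" "0 \<in> K" "\<exists>V. open V \<and> 0 \<in> V \<and> V \<inter> RN N \<subseteq> K"
proof -
  have K: "compactin (Euclidean_space N) K" "0 \<in> Euclidean_space N interior_of K"
    using assms by (auto simp: convex_body_def)
  have ES: "Euclidean_space N = subtopology euclidean {x. \<forall>i\<ge>N. x i = 0}"
    by (simp add: Euclidean_space_def euclidean_product_topology)
  show "compact K"
    using K(1) unfolding ES compactin_subtopology by (simp add: compactin_euclidean_iff)
  show "K \<subseteq> RN N" using K(1) by (rule compactin_subset_topspace)
  show "0 \<in> K" by (rule subsetD[OF interior_of_subset K(2)])
  obtain U where U: "openin (Euclidean_space N) U" "0 \<in> U" "U \<subseteq> K"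
    using K(2) unfolding interior_of_def mem_Collect_eq by (elim exE conjE) (rule that)
  then obtain V where "open V" "U = V \<inter> {x. \<forall>i\<ge>N. x i = 0}"
    unfolding ES openin_subtopology open_openin[symmetric] by (elim exE conjE) (rule that)
  then show "\<exists>V. open V \<and> 0 \<in> V \<and> V \<inter> RN N \<subseteq> K"
    using U(2,3) by (intro exI[of _ V]) (simp add: topspace_Euclidean_space)
qed

text \<open>Supplies the positive \<open>R\<close> by which the concentration exponent divides: the
  body contains a small multiple of a unit vector of \<open>E\<close>. For \<open>k = N\<close> the
  subspace is \<open>{0}\<close> and the claim fails, hence the separate case \<open>n = N\<close>
  in the theorem.\<close>

lemma convex_body_proj_nontrivial:
  assumes K: "convex_body N K" and E: "E \<in> grassmannian N k" and k: "k < N"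
  shows "\<exists>x\<in>K. 0 < norm_N N (orth_proj N E x)"
proof -
  obtain b where b: "orthonormal N b N" "E = span (b ` {..<N - k})" by (rule grassmannian_basis[OF E])
  have o: "orthonormal N b (N - k)" by (rule orthonormal_mono[OF b(1)]) simp
  obtain V where V: "open V" "0 \<in> V" "V \<inter> RN N \<subseteq> K" using convex_bodyD(4)[OF K] by blast
  have "continuous_on UNIV (\<lambda>t::real. t *\<^sub>R b 0)"
    by (rule continuous_on_coordinatewise_then_product) (auto intro!: continuous_intros)
  then have "open ((\<lambda>t::real. t *\<^sub>R b 0) -` V)" using V(1) by (rule open_vimage[rotated])
  moreover have "0 \<in> (\<lambda>t::real. t *\<^sub>R b 0) -` V" using V(2) by simp
  ultimately obtain r where r: "r > 0" "ball 0 r \<subseteq> (\<lambda>t::real. t *\<^sub>R b 0) -` V"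
    using open_contains_ball by blast
  define t where "t = r / 2"
  have t: "t > 0" "t *\<^sub>R b 0 \<in> V" using r by (auto simp: t_def subset_iff)
  have b0: "b 0 \<in> E" unfolding b(2) using k by (intro span_base) auto
  have tE: "t *\<^sub>R b 0 \<in> E" using E b0 by (auto simp: grassmannian_def intro: subspace_scale)
  then have "t *\<^sub>R b 0 \<in> RN N" using E by (auto simp: grassmannian_def)
  then have tK: "t *\<^sub>R b 0 \<in> K" using t V(3) by blast
  have "orth_proj N E (t *\<^sub>R b 0) = t *\<^sub>R b 0"
    using span_orthonormal_expand[OF o, of "t *\<^sub>R b 0"] orth_proj_span[OF o] tE b(2) by metis
  moreover have "inner_N N (t *\<^sub>R b 0) (t *\<^sub>R b 0) = t * t"
    using orthonormalD(2)[OF b(1), of 0 0] k by (simp add: inner_N_scaleR_left inner_N_scaleR_right)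
  ultimately have "0 < norm_N N (orth_proj N E (t *\<^sub>R b 0))" using t(1) by (simp add: norm_N_def)
  then show ?thesis using tK by blast
qed

lemma radius_bound:
  assumes "compact K" "T \<subseteq> K" "T \<noteq> {}" "continuous_on K (\<lambda>x. norm_N N (f x))"
  shows "radius N (f ` T) \<le> c \<longleftrightarrow> (\<forall>x\<in>T. norm_N N (f x) \<le> c)"
proof -
  obtain x0 where "\<forall>x\<in>K. norm_N N (f x) \<le> norm_N N (f x0)"
    using continuous_attains_sup[OF assms(1) _ assms(4)] assms(2,3) by blast
  then have "bdd_above ((\<lambda>x. norm_N N (f x)) ` T)" using assms(2) by (auto simp: bdd_above_def)
  then show ?thesis
    unfolding radius_def image_image using assms(3) by (intro cSUP_le_iff)
qed

lemma ell_star_proj_nonneg: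
  assumes K: "compact K" "0 \<in> K" and E: "E \<in> grassmannian N k"
  shows "0 \<le> ell_star N (orth_proj N E ` K)"
proof -
  obtain b where b: "orthonormal N b N" "E = span (b ` {..<N - k})" by (rule grassmannian_basis[OF E])
  have o: "orthonormal N b (N - k)" by (rule orthonormal_mono[OF b(1)]) simp
  have "0 \<le> gsup {..<N - k} (coords N b K) g" for g
  proof -
    define h where "h x = (\<Sum>j<N - k. g j * inner_N N x (b j))" for x
    have "\<exists>x\<in>K. \<forall>z\<in>K. h z \<le> h x" unfolding h_def using K by (intro compact_attains_lincomb) auto
    then have "bdd_above (h ` K)" by (auto simp: bdd_above_def)
    from cSUP_upper[OF K(2) this] show ?thesis
      by (simp add: gsup_def coords_def image_image h_def)
  qed
  then have "0 \<le> (\<integral>g. gsup {..<N - k} (coords N b K) g \<partial>gauss {..<N - k})" by (intro integral_nonneg_AE AE_I2)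
  moreover have K0: "K \<noteq> {}" using K(2) by blast
  ultimately show ?thesis using integral_gsup_coords[OF o b(2) K(1) K0] by simp
qed

text \<open>In the small ball parameter \<open>12 * \<epsilon>\<close> the factor 6 cancels the 6
  from the length of the random direction. The remaining 2 turns the coefficient 2 of
  \<open>l\<close> in the claimed bound into the 4 of the concentration estimate.\<close>

lemma random_radius_numeric:
  fixes n k m :: nat and \<epsilon> R l L c :: real
  assumes k: "1 \<le> k" "k \<le> n" and m: "m = n - k + 1" and \<epsilon>: "0 < \<epsilon>" "\<epsilon> \<le> 1" and L: "1 \<le> L" and R: "R > 0"
    and c: "6 * sqrt L / \<epsilon> * sqrt (2 * real n / real m) * R + 2 * sqrt (real n) / (\<epsilon> * real m) * l < c"
    (is "?b < c") and l: "0 \<le> l"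
  shows "R < c"
    and "4 * l + 3 * (R * sqrt (2 * real m * L))
      < (12 * \<epsilon>) * sqrt (real m) * (sqrt (min (real m) (real k)) * (c - R) / (6 * sqrt (real k)))"
proof -
  define A where "A = sqrt L / \<epsilon> * sqrt (2 * real n / real m)"
  define D where "D = 2 * sqrt (real n) / (\<epsilon> * real m)"
  have m1: "1 \<le> m" "m \<le> n" and mr: "real m > 0" "real n > 0" "real k > 0" using k m by auto
  have "1 \<le> A"
  proof -
    have "1 * 1 \<le> (sqrt L / \<epsilon>) * sqrt (2 * real n / real m)"
    proof (rule mult_mono)
      have "\<epsilon> \<le> sqrt L" using \<epsilon> L by (meson order_trans real_sqrt_ge_one)
      then show "1 \<le> sqrt L / \<epsilon>" using \<epsilon> by (simp add: le_divide_eq)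
      have "1 \<le> 2 * real n / real m" using mr m1 by (simp add: le_divide_eq)
      then show "1 \<le> sqrt (2 * real n / real m)" by simp
    qed (use L \<epsilon> in auto)
    then show ?thesis by (simp add: A_def)
  qed
  then have AR: "R \<le> A * R" using R by simp
  have b: "?b = 6 * (A * R) + D * l" by (simp add: A_def D_def)
  have D0: "0 \<le> D" using \<epsilon> by (simp add: D_def)
  then have Dl: "0 \<le> D * l" using l by simp
  show "R < c" using c b AR Dl R by linarith
  \<comment> \<open>As \<open>A \<ge> 1\<close>, one of the six copies of \<open>A * R\<close>
    absorbs the \<open>R\<close> subtracted from \<open>c\<close>.\<close>
  have cR: "5 * (A * R) + D * l < c - R" using c b AR by linarith
  have frac: "real m / sqrt (real n) \<le> sqrt (real m) * sqrt (min (real m) (real k)) / sqrt (real k)"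
  proof -
    \<comment> \<open>Both \<open>m\<close> and \<open>k\<close> are at most \<open>n\<close>. This
      is the comparison that bounds the averaging loss \<open>sqrt (k / min m k)\<close> by
      \<open>sqrt (n / m)\<close>.\<close>
    have "real m * real k \<le> min (real m) (real k) * real n"
      using k m1 by (auto simp: min_def intro: mult_left_mono mult_mono simp: mult.commute[of "real m"])
    then have "real m * (real m * real k) \<le> real m * (min (real m) (real k) * real n)"
      by (intro mult_left_mono) auto
    then have "(real m)\<^sup>2 / real n \<le> real m * min (real m) (real k) / real k"
      using mr by (simp add: field_simps power2_eq_square)
    then have "sqrt ((real m)\<^sup>2 / real n) \<le> sqrt (real m * min (real m) (real k) / real k)"
      by (rule real_sqrt_le_mono)
    then show ?thesis by (simp add: real_sqrt_divide real_sqrt_mult)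
  qed
  have AD: "real m / sqrt (real n) * \<epsilon> * A = sqrt (2 * real m * L)" "real m / sqrt (real n) * \<epsilon> * D = 2"
  proof -
    have mm: "real m = sqrt (real m) * sqrt (real m)" using mr by simp
    have "real m / sqrt (real n) * \<epsilon> * A = sqrt L * (sqrt 2 * (real m / sqrt (real m)))"
      using mr \<epsilon> by (simp add: A_def real_sqrt_divide real_sqrt_mult)
    also have "real m / sqrt (real m) = sqrt (real m)" using mr by (simp add: real_div_sqrt)
    finally show "real m / sqrt (real n) * \<epsilon> * A = sqrt (2 * real m * L)" by (simp add: real_sqrt_mult)
    show "real m / sqrt (real n) * \<epsilon> * D = 2" using mr \<epsilon> by (simp add: D_def)
  qed
  have q: "0 < 2 * \<epsilon> * (real m / sqrt (real n))" using mr \<epsilon> by simp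
  have "4 * l + 3 * (R * sqrt (2 * real m * L)) \<le> 4 * l + 10 * (R * sqrt (2 * real m * L))"
    using R L by (intro add_left_mono mult_right_mono) auto
  also have "\<dots> = 2 * \<epsilon> * (real m / sqrt (real n)) * (5 * (A * R) + D * l)"
  proof -
    have "2 * \<epsilon> * (real m / sqrt (real n)) * (5 * (A * R) + D * l)
      = 10 * R * (real m / sqrt (real n) * \<epsilon> * A) + 2 * l * (real m / sqrt (real n) * \<epsilon> * D)"
      by (simp add: algebra_simps add_divide_distrib)
    then show ?thesis unfolding AD by simp
  qed
  also have "\<dots> < 2 * \<epsilon> * (real m / sqrt (real n)) * (c - R)"
    using cR q by (rule mult_strict_left_mono)
  also have "\<dots> \<le> 2 * \<epsilon> * (sqrt (real m) * sqrt (min (real m) (real k)) / sqrt (real k)) * (c - R)"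
    using frac \<epsilon> \<open>R < c\<close> by (intro mult_right_mono mult_left_mono) auto
  also have "\<dots> = (12 * \<epsilon>) * sqrt (real m) * (sqrt (min (real m) (real k)) * (c - R) / (6 * sqrt (real k)))"
    by simp
  finally show "4 * l + 3 * (R * sqrt (2 * real m * L))
      < (12 * \<epsilon>) * sqrt (real m) * (sqrt (min (real m) (real k)) * (c - R) / (6 * sqrt (real k)))" .
qed

lemma haar_radius_tail:
  fixes N n k m :: nat and \<epsilon> :: real
  assumes haar: "haar_grassmannian N n M" and E: "E \<in> grassmannian N k" and k: "1 \<le> k" "k \<le> n" "k < N"
    and K: "convex_body N K" and m: "m = n - k + 1" and \<epsilon>: "0 < \<epsilon>" "\<epsilon> \<le> 1 / exp 1"
    and c: "6 * sqrt (ln (1 / \<epsilon>)) / \<epsilon> * sqrt (2 * real n / real m) * radius N (orth_proj N E ` K)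
      + 2 * sqrt (real n) / (\<epsilon> * real m) * ell_star N (orth_proj N E ` K) < c"
  shows "emeasure M {F \<in> space M. \<exists>x\<in>K. x \<in> F \<and> 0 \<le> norm_N N x - c} \<le> ennreal ((120 * exp 5 * \<epsilon>) ^ m)"
    (is "emeasure M ?B \<le> _")
proof -
  interpret M: prob_space M by (rule haar_prob[OF haar])
  define R where "R = radius N (orth_proj N E ` K)"
  define l where "l = ell_star N (orth_proj N E ` K)"
  define L where "L = ln (1 / \<epsilon>)"
  \<comment> \<open>The largest admissible value: \<open>s \<le> k\<close> is required for the
    direction estimate, and \<open>s \<le> m\<close> lets \<open>exp (5 * s)\<close> be absorbed as
    \<open>exp 5 ^ m\<close>.\<close>
  define s where "s = min (real m) (real k)"
  have Kc: "compact K" "K \<subseteq> RN N" "0 \<in> K" by (rule convex_bodyD[OF K])+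
  have cont: "continuous_on K (\<lambda>x. norm_N N (orth_proj N E x))"
    unfolding norm_N_def inner_N_def
    by (intro continuous_on_real_sqrt continuous_on_sum continuous_on_mult continuous_on_orth_proj[OF E])
  have R_ge: "norm_N N (orth_proj N E x) \<le> R" if "x \<in> K" for x
    using radius_bound[OF Kc(1) subset_refl _ cont, of R] that by (auto simp: R_def)
  then have R: "R > 0" using convex_body_proj_nontrivial[OF K E k(3)] by force
  have l: "l \<ge> 0" unfolding l_def by (rule ell_star_proj_nonneg[OF Kc(1,3) E])
  have e1: "\<epsilon> \<le> 1" using \<epsilon> exp_ge_add_one_self[of "1::real"] by (simp add: le_divide_eq) (smt (verit) mult_le_cancel_left1)
  have "exp 1 \<le> 1 / \<epsilon>" using \<epsilon> by (simp add: field_simps)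
  then have "ln (exp 1) \<le> L" unfolding L_def using \<epsilon> by (subst ln_le_cancel_iff) auto
  then have L: "1 \<le> L" by simp
  \<comment> \<open>Chosen so that the concentration tail
    \<open>exp (- \<sigma>\<^sup>2 / (2 * R\<^sup>2))\<close> equals
    \<open>\<epsilon> ^ m\<close>.\<close>
  define \<sigma> where "\<sigma> = R * sqrt (2 * real m * L)"
  have \<sigma>: "\<sigma> \<ge> 0" using R L by (simp add: \<sigma>_def)
  have s: "1 \<le> s" "s \<le> real k" "s \<le> real m" using k m by (auto simp: s_def)
  note num = random_radius_numeric[OF k(1,2) m \<epsilon>(1) e1 L R c[folded R_def l_def L_def] l]
  have "ennreal (exp (- 5 * s)) * emeasure M ?B
    \<le> ennreal ((2 * (12 * \<epsilon>)) ^ (n - k + 1)) + ennreal (4 * exp (- \<sigma>\<^sup>2 / (2 * R\<^sup>2)))"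
    using num \<epsilon> \<sigma> s
    by (intro haar_long_vector[OF haar E k(1,2) Kc R R_ge]) (simp_all add: l_def[symmetric] \<sigma>_def s_def m)
  also have "exp (- \<sigma>\<^sup>2 / (2 * R\<^sup>2)) = \<epsilon> ^ m"
  proof -
    have "\<sigma>\<^sup>2 / (2 * R\<^sup>2) = real m * L" using R L by (simp add: \<sigma>_def power_mult_distrib)
    then have "- \<sigma>\<^sup>2 / (2 * R\<^sup>2) = real m * ln \<epsilon>" using \<epsilon> by (simp add: L_def ln_div)
    then show ?thesis using \<epsilon> by (simp add: exp_of_nat_mult)
  qed
  \<comment> \<open>The small ball gives \<open>24 * \<epsilon>\<close> as base and the tail four
    powers of a smaller one. The total factor 5 moves into the base since \<open>m \<ge> 1\<close>,
    and 5 * 24 = 120.\<close>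
  also have "ennreal ((2 * (12 * \<epsilon>)) ^ (n - k + 1)) + ennreal (4 * \<epsilon> ^ m) \<le> ennreal ((120 * \<epsilon>) ^ m)"
  proof -
    have "\<epsilon> ^ m \<le> (24 * \<epsilon>) ^ m" using \<epsilon> by (intro power_mono) auto
    then have "4 * \<epsilon> ^ m \<le> 4 * (24 * \<epsilon>) ^ m" by (rule mult_left_mono) simp
    then have "(24 * \<epsilon>) ^ m + 4 * \<epsilon> ^ m \<le> 5 * (24 * \<epsilon>) ^ m" by linarith
    also have "\<dots> \<le> 5 ^ m * (24 * \<epsilon>) ^ m"
    proof (rule mult_right_mono)
      show "5 \<le> (5::real) ^ m" by (rule self_le_power) (simp_all add: m)
    qed (use \<epsilon> in simp)
    also have "\<dots> = (5 * (24 * \<epsilon>)) ^ m" by (rule power_mult_distrib[symmetric])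
    also have "5 * (24 * \<epsilon>) = 120 * \<epsilon>" by simp
    finally have "ennreal ((24 * \<epsilon>) ^ m + 4 * \<epsilon> ^ m) \<le> ennreal ((120 * \<epsilon>) ^ m)" by (rule ennreal_leI)
    moreover have "ennreal ((24 * \<epsilon>) ^ m) + ennreal (4 * \<epsilon> ^ m) = ennreal ((24 * \<epsilon>) ^ m + 4 * \<epsilon> ^ m)"
      using \<epsilon> by (intro ennreal_plus[symmetric]) auto
    moreover have "2 * (12 * \<epsilon>) = 24 * \<epsilon>" by simp
    ultimately show ?thesis by (simp only: m)
  qed
  finally have "ennreal (exp (- 5 * s)) * ennreal (M.prob ?B) \<le> ennreal ((120 * \<epsilon>) ^ m)"
    by (simp only: M.emeasure_eq_measure)
  then have "ennreal (exp (- 5 * s) * M.prob ?B) \<le> ennreal ((120 * \<epsilon>) ^ m)"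
    by (subst ennreal_mult) auto
  then have "exp (- 5 * s) * M.prob ?B \<le> (120 * \<epsilon>) ^ m" using \<epsilon> by (subst (asm) ennreal_le_iff) auto
  then have "exp (5 * s) * (exp (- 5 * s) * M.prob ?B) \<le> exp (5 * s) * (120 * \<epsilon>) ^ m"
    by (rule mult_left_mono) simp
  then have "M.prob ?B \<le> exp (5 * s) * (120 * \<epsilon>) ^ m"
    by (simp add: mult.assoc[symmetric] exp_add[symmetric])
  also have "\<dots> \<le> exp 5 ^ m * (120 * \<epsilon>) ^ m"
    using s(3) \<epsilon> by (intro mult_right_mono) (auto simp: exp_of_nat_mult[symmetric])
  also have "\<dots> = (120 * exp 5 * \<epsilon>) ^ m" by (simp add: power_mult_distrib)
  finally show ?thesis by (simp add: M.emeasure_eq_measure ennreal_leI)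
qed

text \<open>The tail estimate is available only for \<open>c\<close> strictly above
  \<open>b\<close>, so the event that the radius exceeds \<open>b\<close> is written as an
  increasing union over \<open>c = b + 1 / (j + 1)\<close>; continuity from below keeps the same
  bound \<open>q\<close>.\<close>

lemma haar_random_radius:
  assumes haar: "haar_grassmannian N n M" and K: "compact K" "K \<subseteq> RN N" "0 \<in> K" and q: "0 \<le> q"
    and tail: "\<And>c. b < c \<Longrightarrow> emeasure M {F \<in> space M. \<exists>x\<in>K. x \<in> F \<and> 0 \<le> norm_N N x - c} \<le> ennreal q"
  shows "1 - q \<le> measure M {F \<in> space M. random_radius N K F \<le> b}"
proof -
  interpret M: prob_space M by (rule haar_prob[OF haar])
  define B where "B j = {F \<in> space M. \<exists>x\<in>K. x \<in> F \<and> 0 \<le> norm_N N x - (b + 1 / real (Suc j))}" for j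
  have B: "B j \<in> sets M" for j
    unfolding B_def
    by (intro measurable_subspace_meets[OF haar K(1,2) measurable_ident_sets[OF refl]] borel_measurable_const
        continuous_on_diff continuous_on_norm_N continuous_on_const)
  have "incseq B"
  proof (rule incseq_SucI)
    fix j
    have "1 / real (Suc (Suc j)) \<le> 1 / real (Suc j)" by (intro divide_left_mono) auto
    then show "B j \<subseteq> B (Suc j)" unfolding B_def by force
  qed
  then have "emeasure M (\<Union>j. B j) = (SUP j. emeasure M (B j))"
    using B by (intro SUP_emeasure_incseq[symmetric]) auto
  also have "\<dots> \<le> ennreal q"
    unfolding B_def by (intro SUP_least tail) simp
  finally have Bq: "M.prob (\<Union>j. B j) \<le> q" using q by (simp add: M.emeasure_eq_measure)
  have "random_radius N K F \<le> b \<longleftrightarrow> F \<notin> (\<Union>j. B j)" if F: "F \<in> space M" for F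
  proof -
    have "0 \<in> F" using F by (auto simp: haar_space[OF haar] grassmannian_def subspace_0)
    then have "random_radius N K F \<le> b \<longleftrightarrow> (\<forall>x\<in>F \<inter> K. norm_N N x \<le> b)"
      using radius_bound[of K "F \<inter> K" N "\<lambda>x. x" b] K continuous_on_norm_N[of K N]
      by (auto simp: random_radius_def)
    also have "\<dots> \<longleftrightarrow> F \<notin> (\<Union>j. B j)"
    proof -
      have *: "(\<exists>j. 0 \<le> norm_N N x - (b + 1 / real (Suc j))) \<longleftrightarrow> b < norm_N N x" for x
      proof
        assume "\<exists>j. 0 \<le> norm_N N x - (b + 1 / real (Suc j))"
        then obtain j where "b + 1 / real (Suc j) \<le> norm_N N x" by auto
        moreover have "0 < 1 / real (Suc j)" by simp
        ultimately show "b < norm_N N x" by linarith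
      next
        assume "b < norm_N N x"
        then obtain j where "inverse (real (Suc j)) < norm_N N x - b"
          using reals_Archimedean[of "norm_N N x - b"] by auto
        then show "\<exists>j. 0 \<le> norm_N N x - (b + 1 / real (Suc j))"
          by (intro exI[of _ j]) (simp add: inverse_eq_divide)
      qed
      have "F \<in> (\<Union>j. B j) \<longleftrightarrow> (\<exists>x\<in>K. x \<in> F \<and> (\<exists>j. 0 \<le> norm_N N x - (b + 1 / real (Suc j))))"
        using F unfolding B_def by blast
      then show ?thesis unfolding * not_le[symmetric] by blast
    qed
    finally show ?thesis .
  qed
  then have "{F \<in> space M. random_radius N K F \<le> b} = space M - (\<Union>j. B j)" by auto
  then have "measure M {F \<in> space M. random_radius N K F \<le> b} = 1 - M.prob (\<Union>j. B j)"
    using B by (simp add: M.prob_compl)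
  then show ?thesis using Bq by simp
qed

theorem theorem1p1:
  shows "\<exists>C \<gamma> :: real. C \<ge> 2 \<and> 0 < \<gamma> \<and> \<gamma> < 1 \<and>
    (\<forall>\<epsilon> :: real. 0 < \<epsilon> \<and> \<epsilon> \<le> 1 / (2 * C) \<longrightarrow>
      (\<forall>(N :: nat) (n :: nat) (K :: (nat \<Rightarrow> real) set) (M :: (nat \<Rightarrow> real) set measure).
        1 \<le> n \<and> n \<le> N \<and> convex_body N K \<and> haar_grassmannian N n M \<longrightarrow>
        (\<forall>(k :: nat) (E :: (nat \<Rightarrow> real) set).
          1 \<le> k \<and> k \<le> n \<and> E \<in> grassmannian N k \<longrightarrow>
          measure M {F \<in> space M. random_radius N K F \<le>
              (6 * sqrt (ln (1 / \<epsilon>)) / \<epsilon> * sqrt (2 * real n / real (n - k + 1)))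
                * radius N (orth_proj N E ` K)
              + 2 * sqrt (real n) / (\<epsilon> * real (n - k + 1)) * ell_star N (orth_proj N E ` K)}
            \<ge> 1 - 3 * (C * \<epsilon>) ^ (n - k + 1) - real k * exp (- \<gamma> * real n))))"
proof (rule exI[of _ "120 * exp 5"], rule exI[of _ "1 / 2"], intro conjI allI impI)
  \<comment> \<open>The witness \<open>120 * exp 5\<close> is the base found in
    \<open>haar_radius_tail\<close>; 1 / 2 is one choice of \<gamma> in (0, 1).\<close>
  have e5: "1 \<le> exp (5::real)" by simp
  then show "2 \<le> 120 * exp (5::real)" by linarith
  fix \<epsilon> :: real and N n :: nat and K M and k :: nat and E
  assume "0 < \<epsilon> \<and> \<epsilon> \<le> 1 / (2 * (120 * exp 5))"
  then have \<epsilon>: "0 < \<epsilon>" "\<epsilon> \<le> 1 / (240 * exp 5)" by auto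
  assume "1 \<le> n \<and> n \<le> N \<and> convex_body N K \<and> haar_grassmannian N n M"
  then have n: "1 \<le> n" "n \<le> N" and K: "convex_body N K" and haar: "haar_grassmannian N n M" by auto
  assume "1 \<le> k \<and> k \<le> n \<and> E \<in> grassmannian N k"
  then have k: "1 \<le> k" "k \<le> n" and E: "E \<in> grassmannian N k" by auto
  define m where "m = n - k + 1"
  define R where "R = radius N (orth_proj N E ` K)"
  define l where "l = ell_star N (orth_proj N E ` K)"
  define b where "b = 6 * sqrt (ln (1 / \<epsilon>)) / \<epsilon> * sqrt (2 * real n / real m) * R
    + 2 * sqrt (real n) / (\<epsilon> * real m) * l"
  define q where "q = (120 * exp 5 * \<epsilon>) ^ m"
  have q: "q \<ge> 0" using \<epsilon> by (simp add: q_def)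
  have Kc: "compact K" "K \<subseteq> RN N" "0 \<in> K" by (rule convex_bodyD[OF K])+
  have e1: "\<epsilon> \<le> 1 / exp 1"
  proof -
    have "1 / (240 * exp 5) \<le> 1 / (exp 1 :: real)"
    proof (rule divide_left_mono)
      have "exp 1 \<le> exp (5::real)" by simp
      then show "exp 1 \<le> 240 * exp (5::real)" using e5 by linarith
    qed auto
    then show ?thesis using \<epsilon> by linarith
  qed
  have "1 - q \<le> measure M {F \<in> space M. random_radius N K F \<le> b}"
  proof (cases "n < N")
    case True
    then have "k < N" using k by simp
    then show ?thesis
      unfolding q_def b_def R_def l_def
      by (intro haar_random_radius[OF haar Kc] haar_radius_tail[OF haar E k _ K m_def \<epsilon>(1) e1])
        (use \<epsilon> in auto)
  next
    \<comment> \<open>Here the random subspace is \<open>{0}\<close>, so its radius is 0 and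
      \<open>b \<ge> 0\<close> suffices. This includes \<open>k = N\<close>, where the projected
      body has radius 0.\<close>
    case False
    then have nN: "n = N" using n by simp
    interpret M: prob_space M by (rule haar_prob[OF haar])
    have "norm_N N (orth_proj N E 0) \<le> R"
    proof -
      have "continuous_on K (\<lambda>x. norm_N N (orth_proj N E x))"
        unfolding norm_N_def inner_N_def
        by (intro continuous_on_real_sqrt continuous_on_sum continuous_on_mult continuous_on_orth_proj[OF E])
      then show ?thesis using radius_bound[OF Kc(1) subset_refl, of N "orth_proj N E" R] Kc(3) by (auto simp: R_def)
    qed
    then have R0: "R \<ge> 0" using norm_N_nonneg order_trans by blast
    have l0: "l \<ge> 0" unfolding l_def by (rule ell_star_proj_nonneg[OF Kc(1,3) E])
    have "1 \<le> 1 / \<epsilon>" using \<epsilon> e1 e5 by (smt (verit) le_divide_eq_1_pos exp_ge_add_one_self divide_le_eq_1)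
    then have b0: "b \<ge> 0" using \<epsilon> R0 l0 by (simp add: b_def)
    have "random_radius N K F \<le> b" if F: "F \<in> space M" for F
    proof -
      obtain f where "F = span (f ` {..<N - n})"
        using grassmannian_basis F haar_space[OF haar] by metis
      then have "F = {0}" by (simp add: nN)
      then show ?thesis using b0 Kc(3) by (simp add: random_radius_def radius_def norm_N_def)
    qed
    then have "{F \<in> space M. random_radius N K F \<le> b} = space M" by blast
    then show ?thesis using q by (simp add: M.prob_space)
  qed
  moreover have "0 \<le> real k * exp (- (1 / 2) * real n)" by simp
  ultimately show "1 - 3 * (120 * exp 5 * \<epsilon>) ^ (n - k + 1) - real k * exp (- (1 / 2) * real n)
    \<le> measure M {F \<in> space M. random_radius N K F \<le>
          (6 * sqrt (ln (1 / \<epsilon>)) / \<epsilon> * sqrt (2 * real n / real (n - k + 1)))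
            * radius N (orth_proj N E ` K)
          + 2 * sqrt (real n) / (\<epsilon> * real (n - k + 1)) * ell_star N (orth_proj N E ` K)}"
    using q unfolding b_def R_def l_def m_def[symmetric] q_def[symmetric] by linarith
qed simp_all

end
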